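(* Let $\tau_{1,2}(n)=\sum_{ab^2=n}1$. For every $\varepsilon>0$, as $x\to\infty$, $$\sum_{m,n\le x}\tau_{1,2}(mn)=C_1x^2+C_2x^{3/2}+O\bigl(x^{10/7+\varepsilon}\bigr),$$ where $C_1=2.995\ldots$ and $C_2=-5.404\ldots$ are computable constants (given explicitly in the context).
   Context: For a positive integer $n$, $\tau_{1,2}(n)$ is the number of pairs $(a,b)$ of positive integers with $ab^2=n$. The sum runs over all pairs of positive integers $m\le x$, $n\le x$. The implied constant may depend on $\varepsilon$. With $p$ running over primes and $\zeta$ the Riemann zeta-function, the constants are $$C_1=\prod_p(1-p^{-1})^2\sum_{a,b=0}^\infty\frac{\tau_{1,2}(p^{a+b})}{p^{a+b}},\qquad C_2=2\zeta(1/2)\prod_p(1-p^{-1})^2(1-p^{-1/2})\sum_{a,b=0}^\infty\frac{\tau_{1,2}(p^{a+b})}{p^{a+b/2}}.$$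
   Formalization: The printed value C_2 = -5.404... is wrong for the given explicit formula, whose value is about -5.41396; only the correct digits C_2 = -5.4... (-5.5 < C_2 <= -5.4) are asserted. "Computable" is read as given by the explicit formulas. *)

theory Defs
  imports "HOL-Complex_Analysis.Complex_Analysis" "HOL-Library.Landau_Symbols"
begin

definition tau12 :: "nat \<Rightarrow> nat" where
  "tau12 n = card {(a, b). 0 < a \<and> 0 < b \<and> a * b ^ 2 = n}"

text \<open>
  The Riemann zeta function at \<open>s \<noteq> 1\<close> is the value at \<open>s\<close> of the analytic continuation of
  the Dirichlet series, taken in any half-plane (with \<open>1\<close> removed) containing \<open>s\<close>. The value
  does not depend on the half-plane (\<open>zeta_eqI\<close>), and \<open>zeta_continuation\<close> gives a continuation
  to \<open>Re s > 0\<close>. At the pole \<open>s = 1\<close> the value is unspecified.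
\<close>
definition zeta :: "complex \<Rightarrow> complex" where
  "zeta s = (THE w. \<exists>f r. r < Re s \<and> f holomorphic_on ({z. r < Re z} - {1}) \<and>
     (\<forall>z. 1 < Re z \<longrightarrow> (\<lambda>n. of_nat (Suc n) powr (- z)) sums f z) \<and> f s = w)"

lemma zeta_eqI:
  assumes f: "f holomorphic_on ({z. r < Re z} - {1})"
    and fs: "\<And>z. 1 < Re z \<Longrightarrow> (\<lambda>n. of_nat (Suc n) powr (- z)) sums f z"
    and s: "r < Re s" "s \<noteq> 1"
  shows "zeta s = f s"
  unfolding zeta_def
proof (rule the_equality)
  show "\<exists>g q. q < Re s \<and> g holomorphic_on ({z. q < Re z} - {1}) \<and>
     (\<forall>z. 1 < Re z \<longrightarrow> (\<lambda>n. of_nat (Suc n) powr (- z)) sums g z) \<and> g s = f s"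
    using assms by blast
next
  fix w
  assume "\<exists>g q. q < Re s \<and> g holomorphic_on ({z. q < Re z} - {1}) \<and>
     (\<forall>z. 1 < Re z \<longrightarrow> (\<lambda>n. of_nat (Suc n) powr (- z)) sums g z) \<and> g s = w"
  then obtain g q where g: "q < Re s" "g holomorphic_on ({z. q < Re z} - {1})"
    "\<And>z. 1 < Re z \<Longrightarrow> (\<lambda>n. of_nat (Suc n) powr (- z)) sums g z" "g s = w"
    by blast
  define m where "m = max q r"
  have "g s = f s"
  proof (rule analytic_continuation_open
      [of "{z. max 1 m < Re z}" "{z. m < Re z} - {1}" g f s])
    show "open {z. max 1 m < Re z}" by (rule open_halfspace_Re_gt)
    show "open ({z. m < Re z} - {1})" by (intro open_delete open_halfspace_Re_gt)
    have "of_real (max 1 m + 1) \<in> {z. max 1 m < Re z}"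
      by (auto simp: max_def)
    then show "{z. max 1 m < Re z} \<noteq> {}" by blast
    show "connected ({z. m < Re z} - {1})"
      by (intro connected_open_delete open_halfspace_Re_gt convex_connected
          convex_halfspace_Re_gt) simp
    show "{z. max 1 m < Re z} \<subseteq> {z. m < Re z} - {1}" by auto
    show "g holomorphic_on {z. m < Re z} - {1}"
      by (rule holomorphic_on_subset[OF g(2)]) (auto simp: m_def)
    show "f holomorphic_on {z. m < Re z} - {1}"
      by (rule holomorphic_on_subset[OF f]) (auto simp: m_def)
    show "g z = f z" if "z \<in> {z. max 1 m < Re z}" for z
      using that g(3) fs by (auto intro: sums_unique2)
    show "s \<in> {z. m < Re z} - {1}" using s g(1) by (auto simp: m_def)
  qed
  with g(4) show "w = f s" by simp
qed

lemma zeta_continuation: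
  obtains f where "f holomorphic_on ({z. 0 < Re z} - {1})"
    "\<And>z. 1 < Re z \<Longrightarrow> (\<lambda>n. of_nat (Suc n) powr (- z)) sums f z"
proof -
  define S where "S = {z. 0 < Re z} - {1::complex}"
  define t :: "nat \<Rightarrow> complex \<Rightarrow> complex"
    where "t n z = of_nat (Suc n) powr (- z)" for n z
  define u :: "nat \<Rightarrow> complex \<Rightarrow> complex"
    where "u n z = of_nat (Suc n) powr (1 - z) / (1 - z)" for n z
  define g where "g n z = t n z - (u (Suc n) z - u n z)" for n z
  have openS: "open S"
    unfolding S_def by (intro open_delete open_halfspace_Re_gt)
  have bound: "norm (g n z) \<le> norm z * real (Suc n) powr (- Re z - 1)" if z: "z \<in> S" for n z
  proof -
    define a where "a = real (Suc n)"
    have a: "a > 0" by (simp add: a_def)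
    define T where "T = closed_segment (of_real a) (of_real (a + 1) :: complex)"
    have T: "\<exists>v. a \<le> v \<and> v \<le> a + 1 \<and> y = of_real v" if "y \<in> T" for y
      using that unfolding T_def closed_segment_of_real closed_segment_eq_real_ivl by auto
    have Tnn: "y \<notin> \<real>\<^sub>\<le>\<^sub>0" if "y \<in> T" for y
      using T[OF that] a by auto
    have aT: "of_real a \<in> T" "of_real (a + 1) \<in> T"
      by (simp_all add: T_def)
    let ?B = "norm z * a powr (- Re z - 1)"
    have d1: "norm (y powr (- z) - of_real a powr (- z)) \<le> ?B" if y: "y \<in> T" for y
    proof -
      have "norm (y powr (- z) - of_real a powr (- z)) \<le> ?B * norm (y - of_real a)"
      proof (rule field_differentiable_bound[where S = T and f' = "\<lambda>y. - z * y powr (- z - 1)"])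
        show "convex T" by (simp add: T_def)
        show "((\<lambda>y. y powr - z) has_field_derivative - z * x powr (- z - 1)) (at x within T)"
          if "x \<in> T" for x
          using has_field_derivative_powr[OF Tnn[OF that]] has_field_derivative_at_within by blast
        show "norm (- z * x powr (- z - 1)) \<le> ?B" if x: "x \<in> T" for x
        proof -
          obtain v where v: "a \<le> v" "x = of_real v" using T[OF x] by blast
          have "norm (x powr (- z - 1)) = v powr (- Re z - 1)"
            using v a by (simp add: norm_powr_real_powr)
          also have "\<dots> \<le> a powr (- Re z - 1)"
            using v a z by (intro powr_mono2') (auto simp: S_def)
          finally show ?thesis by (simp add: norm_mult mult_left_mono)
        qed
      qed (use y aT in auto)
      also have "\<dots> \<le> ?B * 1"
      proof (rule mult_left_mono)
        obtain v where v: "a \<le> v" "v \<le> a + 1" "y = of_real v" using T[OF y] by blast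
        have "norm (y - of_real a) = \<bar>v - a\<bar>"
          unfolding v(3) of_real_diff[symmetric] norm_of_real ..
        with v show "norm (y - of_real a) \<le> 1" by simp
      qed simp
      finally show ?thesis by simp
    qed
    define \<phi> where "\<phi> y = y * of_real a powr (- z) - y powr (1 - z) / (1 - z)" for y :: complex
    have "norm (\<phi> (of_real (a + 1)) - \<phi> (of_real a)) \<le> ?B * norm (of_real (a + 1) - of_real a :: complex)"
    proof (rule field_differentiable_bound[where S = T
          and f' = "\<lambda>y. of_real a powr (- z) - y powr (- z)"])
      show "convex T" by (simp add: T_def)
      have z1: "1 - z \<noteq> 0" using z by (auto simp: S_def)
      show "(\<phi> has_field_derivative of_real a powr - z - x powr - z) (at x within T)"
        if "x \<in> T" for x
      proof -
        have "((\<lambda>y. y powr (1 - z)) has_field_derivative (1 - z) * x powr (- z)) (at x within T)"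
          using has_field_derivative_at_within[OF has_field_derivative_powr[OF Tnn[OF that], of "1 - z"]]
          by simp
        from DERIV_cdivide[OF this, of "1 - z"] z1
        have "((\<lambda>y. y powr (1 - z) / (1 - z)) has_field_derivative x powr (- z)) (at x within T)"
          by simp
        moreover have "((\<lambda>y. y * of_real a powr (- z)) has_field_derivative of_real a powr (- z))
            (at x within T)"
          by (auto intro!: derivative_eq_intros)
        ultimately show ?thesis unfolding \<phi>_def[abs_def] by (intro DERIV_diff)
      qed
      show "norm (of_real a powr - z - x powr - z) \<le> ?B" if "x \<in> T" for x
        using d1[OF that] by (simp add: norm_minus_commute)
    qed (use aT in auto)
    moreover have "of_real a = (of_nat (Suc n) :: complex)"
      "of_real (a + 1) = (of_nat (Suc (Suc n)) :: complex)"
      unfolding a_def by simp_all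
    moreover have "g n z = \<phi> (of_nat (Suc (Suc n))) - \<phi> (of_nat (Suc n))"
      using calculation(2) by (simp add: g_def t_def u_def \<phi>_def algebra_simps)
    ultimately show ?thesis by (simp add: a_def)
  qed
  have diff: "g n field_differentiable at z" if z: "z \<in> S" for n z
  proof -
    have "(\<lambda>z. of_nat (Suc n) powr (- z) - (of_nat (Suc (Suc n)) powr (1 - z) / (1 - z) -
        of_nat (Suc n) powr (1 - z) / (1 - z))) holomorphic_on S"
      by (intro holomorphic_intros) (auto simp: S_def)
    then have "g n holomorphic_on S"
      by (simp add: g_def[abs_def] t_def u_def)
    with z openS show ?thesis
      by (simp add: holomorphic_on_imp_differentiable_at)
  qed
  obtain G where G: "\<And>z. z \<in> S \<Longrightarrow> (\<lambda>n. g n z) sums G z"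
    "\<And>z. z \<in> S \<Longrightarrow> G field_differentiable at z"
  proof (rule series_differentiable_comparison_complex[OF openS diff])
    fix z assume z: "z \<in> S"
    define d where "d = Re z / 2"
    have d: "d > 0" using z by (simp add: d_def S_def)
    define h :: "nat \<Rightarrow> complex"
      where "h n = of_real ((norm z + d) * real (Suc n) powr (- d - 1))" for n
    have "summable (\<lambda>n. real n powr (- d - 1))"
      by (subst summable_real_powr_iff) (use d in auto)
    then have "summable (\<lambda>n. (norm z + d) * real (Suc n) powr (- d - 1))"
      by (intro summable_mult) (subst summable_Suc_iff)
    then have "summable h"
      unfolding h_def by (rule summable_of_real)
    moreover have "range h \<subseteq> \<real>\<^sub>\<ge>\<^sub>0"
      using d by (auto simp: h_def intro!: mult_nonneg_nonneg simp del: of_real_mult)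
    moreover have "norm (g n y) \<le> norm (h n)" if y: "y \<in> ball z d \<inter> S" for n y
    proof -
      have zy: "norm (z - y) < d" using y by (simp add: dist_norm)
      have "norm y \<le> norm z + d"
        using zy norm_triangle_ineq3[of z y] by linarith
      moreover have "d \<le> Re y"
        using zy abs_Re_le_cmod[of "z - y"] by (simp add: d_def)
      then have "real (Suc n) powr (- Re y - 1) \<le> real (Suc n) powr (- d - 1)"
        by (intro powr_mono) auto
      ultimately have "norm y * real (Suc n) powr (- Re y - 1)
          \<le> (norm z + d) * real (Suc n) powr (- d - 1)"
        using d by (intro mult_mono) auto
      also have "\<dots> = norm (h n)"
        unfolding h_def norm_of_real using d by (intro abs_of_nonneg[symmetric]) simp
      finally show ?thesis using bound[of y n] y by simp
    qed
    ultimately have "summable h \<and> range h \<subseteq> \<real>\<^sub>\<ge>\<^sub>0 \<and>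
        (\<forall>\<^sub>F n in sequentially. \<forall>y\<in>ball z d \<inter> S. norm (g n y) \<le> norm (h n))"
      by (intro conjI always_eventually allI ballI)
    with d show "\<exists>d (h :: nat \<Rightarrow> complex). 0 < d \<and> summable h \<and> range h \<subseteq> \<real>\<^sub>\<ge>\<^sub>0 \<and>
        (\<forall>\<^sub>F n in sequentially. \<forall>y\<in>ball z d \<inter> S. norm (g n y) \<le> norm (h n))"
      by blast
  qed auto
  show thesis
  proof (rule that[of "\<lambda>z. G z - 1 / (1 - z)"])
    have "G holomorphic_on S"
      using G(2) by (auto simp: holomorphic_on_def field_differentiable_at_within)
    then have "(\<lambda>z. G z - 1 / (1 - z)) holomorphic_on S"
      by (intro holomorphic_intros) (auto simp: S_def)
    then show "(\<lambda>z. G z - 1 / (1 - z)) holomorphic_on {z. 0 < Re z} - {1}"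
      by (simp add: S_def)
  next
    fix z :: complex assume z: "1 < Re z"
    have "(\<lambda>n. of_nat n powr (1 - z) :: complex) \<longlonglongrightarrow> 0"
      by (rule tendsto_neg_powr_complex_of_nat)
        (use z in \<open>auto intro: filterlim_ident\<close>)
    then have "(\<lambda>n. of_nat (Suc n) powr (1 - z) / (1 - z) :: complex) \<longlonglongrightarrow> 0"
      by (intro tendsto_divide_zero) (rule LIMSEQ_Suc)
    then have "(\<lambda>n. u n z) \<longlonglongrightarrow> 0"
      by (simp add: u_def)
    then have "(\<lambda>n. u (Suc n) z - u n z) sums (0 - u 0 z)"
      by (rule telescope_sums)
    moreover have "(\<lambda>n. g n z) sums G z"
      using z by (intro G) (auto simp: S_def)
    ultimately have "(\<lambda>n. g n z + (u (Suc n) z - u n z)) sums (G z + (0 - u 0 z))"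
      by (intro sums_add)
    then show "(\<lambda>n. of_nat (Suc n) powr (- z)) sums (G z - 1 / (1 - z))"
      by (simp add: g_def t_def u_def)
  qed
qed

definition C1 :: real where
  "C1 = (\<Prod>p. if prime p then
      (1 - 1 / real p) ^ 2 *
      (\<Sum>\<^sub>\<infinity>(a, b)\<in>(UNIV :: (nat \<times> nat) set). real (tau12 (p ^ (a + b))) / real p ^ (a + b))
    else 1)"

text \<open>\<open>Re\<close> only casts the real number \<open>zeta (1 / 2)\<close> to type \<^typ>\<open>real\<close>.
  The local factor at \<open>p\<close> simplifies to \<open>1 + 1 / (sqrt p * (p + 1))\<close>, so the product converges
  slowly; numerically \<open>C2 = -5.41396...\<close>.\<close>
definition C2 :: real where
  "C2 = 2 * Re (zeta (1 / 2)) * (\<Prod>p. if prime p then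
      (1 - 1 / real p) ^ 2 * (1 - real p powr (- 1 / 2)) *
      (\<Sum>\<^sub>\<infinity>(a, b)\<in>(UNIV :: (nat \<times> nat) set).
         real (tau12 (p ^ (a + b))) / real p powr (real a + real b / 2))
    else 1)"

end

theory Submission
  imports Defs "HOL-Real_Asymp.Real_Asymp"
begin

text \<open>
  Why the asymptotic formula holds. In two variables, the series of \<open>\<tau>(mn)\<close> (with
  \<open>\<tau>\<close> for \<^const>\<open>tau12\<close>) is a product over primes whose factor, in \<open>u = p\<^sup>-\<^sup>s\<close> and
  \<open>v = p\<^sup>-\<^sup>w\<close>, is
    \<open>(1 + uv - u\<^sup>2v - uv\<^sup>2) / ((1 - u)(1 - u\<^sup>2)(1 - v)(1 - v\<^sup>2))\<close>.
  The denominators belong to \<open>\<tau>(m)\<close> and \<open>\<tau>(n)\<close>. Hence \<open>\<tau>(mn)\<close> is the sum of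
  \<open>f(d,e) \<tau>(m/d) \<tau>(n/e)\<close> over \<open>d | m\<close> and \<open>e | n\<close>, where \<open>f\<close> takes the values
  \<open>0, 1, -1\<close> and is read off from the numerator (\<open>tau12_mult\<close>). Summing over \<open>m, n \<le> x\<close>
  gives the sum of \<open>f(d,e) T(x/d) T(x/e)\<close>, where \<open>T\<close> is the summatory function of \<open>\<tau>\<close>.

  Dirichlet's hyperbola method gives \<open>T(y) = \<zeta>(2) y + \<zeta>(1/2) y\<^bsup>1/2\<^esup> + O(y\<^bsup>1/3\<^esup>)\<close>. The
  point that makes the rest short is that this error bound, and the cruder
  \<open>T(y) = \<zeta>(2) y + O(y\<^bsup>2/3\<^esup>)\<close>, hold for all \<open>y > 0\<close>, also where \<open>T(y) = 0\<close>
  (\<open>summatory_tau12_bounds\<close>). So no sum over \<open>(d,e)\<close> has to be truncated. With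
  \<open>T(y) = \<zeta>(2) y + R(y)\<close> the product \<open>T(x/d) T(x/e)\<close> splits into the term of order \<open>x\<^sup>2\<close>, two
  mixed terms, which contain the terms of order \<open>x\<^bsup>3/2\<^esup>\<close>, and \<open>R(x/d) R(x/e)\<close>. The remaining
  parts are bounded by \<open>x\<^bsup>4/3\<^esup>\<close> times the sums of \<open>|f(d,e)| d\<^sup>-\<^sup>s e\<^sup>-\<^sup>w\<close> at
  \<open>(s,w) = (1,1/3), (1/3,1), (2/3,2/3)\<close>. These converge since \<open>f\<close> is carried by the exponent pairs
  \<open>(1,1), (2,1), (1,2)\<close>, so that only \<open>s + w > 1\<close>, \<open>2s + w > 1\<close> and \<open>s + 2w > 1\<close> are required.
  The error is therefore even \<open>O(x\<^bsup>4/3\<^esup>)\<close> (\<open>double_sum_error\<close>), which is below the exponent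
  \<open>10/7\<close>. Comparing Euler products identifies the coefficients with \<open>C1\<close> and \<open>C2\<close>
  (\<open>C1_eq\<close>, \<open>C2_eq\<close>).

  For the numerical values the Euler products are sped up by splitting off \<open>\<zeta>(2)\<^sup>3\<close> and
  \<open>\<zeta>(3/2)\<close>. The remaining factors lie below 1 by about \<open>2p\<^sup>-\<^sup>3\<close> and \<open>p\<^bsup>-5/2\<^esup>\<close>. The primes up to
  100 are multiplied out in rounded integer arithmetic, and the tail is dominated by a telescoping
  sum over odd numbers. The values \<open>\<zeta>(1/2)\<close> and \<open>\<zeta>(3/2)\<close> come from monotone corrections of their
  partial sums.
\<close>

section \<open>Values of \<open>tau12\<close> from prime powers\<close>

text \<open>
  The value of \<^const>\<open>tau12\<close> at the \<open>i\<close>-th power of a prime: a square divisor of it is the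
  choice of an even exponent up to \<open>i\<close>.
\<close>
definition even_exponents :: "nat \<Rightarrow> nat" where
  "even_exponents i = i div 2 + 1"

lemma tau12_eq_card_square_divisors:
  assumes "n > 0"
  shows "tau12 n = card {b. b\<^sup>2 dvd n}"
proof -
  have "bij_betw snd {(a, b). 0 < a \<and> 0 < b \<and> a * b ^ 2 = n} {b. b\<^sup>2 dvd n}"
    unfolding bij_betw_def
  proof
    show "inj_on snd {(a, b). 0 < a \<and> 0 < b \<and> a * b ^ 2 = n}"
      by (auto simp: inj_on_def)
    show "snd ` {(a, b). 0 < a \<and> 0 < b \<and> a * b ^ 2 = n} = {b. b\<^sup>2 dvd n}"
    proof (intro equalityI subsetI)
      fix b assume "b \<in> {b. b\<^sup>2 dvd n}"
      then obtain a where a: "n = b\<^sup>2 * a" by (auto elim: dvdE)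
      with assms have "a > 0" "b > 0" by (auto intro!: Nat.gr0I)
      with a have "(a, b) \<in> {(a, b). 0 < a \<and> 0 < b \<and> a * b ^ 2 = n}" by (simp add: mult.commute)
      then show "b \<in> snd ` {(a, b). 0 < a \<and> 0 < b \<and> a * b ^ 2 = n}" by force
    qed auto
  qed
  then show ?thesis unfolding tau12_def by (rule bij_betw_same_card)
qed

text \<open>
  A square divisor of \<open>p ^ i * m\<close> is uniquely one of \<open>p ^ i\<close> times one of \<open>m\<close>. This single step
  replaces a general theory of multiplicative functions: it is iterated over the primes below.
\<close>
lemma tau12_prime_power_mult:
  assumes p: "prime p" and m: "\<not> p dvd m" "m > 0"
  shows "tau12 (p ^ i * m) = even_exponents i * tau12 m"
proof -
  have p0: "p > 0" using p by (simp add: prime_gt_0_nat)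
  have "bij_betw (\<lambda>(j, b). p ^ j * b) ({..i div 2} \<times> {b. b\<^sup>2 dvd m}) {b. b\<^sup>2 dvd p ^ i * m}"
    unfolding bij_betw_def
  proof
    have nd: "\<not> p dvd b" if "b\<^sup>2 dvd m" for b
    proof
      assume "p dvd b"
      then have "p dvd b\<^sup>2" by (simp add: power2_eq_square)
      then show False using that m dvd_trans by blast
    qed
    show "inj_on (\<lambda>(j, b). p ^ j * b) ({..i div 2} \<times> {b. b\<^sup>2 dvd m})"
    proof (rule inj_onI, clarsimp)
      fix j b j' b' assume b: "b\<^sup>2 dvd m" "b'\<^sup>2 dvd m" and eq: "p ^ j * b = p ^ j' * b'"
      have "b > 0" "b' > 0" using b m by (auto intro!: Nat.gr0I)
      then have "multiplicity p (p ^ j * b) = j" "multiplicity p (p ^ j' * b') = j'"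
        using p nd[OF b(1)] nd[OF b(2)] by (auto intro!: multiplicity_eqI simp: p0 prime_gt_Suc_0_nat)
      with eq p0 show "j = j' \<and> b = b'" by auto
    qed
    show "(\<lambda>(j, b). p ^ j * b) ` ({..i div 2} \<times> {b. b\<^sup>2 dvd m}) = {b. b\<^sup>2 dvd p ^ i * m}"
    proof (intro equalityI subsetI)
      fix c assume "c \<in> (\<lambda>(j, b). p ^ j * b) ` ({..i div 2} \<times> {b. b\<^sup>2 dvd m})"
      then obtain j b where c: "c = p ^ j * b" "j \<le> i div 2" "b\<^sup>2 dvd m" by auto
      have "c\<^sup>2 = p ^ (2 * j) * b\<^sup>2" by (simp add: c power_mult_distrib power_mult mult.commute)
      also have "\<dots> dvd p ^ i * m" using c by (intro mult_dvd_mono le_imp_power_dvd) auto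
      finally show "c \<in> {b. b\<^sup>2 dvd p ^ i * m}" by simp
    next
      fix c assume "c \<in> {b. b\<^sup>2 dvd p ^ i * m}"
      then have c: "c\<^sup>2 dvd p ^ i * m" by simp
      then have "c \<noteq> 0" using m p0 by (auto intro!: Nat.gr0I)
      then obtain b where b: "c = p ^ multiplicity p c * b" "\<not> p dvd b"
        by (rule multiplicity_decompose'[of c p]) (use p \<open>c \<noteq> 0\<close> in auto)
      define j where "j = multiplicity p c"
      have c2: "c\<^sup>2 = p ^ (2 * j) * b\<^sup>2"
        by (subst b(1)) (simp add: j_def power_mult_distrib power_mult mult.commute)
      have "coprime (b\<^sup>2) (p ^ i)"
        using prime_imp_coprime[OF p b(2)] by (simp add: coprime_commute)
      then have "b\<^sup>2 dvd m" using c c2 by (metis coprime_dvd_mult_right_iff dvd_mult_right)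
      moreover have "coprime (p ^ (2 * j)) m"
        using m p by (simp add: prime_imp_coprime)
      then have "p ^ (2 * j) dvd p ^ i" using c c2 by (metis coprime_dvd_mult_left_iff dvd_mult_left)
      then have "2 * j \<le> i"
        using power_dvd_imp_le[of p "2 * j" i] p prime_gt_1_nat by blast
      ultimately show "c \<in> (\<lambda>(j, b). p ^ j * b) ` ({..i div 2} \<times> {b. b\<^sup>2 dvd m})"
        using b(1) by (intro image_eqI[of _ _ "(j, b)"]) (auto simp: j_def)
    qed
  qed
  then have "card {b. b\<^sup>2 dvd p ^ i * m} = card ({..i div 2} \<times> {b. b\<^sup>2 dvd m})"
    by (rule bij_betw_same_card[symmetric])
  then show ?thesis using assms p0
    by (simp add: tau12_eq_card_square_divisors card_cartesian_product even_exponents_def)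
qed

lemma tau12_1: "tau12 (Suc 0) = 1"
  by (simp add: tau12_eq_card_square_divisors)

lemma tau12_prime_power: "prime p \<Longrightarrow> tau12 (p ^ i) = even_exponents i"
  using tau12_prime_power_mult[of p 1 i] by (cases "p = 1") (simp_all add: tau12_1)

lemma tau12_eq_prod:
  assumes "finite P" "\<And>p. p \<in> P \<Longrightarrow> prime p" "n > 0" "prime_factors n \<subseteq> P"
  shows "tau12 n = (\<Prod>p\<in>P. even_exponents (multiplicity p n))"
  using assms
proof (induction P arbitrary: n)
  case empty
  then have "n = 1" using prime_factorization_empty_iff[of n] by simp
  then show ?case by (simp add: tau12_1)
next
  case (insert p P)
  have p: "prime p" using insert.prems by auto
  obtain m where m: "n = p ^ multiplicity p n * m" "\<not> p dvd m"
    by (rule multiplicity_decompose'[of n p]) (use insert.prems(2) prime_gt_1_nat[OF p] in auto)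
  have m0: "m > 0" using m insert.prems by (auto intro!: Nat.gr0I)
  have mult: "multiplicity q n = multiplicity q m" if "prime q" "q \<noteq> p" for q
  proof -
    have "multiplicity q n = multiplicity q (p ^ multiplicity p n) + multiplicity q m"
      using that p m0 by (subst m(1), subst prime_elem_multiplicity_mult_distrib) auto
    also have "multiplicity q (p ^ multiplicity p n) = 0"
      using that p by (intro not_dvd_imp_multiplicity_0) (metis prime_dvd_power primes_dvd_imp_eq)
    finally show ?thesis by simp
  qed
  have sub: "prime_factors m \<subseteq> P"
  proof
    fix q assume q: "q \<in> prime_factors m"
    then have "q \<noteq> p" using m(2) by auto
    moreover have "q \<in> prime_factors n" using q m(1) insert.prems
      by (metis dvd_mult in_prime_factors_iff not_gr_zero)
    ultimately show "q \<in> P" using insert.prems by auto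
  qed
  have "tau12 n = even_exponents (multiplicity p n) * tau12 m"
    by (subst m(1), rule tau12_prime_power_mult[OF p m(2) m0])
  also have "tau12 m = (\<Prod>q\<in>P. even_exponents (multiplicity q m))"
    using insert.prems by (intro insert.IH m0 sub) auto
  also have "\<dots> = (\<Prod>q\<in>P. even_exponents (multiplicity q n))"
    using insert.hyps insert.prems by (intro prod.cong refl) (subst mult, auto)
  finally show ?case using insert.hyps by simp
qed

section \<open>Expanding Euler products\<close>

text \<open>
  A function choosing a state \<open>\<sigma> p \<in> S\<close> at each prime, with default state \<open>z\<close> outside \<open>P\<close>,
  is one term in the expansion of a product over \<open>p \<in> P\<close> of sums over \<open>S\<close>. A total function with
  a default is used, and not an element of a dependent product, so that the index sets for growing
  \<open>P\<close> are nested.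
\<close>
definition choices :: "'s set \<Rightarrow> 's \<Rightarrow> nat set \<Rightarrow> (nat \<Rightarrow> 's) set" where
  "choices S z P = {\<sigma>. (\<forall>p\<in>P. \<sigma> p \<in> S) \<and> (\<forall>p. p \<notin> P \<longrightarrow> \<sigma> p = z)}"

definition prime_choices :: "'s set \<Rightarrow> 's \<Rightarrow> (nat \<Rightarrow> 's) set" where
  "prime_choices S z = {\<sigma>. finite {p. \<sigma> p \<noteq> z} \<and> (\<forall>p. \<sigma> p \<noteq> z \<longrightarrow> prime p \<and> \<sigma> p \<in> S)}"

abbreviation primes_le :: "nat \<Rightarrow> nat set" where
  "primes_le N \<equiv> {p. prime p \<and> p \<le> N}"

lemma bij_betw_choices_PiE:
  "bij_betw (\<lambda>\<sigma>. restrict \<sigma> P) (choices S z P) (PiE P (\<lambda>_. S))"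
proof (rule bij_betw_byWitness[where f' = "\<lambda>g p. if p \<in> P then g p else z"])
  show "\<forall>\<sigma>\<in>choices S z P. (\<lambda>p. if p \<in> P then restrict \<sigma> P p else z) = \<sigma>"
    by (auto simp: choices_def fun_eq_iff)
  show "\<forall>g\<in>PiE P (\<lambda>_. S). restrict (\<lambda>p. if p \<in> P then g p else z) P = g"
    by (auto simp: fun_eq_iff PiE_def extensional_def)
qed (auto simp: choices_def PiE_def)

lemma finite_choices: "finite P \<Longrightarrow> finite S \<Longrightarrow> finite (choices S z P)"
  using bij_betw_finite[OF bij_betw_choices_PiE[of P S z]] finite_PiE[of P "\<lambda>_. S"] by simp

lemma prod_sum_choices:
  fixes g :: "nat \<Rightarrow> 's \<Rightarrow> real"
  assumes "finite P" "finite S"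
  shows "(\<Prod>p\<in>P. \<Sum>s\<in>S. g p s) = (\<Sum>\<sigma>\<in>choices S z P. \<Prod>p\<in>P. g p (\<sigma> p))"
proof -
  have "(\<Sum>\<sigma>\<in>choices S z P. \<Prod>p\<in>P. g p (\<sigma> p)) = (\<Sum>\<sigma>\<in>choices S z P. \<Prod>p\<in>P. g p (restrict \<sigma> P p))"
    by simp
  also have "\<dots> = (\<Sum>\<sigma>\<in>PiE P (\<lambda>_. S). \<Prod>p\<in>P. g p (\<sigma> p))"
    by (rule sum.reindex_bij_betw[OF bij_betw_choices_PiE])
  finally show ?thesis using prod_sum_PiE[of P "\<lambda>_. S" g] assms by simp
qed

lemma prod_support_choices:
  assumes "\<sigma> \<in> choices S z P" "finite P" "\<And>p. g p z = 1"
  shows "(\<Prod>p | \<sigma> p \<noteq> z. g p (\<sigma> p)) = (\<Prod>p\<in>P. g p (\<sigma> p))"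
  using assms by (intro prod.mono_neutral_left) (auto simp: choices_def)

lemma choices_subset_prime_choices:
  "choices S z (primes_le N) \<subseteq> prime_choices S z"
proof
  fix \<sigma> assume "\<sigma> \<in> choices S z (primes_le N)"
  then have *: "\<sigma> p \<noteq> z \<Longrightarrow> p \<in> primes_le N \<and> \<sigma> p \<in> S" for p
    by (auto simp: choices_def)
  have "{p. \<sigma> p \<noteq> z} \<subseteq> {..N}" using * by auto
  then show "\<sigma> \<in> prime_choices S z"
    using * finite_subset by (fastforce simp: prime_choices_def)
qed

text \<open>
  Every finite set of finitely supported choices is already supported on the primes up to some
  bound. Hence partial products over primes are partial sums of the expanded series, and unconditional
  convergence of the latter gives convergence of the product.
\<close>
lemma filterlim_choices:
  assumes "finite S" "z \<in> S"
  shows "filterlim (\<lambda>N. choices S z (primes_le N)) (finite_subsets_at_top (prime_choices S z)) sequentially"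
  unfolding filterlim_finite_subsets_at_top
proof (intro allI impI)
  fix F assume F: "finite F \<and> F \<subseteq> prime_choices S z"
  define X where "X = (\<Union>\<sigma>\<in>F. {p. \<sigma> p \<noteq> z})"
  have X: "finite X" unfolding X_def using F by (auto simp: prime_choices_def)
  have "F \<subseteq> choices S z (primes_le N)" if N: "N \<ge> Max (insert 0 X)" for N
  proof
    fix \<sigma> assume \<sigma>: "\<sigma> \<in> F"
    then have \<sigma>': "\<sigma> p \<noteq> z \<Longrightarrow> prime p \<and> \<sigma> p \<in> S" for p using F by (auto simp: prime_choices_def)
    moreover have "p \<le> N" if "\<sigma> p \<noteq> z" for p
    proof -
      have "p \<in> X" using that \<sigma> by (auto simp: X_def)
      then have "p \<le> Max (insert 0 X)" using X by simp
      then show ?thesis using N by simp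
    qed
    ultimately show "\<sigma> \<in> choices S z (primes_le N)"
      using assms(2) unfolding choices_def by (smt (verit) mem_Collect_eq)
  qed
  moreover have "finite (choices S z (primes_le N))" for N
    using assms by (intro finite_choices) auto
  ultimately show "\<forall>\<^sub>F N in sequentially. finite (choices S z (primes_le N)) \<and>
      F \<subseteq> choices S z (primes_le N) \<and> choices S z (primes_le N) \<subseteq> prime_choices S z"
    using choices_subset_prime_choices[of S z] by (auto simp: eventually_sequentially)
qed

definition choice_weight :: "'s \<Rightarrow> (nat \<Rightarrow> 's \<Rightarrow> real) \<Rightarrow> (nat \<Rightarrow> 's) \<Rightarrow> real" where
  "choice_weight z h \<sigma> = (\<Prod>p | \<sigma> p \<noteq> z. h p (\<sigma> p))"

lemma sum_choice_weight:
  assumes "finite P" "finite S" "\<And>p. h p z = 1"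
  shows "(\<Sum>\<sigma>\<in>choices S z P. choice_weight z h \<sigma>) = (\<Prod>p\<in>P. \<Sum>s\<in>S. h p s)"
  unfolding prod_sum_choices[OF assms(1,2), where z = z] choice_weight_def
  by (intro sum.cong refl prod_support_choices assms)

text \<open>
  The Euler product with finitely many states per prime: the expanded series is absolutely summable
  because its partial sums expand products bounded by the exponential of the convergent sum of the
  nontrivial weights.
\<close>
lemma
  assumes S: "finite S" "z \<in> S" and h: "\<And>p. h p z = 1"
    and summable: "summable (\<lambda>p. if prime p then \<Sum>s\<in>S - {z}. \<bar>h p s\<bar> else 0)"
  shows choice_weight_abs_summable: "(\<lambda>\<sigma>. norm (choice_weight z h \<sigma>)) summable_on prime_choices S z"
    and euler_product: "(\<lambda>N. \<Prod>p\<in>primes_le N. \<Sum>s\<in>S. h p s)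
          \<longlonglongrightarrow> infsum (choice_weight z h) (prime_choices S z)"
proof -
  define g where "g p = (if prime p then \<Sum>s\<in>S - {z}. \<bar>h p s\<bar> else 0)" for p
  have g: "summable g" "\<And>p. g p \<ge> 0" using summable by (simp_all add: g_def[abs_def] sum_nonneg)
  have bound: "(\<Sum>\<sigma>\<in>choices S z (primes_le N). \<bar>choice_weight z h \<sigma>\<bar>) \<le> exp (suminf g)" for N
  proof -
    \<comment> \<open>The absolute series also expands a product, whose factors are at most \<open>exp (g p)\<close>.\<close>
    have "(\<Sum>\<sigma>\<in>choices S z (primes_le N). \<bar>choice_weight z h \<sigma>\<bar>)
        = (\<Sum>\<sigma>\<in>choices S z (primes_le N). choice_weight z (\<lambda>p s. \<bar>h p s\<bar>) \<sigma>)"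
      by (simp add: choice_weight_def abs_prod)
    also have "\<dots> = (\<Prod>p\<in>primes_le N. \<Sum>s\<in>S. \<bar>h p s\<bar>)"
      using S h by (intro sum_choice_weight) auto
    also have "\<dots> = (\<Prod>p\<in>primes_le N. 1 + g p)"
      using S h by (intro prod.cong refl) (simp add: g_def sum.remove)
    also have "\<dots> \<le> exp (\<Sum>p\<in>primes_le N. g p)"
      using g by (intro prod_le_exp_sum) auto
    also have "\<dots> \<le> exp (suminf g)"
      using g by (simp add: sum_le_suminf)
    finally show ?thesis .
  qed
  have "sum (\<lambda>\<sigma>. norm (choice_weight z h \<sigma>)) F \<le> exp (suminf g)"
    if F: "finite F" "F \<subseteq> prime_choices S z" for F
  proof -
    have "\<forall>\<^sub>F N in sequentially. finite (choices S z (primes_le N)) \<and>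
        F \<subseteq> choices S z (primes_le N) \<and> choices S z (primes_le N) \<subseteq> prime_choices S z"
      using filterlim_choices[OF S] F unfolding filterlim_finite_subsets_at_top by simp
    then obtain N where N: "finite (choices S z (primes_le N))" "F \<subseteq> choices S z (primes_le N)"
      unfolding eventually_sequentially by blast
    have "sum (\<lambda>\<sigma>. norm (choice_weight z h \<sigma>)) F
        \<le> sum (\<lambda>\<sigma>. norm (choice_weight z h \<sigma>)) (choices S z (primes_le N))"
      using N by (intro sum_mono2) auto
    then show ?thesis using bound[of N] by simp
  qed
  then show *: "(\<lambda>\<sigma>. norm (choice_weight z h \<sigma>)) summable_on prime_choices S z"
    unfolding abs_summable_iff_bdd_above by (intro bdd_aboveI2) auto
  have "((\<lambda>F. sum (choice_weight z h) F) \<longlongrightarrow> infsum (choice_weight z h) (prime_choices S z))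
      (finite_subsets_at_top (prime_choices S z))"
    using * abs_summable_summable infsum_tendsto by blast
  from filterlim_compose[OF this filterlim_choices[OF S]]
  have "(\<lambda>N. sum (choice_weight z h) (choices S z (primes_le N)))
      \<longlonglongrightarrow> infsum (choice_weight z h) (prime_choices S z)" .
  moreover have "sum (choice_weight z h) (choices S z (primes_le N))
      = (\<Prod>p\<in>primes_le N. \<Sum>s\<in>S. h p s)" for N
    using S h by (intro sum_choice_weight) auto
  ultimately show "(\<lambda>N. \<Prod>p\<in>primes_le N. \<Sum>s\<in>S. h p s)
          \<longlonglongrightarrow> infsum (choice_weight z h) (prime_choices S z)" by simp
qed

section \<open>The convolution identity for \<open>tau12 (m * n)\<close>\<close>

text \<open>
  The numerator \<open>1 + uv - u\<^sup>2v - uv\<^sup>2\<close> of the local factor of \<open>tau12 (m * n)\<close>: the exponent pairs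
  are listed here, the signs in \<open>shift_sign\<close>.
\<close>
abbreviation shifts :: "(nat \<times> nat) set" where
  "shifts \<equiv> {(0, 0), (1, 1), (2, 1), (1, 2)}"

definition shift_sign :: "nat \<times> nat \<Rightarrow> real" where
  "shift_sign s = (if s \<in> {(2, 1), (1, 2)} then -1 else 1)"

abbreviation shifted_pairs :: "(nat \<Rightarrow> nat \<times> nat) set" where
  "shifted_pairs \<equiv> prime_choices shifts (0, 0)"

text \<open>
  A choice of an exponent pair at each prime encodes a pair of integers; these are its two
  components.
\<close>
definition left_divisor :: "(nat \<Rightarrow> nat \<times> nat) \<Rightarrow> nat" where
  "left_divisor \<sigma> = (\<Prod>p | \<sigma> p \<noteq> (0, 0). p ^ fst (\<sigma> p))"

definition right_divisor :: "(nat \<Rightarrow> nat \<times> nat) \<Rightarrow> nat" where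
  "right_divisor \<sigma> = (\<Prod>p | \<sigma> p \<noteq> (0, 0). p ^ snd (\<sigma> p))"

definition pair_sign :: "(nat \<Rightarrow> nat \<times> nat) \<Rightarrow> real" where
  "pair_sign \<sigma> = choice_weight (0, 0) (\<lambda>_. shift_sign) \<sigma>"

definition tau12_quot :: "nat \<Rightarrow> nat \<Rightarrow> real" where
  "tau12_quot n d = (if d dvd n then real (tau12 (n div d)) else 0)"

definition even_exponents_minus :: "nat \<Rightarrow> nat \<Rightarrow> real" where
  "even_exponents_minus i k = (if k \<le> i then real (even_exponents (i - k)) else 0)"

text \<open>
  The local identity behind everything: it says that the series of \<open>even_exponents (i + j) u\<^sup>i v\<^sup>j\<close>
  is \<open>1 + uv - u\<^sup>2v - uv\<^sup>2\<close> times the product of the series of \<open>even_exponents i\<close> in \<open>u\<close> and of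
  \<open>even_exponents j\<close> in \<open>v\<close>. Since \<open>even_exponents\<close> is linear on each parity class, the four
  parity cases decide it.
\<close>
lemma even_exponents_add:
  "real (even_exponents (i + j)) =
     (\<Sum>s\<in>shifts. shift_sign s * even_exponents_minus i (fst s) * even_exponents_minus j (snd s))"
proof -
  have [simp]: "even_exponents (Suc (Suc n)) = even_exponents n + 1" for n
    by (simp add: even_exponents_def)
  have base: "even_exponents 0 = 1" "even_exponents (Suc 0) = 1" by (simp_all add: even_exponents_def)
  define i0 j0 where "i0 = i mod 2" and "j0 = j mod 2"
  define a b where "a = i div 2" and "b = j div 2"
  have ij: "i = 2 * a + i0" "j = 2 * b + j0" "i0 = 0 \<or> i0 = 1" "j0 = 0 \<or> j0 = 1"
    by (auto simp: i0_def j0_def a_def b_def)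
  show ?thesis using ij(3,4) unfolding ij(1,2)
    by (cases a; cases b; elim disjE)
      (simp_all add: shift_sign_def even_exponents_minus_def even_exponents_def algebra_simps)
qed

text \<open>
  Extending \<open>tau12 (n div d)\<close> by zero to \<open>d\<close> not dividing \<open>n\<close> makes it a product of local
  terms: one failing prime makes both sides vanish.
\<close>
lemma tau12_quot_eq_prod:
  assumes P: "finite P" "\<And>p. p \<in> P \<Longrightarrow> prime p" and n: "n > 0" "prime_factors n \<subseteq> P"
  shows "tau12_quot n (\<Prod>p\<in>P. p ^ \<alpha> p) = (\<Prod>p\<in>P. even_exponents_minus (multiplicity p n) (\<alpha> p))"
proof -
  define d where "d = (\<Prod>p\<in>P. p ^ \<alpha> p)"
  have d0: "d > 0" using P by (auto simp: d_def prime_gt_0_nat intro!: prod_pos)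
  have md: "multiplicity p d = \<alpha> p" if "p \<in> P" for p
    using that P by (simp add: d_def multiplicity_prod_prime_powers)
  show ?thesis
  proof (cases "\<forall>p\<in>P. \<alpha> p \<le> multiplicity p n")
    case True
    have "multiplicity p d \<le> multiplicity p n" if "prime p" for p
      using P that True md[of p] by (cases "p \<in> P") (auto simp: d_def multiplicity_prod_prime_powers)
    then have dn: "d dvd n" using d0 n by (intro multiplicity_le_imp_dvd) auto
    then obtain q where q: "n = d * q" by (elim dvdE)
    have q0: "q > 0" using q n by (auto intro!: Nat.gr0I)
    have mq: "multiplicity p q = multiplicity p n - \<alpha> p" if "p \<in> P" for p
      using that P d0 q0 md[of p] by (simp add: q prime_elem_multiplicity_mult_distrib)
    have "prime_factors q \<subseteq> P" using n q0 d0 by (auto simp: q prime_factors_product)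
    then have "tau12 q = (\<Prod>p\<in>P. even_exponents (multiplicity p q))"
      using P q0 by (intro tau12_eq_prod) auto
    also have "\<dots> = (\<Prod>p\<in>P. even_exponents (multiplicity p n - \<alpha> p))"
      by (intro prod.cong refl) (simp add: mq)
    finally have "real (tau12 q) = (\<Prod>p\<in>P. even_exponents_minus (multiplicity p n) (\<alpha> p))"
      using True by (simp add: even_exponents_minus_def)
    then show ?thesis using d0 by (simp add: d_def[symmetric] tau12_quot_def q)
  next
    case False
    then obtain p where p: "p \<in> P" "\<alpha> p > multiplicity p n" by auto
    then have "\<not> d dvd n" using n md[of p] dvd_imp_multiplicity_le[of d n p] by auto
    moreover have "(\<Prod>p\<in>P. even_exponents_minus (multiplicity p n) (\<alpha> p)) = 0"
      using p P by (intro prod_zero) (auto simp: even_exponents_minus_def intro!: bexI[of _ p])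
    ultimately show ?thesis by (simp add: d_def[symmetric] tau12_quot_def)
  qed
qed

text \<open>
  Multiply the local identity over the primes of \<open>P\<close> and expand. Any finite \<open>P\<close> that contains the
  prime factors is allowed, so that one index set serves all \<open>m, n \<le> x\<close> at once.
\<close>
lemma tau12_mult:
  assumes P: "finite P" "\<And>p. p \<in> P \<Longrightarrow> prime p"
    and mn: "m > 0" "prime_factors m \<subseteq> P" "n > 0" "prime_factors n \<subseteq> P"
  shows "real (tau12 (m * n)) = (\<Sum>\<sigma>\<in>choices shifts (0, 0) P.
    pair_sign \<sigma> * tau12_quot m (left_divisor \<sigma>) * tau12_quot n (right_divisor \<sigma>))"
proof -
  have "tau12 (m * n) = (\<Prod>p\<in>P. even_exponents (multiplicity p (m * n)))"
    using P mn by (intro tau12_eq_prod) (auto simp: prime_factors_product)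
  also have "\<dots> = (\<Prod>p\<in>P. even_exponents (multiplicity p m + multiplicity p n))"
    using P mn by (intro prod.cong refl) (simp add: prime_elem_multiplicity_mult_distrib)
  finally have "real (tau12 (m * n)) = (\<Prod>p\<in>P. \<Sum>s\<in>shifts. shift_sign s *
      even_exponents_minus (multiplicity p m) (fst s) * even_exponents_minus (multiplicity p n) (snd s))"
    by (simp only: of_nat_prod even_exponents_add)
  also have "\<dots> = (\<Sum>\<sigma>\<in>choices shifts (0, 0) P. \<Prod>p\<in>P. shift_sign (\<sigma> p) *
      even_exponents_minus (multiplicity p m) (fst (\<sigma> p)) *
      even_exponents_minus (multiplicity p n) (snd (\<sigma> p)))"
    using P by (intro prod_sum_choices) auto
  also have "\<dots> = (\<Sum>\<sigma>\<in>choices shifts (0, 0) P.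
    pair_sign \<sigma> * tau12_quot m (left_divisor \<sigma>) * tau12_quot n (right_divisor \<sigma>))"
  proof (rule sum.cong[OF refl])
    fix \<sigma> assume \<sigma>: "\<sigma> \<in> choices shifts (0, 0) P"
    have "pair_sign \<sigma> = (\<Prod>p\<in>P. shift_sign (\<sigma> p))"
      unfolding pair_sign_def choice_weight_def using \<sigma> P
      by (intro prod_support_choices) (auto simp: shift_sign_def)
    moreover have "left_divisor \<sigma> = (\<Prod>p\<in>P. p ^ fst (\<sigma> p))"
      unfolding left_divisor_def using \<sigma> P
      by (intro prod_support_choices[where g = "\<lambda>p s. p ^ fst s"]) auto
    moreover have "right_divisor \<sigma> = (\<Prod>p\<in>P. p ^ snd (\<sigma> p))"
      unfolding right_divisor_def using \<sigma> P
      by (intro prod_support_choices[where g = "\<lambda>p s. p ^ snd s"]) auto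
    ultimately show "(\<Prod>p\<in>P. shift_sign (\<sigma> p) *
      even_exponents_minus (multiplicity p m) (fst (\<sigma> p)) *
      even_exponents_minus (multiplicity p n) (snd (\<sigma> p))) =
      pair_sign \<sigma> * tau12_quot m (left_divisor \<sigma>) * tau12_quot n (right_divisor \<sigma>)"
      using P mn by (simp only: prod.distrib tau12_quot_eq_prod)
  qed
  finally show ?thesis .
qed

section \<open>Removing Euler factors from the zeta function\<close>

definition unsieved :: "nat set \<Rightarrow> nat set" where
  "unsieved P = {n. n > 0 \<and> (\<forall>p\<in>P. \<not> p dvd n)}"

text \<open>
  The multiples of \<open>p\<close> among the integers free of prime factors in \<open>P\<close> are \<open>p\<close> times these integers,
  so that striking them out multiplies the sum by \<open>1 - f p\<close>.
\<close>
lemma has_sum_unsieved: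
  assumes P: "finite P" "\<And>p. p \<in> P \<Longrightarrow> prime p"
    and f: "\<And>m n. f (m * n) = f m * f n" and Z: "(f has_sum (Z :: real)) {0<..}"
  shows "(f has_sum (Z * (\<Prod>p\<in>P. 1 - f p))) (unsieved P)"
  using P
proof (induction P)
  case empty
  then show ?case using Z by (simp add: unsieved_def greaterThan_def)
next
  case (insert p P)
  define s where "s = Z * (\<Prod>p\<in>P. 1 - f p)"
  have p: "prime p" "p > 0" using insert.prems by (auto simp: prime_gt_0_nat)
  have s: "(f has_sum s) (unsieved P)" unfolding s_def using insert by auto
  have "((\<lambda>n. f p * f n) has_sum (f p * s)) (unsieved P)"
    by (rule has_sum_cmult_right[OF s])
  then have "((\<lambda>n. f (p * n)) has_sum (f p * s)) (unsieved P)" by (simp add: f)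
  moreover have "inj_on (\<lambda>n. p * n) (unsieved P)" using p by (auto simp: inj_on_def)
  ultimately have "(f has_sum (f p * s)) ((\<lambda>n. p * n) ` unsieved P)"
    by (simp add: has_sum_reindex o_def)
  moreover have "(\<lambda>n. p * n) ` unsieved P \<subseteq> unsieved P"
  proof (clarsimp simp: unsieved_def p)
    fix n q assume n: "\<forall>q\<in>P. \<not> q dvd n" "q \<in> P" "q dvd p * n"
    then have "q dvd p" using insert.prems prime_dvd_mult_iff[of q p n] by auto
    then have "q = p" using insert.prems p n(2) primes_dvd_imp_eq by blast
    then show False using n insert.hyps by auto
  qed
  ultimately have "(f has_sum (s - f p * s)) (unsieved P - (\<lambda>n. p * n) ` unsieved P)"
    using s by (intro has_sum_Diff)
  moreover have "unsieved P - (\<lambda>n. p * n) ` unsieved P = unsieved (insert p P)"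
  proof (intro equalityI subsetI)
    fix n assume n: "n \<in> unsieved P - (\<lambda>n. p * n) ` unsieved P"
    have "\<not> p dvd n"
    proof
      assume "p dvd n"
      then obtain k where "n = p * k" by (elim dvdE)
      then have "k \<in> unsieved P" using n by (auto simp: unsieved_def)
      then show False using n \<open>n = p * k\<close> by auto
    qed
    then show "n \<in> unsieved (insert p P)" using n by (simp add: unsieved_def)
  qed (auto simp: unsieved_def)
  ultimately show ?case using insert.hyps by (simp add: s_def algebra_simps)
qed

text \<open>
  After sieving by all primes up to \<open>N\<close> only \<open>1\<close> and integers beyond \<open>N\<close> survive, and the latter
  contribute at most a tail of the convergent series.
\<close>
lemma zeta_times_euler_product:
  assumes s: "s > 1"
  shows "(\<lambda>N. (\<Sum>n. real (Suc n) powr - s) * (\<Prod>p\<in>primes_le N. 1 - real p powr - s)) \<longlonglongrightarrow> 1"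
proof -
  define f where "f n = real n powr - s" for n
  define Z where "Z = (\<Sum>n. real (Suc n) powr - s)"
  have f: "f (m * n) = f m * f n" for m n by (simp add: f_def powr_mult)
  have f0: "f 0 = 0" by (simp add: f_def)
  have "summable (\<lambda>n. f (Suc n))" unfolding f_def
    by (subst summable_Suc_iff, subst summable_real_powr_iff) (use s in auto)
  then have "(\<lambda>n. f (Suc n)) sums Z" by (simp add: Z_def f_def summable_sums)
  then have fs: "f sums Z" using sums_Suc[of f Z] f0 by simp
  then have hs: "(f has_sum Z) UNIV" by (rule sums_nonneg_imp_has_sum) (simp add: f_def)
  have "(f has_sum Z) {0<..} \<longleftrightarrow> (f has_sum Z) UNIV"
    by (rule has_sum_cong_neutral) (auto simp: f0)
  then have hs0: "(f has_sum Z) {0<..}" using hs by simp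
  have lower: "1 \<le> Z * (\<Prod>p\<in>primes_le N. 1 - f p)" and
       upper: "Z * (\<Prod>p\<in>primes_le N. 1 - f p) \<le> 1 + (Z - (\<Sum>n<Suc N. f n))" if "N \<ge> 1" for N
  proof -
    have hsN: "(f has_sum (Z * (\<Prod>p\<in>primes_le N. 1 - f p))) (unsieved (primes_le N))"
      by (rule has_sum_unsieved[OF _ _ f hs0]) auto
    have f1: "f 1 = 1" by (simp add: f_def)
    have "1 \<in> unsieved (primes_le N)" by (auto simp: unsieved_def)
    then have "(\<Sum>n\<in>{1}. f n) \<le> Z * (\<Prod>p\<in>primes_le N. 1 - f p)"
      by (intro finite_sum_le_has_sum[OF hsN]) (auto simp: f_def)
    then show "1 \<le> Z * (\<Prod>p\<in>primes_le N. 1 - f p)" using f1 by simp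
    have "(f has_sum (\<Sum>n<Suc N. f n)) {..<Suc N}" by (rule has_sum_finite) simp
    then have "(f has_sum (Z - (\<Sum>n<Suc N. f n))) (UNIV - {..<Suc N})"
      by (intro has_sum_Diff[OF hs]) auto
    then have "(f has_sum (f 1 + (Z - (\<Sum>n<Suc N. f n)))) ({1} \<union> (UNIV - {..<Suc N}))"
      using that has_sum_finite[of "{1}" f] by (intro has_sum_Un_disjoint) auto
    moreover have "unsieved (primes_le N) \<subseteq> {1} \<union> (UNIV - {..<Suc N})"
    proof
      fix n assume n: "n \<in> unsieved (primes_le N)"
      show "n \<in> {1} \<union> (UNIV - {..<Suc N})"
      proof (cases "n = 1")
        case False
        then obtain p where p: "prime p" "p dvd n" using prime_factor_nat by blast
        then have "N < p" "p \<le> n" using n by (auto simp: unsieved_def dvd_imp_le)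
        then show ?thesis by simp
      qed simp
    qed
    ultimately show "Z * (\<Prod>p\<in>primes_le N. 1 - f p) \<le> 1 + (Z - (\<Sum>n<Suc N. f n))"
      unfolding f1 by (intro has_sum_mono2[OF hsN]) (simp_all add: f_def)
  qed
  have "(\<lambda>N. 1 + (Z - (\<Sum>n<Suc N. f n))) \<longlonglongrightarrow> 1 + (Z - Z)"
    using fs by (intro tendsto_intros LIMSEQ_Suc) (simp add: sums_def)
  then have "(\<lambda>N. Z * (\<Prod>p\<in>primes_le N. 1 - f p)) \<longlonglongrightarrow> 1"
    using tendsto_sandwich[OF eventually_sequentiallyI[of 1, OF lower]
          eventually_sequentiallyI[of 1, OF upper] tendsto_const] by simp
  then show ?thesis by (simp add: Z_def f_def)
qed

section \<open>The constants as Euler products\<close>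

text \<open>
  The generating function follows from the recursion \<open>even_exponents (i + 2) = even_exponents i + 1\<close>;
  shifting the index by \<open>k\<close> multiplies it by \<open>u ^ k\<close>.
\<close>
lemma has_sum_even_exponents_minus:
  assumes "0 \<le> u" "u < (1 :: real)"
  shows "((\<lambda>i. even_exponents_minus i k * u ^ i) has_sum (u ^ k / ((1 - u) * (1 - u\<^sup>2)))) UNIV"
proof -
  define H where "H = 1 / ((1 - u) * (1 - u\<^sup>2))"
  have u2: "u\<^sup>2 < 1" using assms by (simp add: power_less_one_iff abs_square_less_1)
  have summ: "summable (\<lambda>i. real (even_exponents i) * u ^ i)"
  proof (rule summable_comparison_test)
    show "summable (\<lambda>i. of_nat (Suc i) * u ^ i)"
      using geometric_deriv_sums[of u] assms by (auto simp: sums_iff)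
    show "\<exists>N. \<forall>i\<ge>N. norm (real (even_exponents i) * u ^ i) \<le> of_nat (Suc i) * u ^ i"
      using assms by (intro exI[of _ 0]) (auto simp: even_exponents_def abs_mult intro!: mult_right_mono)
  qed
  define S where "S = (\<Sum>i. real (even_exponents i) * u ^ i)"
  have "(\<lambda>i. real (even_exponents (i + 2)) * u ^ (i + 2)) sums (S - (\<Sum>i<2. real (even_exponents i) * u ^ i))"
    using summ sums_split_initial_segment[of "\<lambda>i. real (even_exponents i) * u ^ i" S 2] by (simp add: S_def summable_sums)
  moreover have "(\<lambda>i. u\<^sup>2 * (real (even_exponents i) * u ^ i) + u\<^sup>2 * u ^ i) sums (u\<^sup>2 * S + u\<^sup>2 * (1 / (1 - u)))"
    using assms summ by (intro sums_add sums_mult geometric_sums) (auto simp: S_def summable_sums)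
  moreover have "real (even_exponents (i + 2)) * u ^ (i + 2) = u\<^sup>2 * (real (even_exponents i) * u ^ i) + u\<^sup>2 * u ^ i" for i
    by (simp add: even_exponents_def power2_eq_square algebra_simps)
  ultimately have "S - (\<Sum>i<2. real (even_exponents i) * u ^ i) = u\<^sup>2 * S + u\<^sup>2 * (1 / (1 - u))"
    by (simp only: sums_unique2)
  then have "S * (1 - u\<^sup>2) = 1 + u + u\<^sup>2 * (1 / (1 - u))"
    by (simp add: even_exponents_def eval_nat_numeral algebra_simps)
  also have "\<dots> = 1 / (1 - u)" using assms by (simp add: field_simps power2_eq_square)
  finally have "S = 1 / (1 - u) / (1 - u\<^sup>2)" using u2 by (subst nonzero_eq_divide_eq) auto
  then have "S = H" by (simp add: H_def)
  then have "(\<lambda>i. real (even_exponents i) * u ^ i) sums H" using summ by (auto simp: S_def)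
  then have "((\<lambda>i. real (even_exponents i) * u ^ i) has_sum H) UNIV"
    by (rule sums_nonneg_imp_has_sum) (use assms in auto)
  then have "((\<lambda>i. u ^ k * (real (even_exponents i) * u ^ i)) has_sum (u ^ k * H)) UNIV"
    by (rule has_sum_cmult_right)
  also have "(\<lambda>i. u ^ k * (real (even_exponents i) * u ^ i)) = (\<lambda>i. even_exponents_minus i k * u ^ i) \<circ> (\<lambda>i. i + k)"
    by (simp add: fun_eq_iff even_exponents_minus_def power_add)
  finally have "((\<lambda>i. even_exponents_minus i k * u ^ i) has_sum (u ^ k * H)) (range (\<lambda>i. i + k))"
    by (subst has_sum_reindex) (simp_all add: o_def)
  moreover have "((\<lambda>i. even_exponents_minus i k * u ^ i) has_sum (u ^ k * H)) (range (\<lambda>i. i + k)) \<longleftrightarrow>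
    ((\<lambda>i. even_exponents_minus i k * u ^ i) has_sum (u ^ k * H)) UNIV"
  proof (rule has_sum_cong_neutral)
    fix i assume i: "i \<in> UNIV - range (\<lambda>i. i + k)"
    have "\<not> k \<le> i"
    proof
      assume "k \<le> i"
      then have "i = (i - k) + k" by simp
      then show False using i by blast
    qed
    then show "even_exponents_minus i k * u ^ i = 0" by (simp add: even_exponents_minus_def)
  qed auto
  ultimately show ?thesis by (simp add: H_def)
qed

lemma has_sum_product:
  fixes f g :: "_ \<Rightarrow> real"
  assumes f: "(f has_sum a) A" "\<And>x. f x \<ge> 0" and g: "(g has_sum b) B" "\<And>y. g y \<ge> 0"
  shows "((\<lambda>(x, y). f x * g y) has_sum (a * b)) (A \<times> B)"
proof (rule has_sum_SigmaI)
  show 1: "((\<lambda>y. case (x, y) of (x, y) \<Rightarrow> f x * g y) has_sum (f x * b)) B" for x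
    using has_sum_cmult_right[OF g(1)] by simp
  show 2: "((\<lambda>x. f x * b) has_sum (a * b)) A" using has_sum_cmult_left[OF f(1)] by simp
  show "(\<lambda>(x, y). f x * g y) summable_on A \<times> B"
    by (rule summable_on_SigmaI[OF 1 has_sum_imp_summable[OF 2]]) (use f g in auto)
qed

lemma has_sum_local_factor:
  assumes u: "0 \<le> u" "u < (1 :: real)" and v: "0 \<le> v" "v < 1"
  shows "((\<lambda>(i, j). real (even_exponents (i + j)) * u ^ i * v ^ j) has_sum
     ((1 + u * v - u\<^sup>2 * v - u * v\<^sup>2) / (((1 - u) * (1 - u\<^sup>2)) * ((1 - v) * (1 - v\<^sup>2))))) UNIV"
proof -
  define H where "H = 1 / (((1 - u) * (1 - u\<^sup>2)) * ((1 - v) * (1 - v\<^sup>2)))"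
  have *: "((\<lambda>(i, j). shift_sign s * ((even_exponents_minus i (fst s) * u ^ i) * (even_exponents_minus j (snd s) * v ^ j)))
      has_sum (shift_sign s * (u ^ fst s * v ^ snd s * H))) UNIV" for s
    using has_sum_cmult_right[OF has_sum_product[OF has_sum_even_exponents_minus[OF u] _ has_sum_even_exponents_minus[OF v]],
        of "fst s" "snd s" "shift_sign s"] u v
    by (simp add: case_prod_unfold even_exponents_minus_def H_def)
  have "((\<lambda>c. \<Sum>s\<in>shifts. (\<lambda>(i, j). shift_sign s * ((even_exponents_minus i (fst s) * u ^ i) * (even_exponents_minus j (snd s) * v ^ j))) c)
      has_sum (\<Sum>s\<in>shifts. shift_sign s * (u ^ fst s * v ^ snd s * H))) UNIV"
    using *[of "(0,0)"] *[of "(1,1)"] *[of "(2,1)"] *[of "(1,2)"]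
    by (auto intro!: has_sum_add simp del: One_nat_def)
  also have "(\<lambda>c. \<Sum>s\<in>shifts. (\<lambda>(i, j). shift_sign s * ((even_exponents_minus i (fst s) * u ^ i) * (even_exponents_minus j (snd s) * v ^ j))) c)
     = (\<lambda>(i, j). real (even_exponents (i + j)) * u ^ i * v ^ j)"
    unfolding even_exponents_add by (auto simp: fun_eq_iff algebra_simps)
  also have "(\<Sum>s\<in>shifts. shift_sign s * (u ^ fst s * v ^ snd s * H)) = (1 + u * v - u\<^sup>2 * v - u * v\<^sup>2) * H"
    by (simp add: shift_sign_def algebra_simps)
  finally show ?thesis by (simp add: H_def)
qed

text \<open>
  The term of \<open>\<sigma>\<close> in the two-variable Dirichlet series of the shifts.
\<close>
definition pair_weight :: "real \<Rightarrow> real \<Rightarrow> (nat \<Rightarrow> nat \<times> nat) \<Rightarrow> real" where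
  "pair_weight s w \<sigma> = pair_sign \<sigma> * real (left_divisor \<sigma>) powr - s * real (right_divisor \<sigma>) powr - w"

definition pair_factor :: "real \<Rightarrow> real \<Rightarrow> real" where
  "pair_factor u v = 1 + u * v - u\<^sup>2 * v - u * v\<^sup>2"

lemma abs_pair_sign: "\<bar>pair_sign \<sigma>\<bar> = 1"
  unfolding pair_sign_def choice_weight_def abs_prod by (intro prod.neutral) (simp add: shift_sign_def)

text \<open>
  The three conditions are convergence of \<open>\<Sum> p\<^sup>-\<^sup>e\<close> for the exponents \<open>e\<close> of the three nontrivial
  shifts \<open>(1,1), (2,1), (1,2)\<close>.
\<close>
lemma
  assumes sw: "s + w > 1" "2 * s + w > 1" "s + 2 * w > 1"
  shows pair_weight_abs_summable: "(\<lambda>\<sigma>. \<bar>pair_weight s w \<sigma>\<bar>) summable_on shifted_pairs"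
    and pair_weight_euler_product:
      "(\<lambda>N. \<Prod>p\<in>primes_le N. pair_factor (real p powr - s) (real p powr - w))
         \<longlonglongrightarrow> infsum (pair_weight s w) shifted_pairs"
proof -
  define h where "h p t = shift_sign t * ((real p powr - s) ^ fst t * (real p powr - w) ^ snd t)"
    for p :: nat and t
  have h0: "h p (0, 0) = 1" for p by (simp add: h_def shift_sign_def)
  have pw: "(real p ^ k) powr - e = (real p powr - e) ^ k" for p k :: nat and e :: real
    by (induction k) (simp_all add: powr_mult)
  have weight: "pair_weight s w = choice_weight (0, 0) h"
    by (simp add: fun_eq_iff pair_weight_def choice_weight_def pair_sign_def left_divisor_def
        right_divisor_def h_def prod.distrib prod_powr_distrib pw)
  have abs_eq: "(\<Sum>t\<in>shifts - {(0, 0)}. \<bar>h p t\<bar>)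
      = real p powr - (s + w) + real p powr - (2 * s + w) + real p powr - (s + 2 * w)" if "p > 0" for p
  proof -
    have "shifts - {(0, 0)} = {(1, 1), (2, 1), (1, 2)}" by auto
    then show ?thesis using that
      by (simp add: h_def shift_sign_def abs_mult power2_eq_square powr_add[symmetric])
  qed
  have "summable (\<lambda>p. real p powr - (s + w) + real p powr - (2 * s + w) + real p powr - (s + 2 * w))"
    using sw by (intro summable_add) (subst summable_real_powr_iff; simp)+
  then have summ: "summable (\<lambda>p. if prime p then \<Sum>t\<in>shifts - {(0, 0)}. \<bar>h p t\<bar> else 0)"
  proof (rule summable_comparison_test[rotated])
    show "\<exists>N. \<forall>p\<ge>N. norm (if prime p then \<Sum>t\<in>shifts - {(0, 0)}. \<bar>h p t\<bar> else 0)
      \<le> real p powr - (s + w) + real p powr - (2 * s + w) + real p powr - (s + 2 * w)"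
      using abs_eq by (auto simp: prime_gt_0_nat intro!: exI[of _ 0])
  qed
  have fin: "finite shifts" "(0, 0) \<in> shifts" by auto
  show "(\<lambda>\<sigma>. \<bar>pair_weight s w \<sigma>\<bar>) summable_on shifted_pairs"
    using choice_weight_abs_summable[OF fin h0 summ] by (simp add: weight)
  have "(\<Sum>t\<in>shifts. h p t) = pair_factor (real p powr - s) (real p powr - w)" for p
    by (simp add: h_def shift_sign_def pair_factor_def)
  then show "(\<lambda>N. \<Prod>p\<in>primes_le N. pair_factor (real p powr - s) (real p powr - w))
         \<longlonglongrightarrow> infsum (pair_weight s w) shifted_pairs"
    using euler_product[OF fin h0 summ] by (simp add: weight)
qed

text \<open>
  Partial products of nonzero factors that tend to 0 count as divergent. Factors at least 1 rule
  this out.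
\<close>
lemma prodinf_over_primes:
  fixes f :: "nat \<Rightarrow> real"
  assumes lim: "(\<lambda>N. \<Prod>p\<in>primes_le N. f p) \<longlonglongrightarrow> L" and ge: "\<And>p. prime p \<Longrightarrow> f p \<ge> 1"
  shows "(\<Prod>p. if prime p then f p else 1) = L"
proof -
  define g where "g p = (if prime p then f p else 1)" for p
  have g: "g p \<ge> 1" for p using ge by (simp add: g_def)
  have "(\<Prod>p\<le>N. g p) = (\<Prod>p\<in>primes_le N. f p)" for N
    unfolding g_def by (subst prod.inter_filter[symmetric]) (auto intro!: prod.cong)
  then have lim': "(\<lambda>N. \<Prod>p\<le>N. g p) \<longlonglongrightarrow> L" using lim by simp
  moreover have "1 \<le> (\<Prod>p\<le>N. g p)" for N using g by (intro prod_ge_1)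
  ultimately have "1 \<le> L" by (intro LIMSEQ_le_const[OF lim']) auto
  then have "convergent_prod g"
    using lim' g by (subst convergent_prod_iff_nz_lim) (auto, metis not_one_le_zero)
  then have "g has_prod L" using lim' by (rule convergent_prod_tendsto_imp_has_prod)
  then have "L = prodinf g" by (rule has_prod_unique)
  then show ?thesis by (simp add: g_def[abs_def])
qed

lemma C1_factor:
  assumes "prime p"
  shows "(1 - 1 / real p) ^ 2 *
      (\<Sum>\<^sub>\<infinity>(a, b)\<in>UNIV. real (tau12 (p ^ (a + b))) / real p ^ (a + b))
    = pair_factor (1 / p) (1 / p) / (1 - (1 / p)\<^sup>2)\<^sup>2"
proof -
  define u where "u = 1 / real p"
  have u: "0 \<le> u" "u < 1" using prime_gt_1_nat[OF assms] by (auto simp: u_def)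
  have u2: "u\<^sup>2 < 1" using u by (simp add: power_less_one_iff abs_square_less_1)
  have "real (tau12 (p ^ (a + b))) / real p ^ (a + b) = real (even_exponents (a + b)) * u ^ a * u ^ b" for a b
    unfolding tau12_prime_power[OF assms] by (simp add: u_def power_add power_one_over)
  then have "(\<Sum>\<^sub>\<infinity>(a, b)\<in>UNIV. real (tau12 (p ^ (a + b))) / real p ^ (a + b))
      = pair_factor u u / (((1 - u) * (1 - u\<^sup>2)) * ((1 - u) * (1 - u\<^sup>2)))"
    using infsumI[OF has_sum_local_factor[OF u u]] by (simp add: pair_factor_def case_prod_unfold)
  moreover have "a\<^sup>2 * (x / ((a * b) * (a * b))) = x / b\<^sup>2" if "a \<noteq> 0" "b \<noteq> 0" for a b x :: real
    using that by (simp add: power2_eq_square)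
  ultimately show ?thesis using u u2 unfolding u_def[symmetric] by simp
qed

lemma C2_factor:
  assumes "prime p"
  shows "(1 - 1 / real p) ^ 2 * (1 - real p powr (- 1 / 2)) *
      (\<Sum>\<^sub>\<infinity>(a, b)\<in>UNIV. real (tau12 (p ^ (a + b))) / real p powr (real a + real b / 2))
    = pair_factor (1 / p) (real p powr (- 1 / 2)) / (1 - (1 / p)\<^sup>2)"
proof -
  define u v where "u = 1 / real p" and "v = real p powr (- 1 / 2)"
  have p: "real p > 1" using prime_gt_1_nat[OF assms] by simp
  have u: "0 \<le> u" "u < 1" using p by (auto simp: u_def)
  have u2: "u\<^sup>2 < 1" using u by (simp add: power_less_one_iff abs_square_less_1)
  have "v < 1" using p powr_less_mono[of "- 1 / 2" 0 "real p"] by (simp add: v_def)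
  then have v: "0 \<le> v" "v < 1" by (auto simp: v_def)
  have vu: "v\<^sup>2 = u" using p by (simp add: v_def u_def powr_minus_divide powr_half_sqrt power_one_over)
  have "real (tau12 (p ^ (a + b))) / real p powr (real a + real b / 2)
      = real (even_exponents (a + b)) * u ^ a * v ^ b" for a b
  proof -
    have "v ^ b = real p powr (- (real b / 2))" using p by (simp add: v_def powr_power)
    moreover have "u ^ a = real p powr (- real a)"
      using p by (simp add: u_def powr_minus powr_realpow field_simps)
    ultimately have "u ^ a * v ^ b = 1 / real p powr (real a + real b / 2)"
      by (simp add: powr_add[symmetric] powr_minus_divide[symmetric])
    then show ?thesis by (simp add: tau12_prime_power[OF assms] mult.assoc)
  qed
  then have "(\<Sum>\<^sub>\<infinity>(a, b)\<in>UNIV. real (tau12 (p ^ (a + b))) / real p powr (real a + real b / 2))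
      = pair_factor u v / (((1 - u) * (1 - u\<^sup>2)) * ((1 - v) * (1 - u)))"
    using infsumI[OF has_sum_local_factor[OF u v]] by (simp add: pair_factor_def vu case_prod_unfold)
  moreover have "a\<^sup>2 * c * (x / ((a * b) * (c * a))) = x / b"
    if "a \<noteq> 0" "b \<noteq> 0" "c \<noteq> 0" for a b c x :: real
    using that by (simp add: power2_eq_square)
  from this[of "1 - u" "1 - u\<^sup>2" "1 - v" "pair_factor u v"] u v u2
  have "(1 - u)\<^sup>2 * (1 - v) * (pair_factor u v / (((1 - u) * (1 - u\<^sup>2)) * ((1 - v) * (1 - u))))
    = pair_factor u v / (1 - u\<^sup>2)" by linarith
  ultimately show ?thesis unfolding u_def[symmetric] v_def[symmetric] by simp
qed

lemma C1_factor_ge_1: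
  fixes p :: nat assumes "prime p" shows "pair_factor (1 / p) (1 / p) / (1 - (1 / p)\<^sup>2)\<^sup>2 \<ge> 1"
proof -
  define u where "u = 1 / real p"
  have u: "0 \<le> u" "u < 1" using prime_gt_1_nat[OF assms] by (auto simp: u_def)
  have "pair_factor u u - (1 - u\<^sup>2)\<^sup>2 = u\<^sup>2 * (1 - u) * (3 + u)"
    by (simp add: pair_factor_def power2_eq_square algebra_simps)
  moreover have "u\<^sup>2 * (1 - u) * (3 + u) \<ge> 0" using u by simp
  moreover have "u\<^sup>2 < 1" using u by (simp add: power_less_one_iff abs_square_less_1)
  then have "(1 - u\<^sup>2)\<^sup>2 > 0" by simp
  ultimately show ?thesis unfolding u_def[symmetric] by (simp add: field_simps)
qed

lemma C2_factor_eq: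
  fixes p :: nat assumes "prime p" shows "pair_factor (1 / p) (real p powr (- 1 / 2)) / (1 - (1 / p)\<^sup>2)
    = 1 + 1 / (sqrt p * (real p + 1))"
proof -
  define v where "v = 1 / sqrt (real p)"
  have p: "real p > 1" using prime_gt_1_nat[OF assms] by simp
  have v: "0 < v" "v < 1" "real p powr (- 1 / 2) = v" "1 / real p = v\<^sup>2"
    using p by (auto simp: v_def powr_minus_divide powr_half_sqrt power_one_over)
  have "v ^ 2 < 1" "v ^ 4 < 1" using v by (auto simp: power_less_one_iff)
  have "1 / (sqrt p * (real p + 1)) = v ^ 3 / (1 + v\<^sup>2)"
  proof -
    define r where "r = sqrt (real p)"
    have r: "r > 0" "real p = r\<^sup>2" "v = 1 / r" using p by (auto simp: r_def v_def)
    show ?thesis unfolding r_def[symmetric] r(2,3) using r(1)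
      by (simp add: divide_simps add_pos_pos eval_nat_numeral)
  qed
  moreover have "pair_factor (v\<^sup>2) v = (1 - v ^ 4) * (1 + v ^ 3 / (1 + v\<^sup>2))"
  proof -
    have "pair_factor (v\<^sup>2) v = (1 - v ^ 4) + (1 - v\<^sup>2) * v ^ 3"
      by (simp add: pair_factor_def eval_nat_numeral algebra_simps)
    also have "(1 - v\<^sup>2) = (1 - v ^ 4) / (1 + v\<^sup>2)"
    proof (subst nonzero_eq_divide_eq)
      have "1 + v\<^sup>2 > 0" by (simp add: add_pos_nonneg)
      then show "1 + v\<^sup>2 \<noteq> 0" by simp
    qed (simp add: eval_nat_numeral algebra_simps)
    finally show ?thesis by (simp add: algebra_simps)
  qed
  ultimately show ?thesis using \<open>v ^ 4 < 1\<close> unfolding v(3,4)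
    by (simp add: power_mult[symmetric])
qed

lemma suminf_inverse_squares: "(\<Sum>n. real (Suc n) powr - 2) = pi\<^sup>2 / 6"
proof -
  have *: "(\<lambda>n. real (Suc n) powr - 2) = (\<lambda>n. 1 / (real n + 1)\<^sup>2)"
    by (simp add: fun_eq_iff powr_minus_divide add.commute)
  show ?thesis unfolding * using sums_unique[OF inverse_squares_sums] by (simp add: add.commute)
qed

lemma zeta_2_euler_product:
  "(\<lambda>N. pi\<^sup>2 / 6 * (\<Prod>p\<in>primes_le N. 1 - (1 / real p)\<^sup>2)) \<longlonglongrightarrow> 1"
  using zeta_times_euler_product[of 2] unfolding suminf_inverse_squares
  by (simp add: powr_minus_divide power_one_over)

text \<open>
  Both constants are the shift series at a point, times powers of \<open>\<zeta>(2)\<close> that come from the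
  \<open>1 - p\<^sup>-\<^sup>2\<close> in the denominators of the local factors.
\<close>
lemma C1_eq: "C1 = (pi\<^sup>2 / 6)\<^sup>2 * infsum (pair_weight 1 1) shifted_pairs"
  and C1_product: "(\<lambda>N. \<Prod>p\<in>primes_le N. pair_factor (1 / p) (1 / p) / (1 - (1 / p)\<^sup>2)\<^sup>2) \<longlonglongrightarrow> C1"
proof -
  have q: "(\<lambda>N. \<Prod>p\<in>primes_le N. pair_factor (1 / p) (1 / p)) \<longlonglongrightarrow> infsum (pair_weight 1 1) shifted_pairs"
    using pair_weight_euler_product[of 1 1] by (simp add: powr_minus_divide)
  have "(\<lambda>N. \<Prod>p\<in>primes_le N. pair_factor (1 / p) (1 / p) / (1 - (1 / p)\<^sup>2)\<^sup>2)
      \<longlonglongrightarrow> (pi\<^sup>2 / 6)\<^sup>2 * infsum (pair_weight 1 1) shifted_pairs / 1\<^sup>2"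
  proof -
    have "(\<lambda>N. (pi\<^sup>2 / 6)\<^sup>2 * (\<Prod>p\<in>primes_le N. pair_factor (1 / p) (1 / p))
        / (pi\<^sup>2 / 6 * (\<Prod>p\<in>primes_le N. 1 - (1 / real p)\<^sup>2))\<^sup>2)
        \<longlonglongrightarrow> (pi\<^sup>2 / 6)\<^sup>2 * infsum (pair_weight 1 1) shifted_pairs / 1\<^sup>2"
      by (intro tendsto_intros zeta_2_euler_product q) auto
    then show ?thesis by (simp add: prod_dividef prod_power_distrib power_mult_distrib power_divide)
  qed
  then have lim: "(\<lambda>N. \<Prod>p\<in>primes_le N. pair_factor (1 / p) (1 / p) / (1 - (1 / p)\<^sup>2)\<^sup>2)
      \<longlonglongrightarrow> (pi\<^sup>2 / 6)\<^sup>2 * infsum (pair_weight 1 1) shifted_pairs" by simp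
  then have "(\<Prod>p. if prime p then pair_factor (1 / p) (1 / p) / (1 - (1 / p)\<^sup>2)\<^sup>2 else 1)
      = (pi\<^sup>2 / 6)\<^sup>2 * infsum (pair_weight 1 1) shifted_pairs"
    by (intro prodinf_over_primes C1_factor_ge_1) auto
  moreover have "C1 = (\<Prod>p. if prime p then pair_factor (1 / p) (1 / p) / (1 - (1 / p)\<^sup>2)\<^sup>2 else 1)"
    unfolding C1_def using C1_factor by (intro arg_cong[where f = prodinf]) (simp add: fun_eq_iff)
  ultimately show "C1 = (pi\<^sup>2 / 6)\<^sup>2 * infsum (pair_weight 1 1) shifted_pairs" by simp
  with lim show "(\<lambda>N. \<Prod>p\<in>primes_le N. pair_factor (1 / p) (1 / p) / (1 - (1 / p)\<^sup>2)\<^sup>2) \<longlonglongrightarrow> C1" by simp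
qed

lemma C2_eq: "C2 = 2 * (Re (zeta (1 / 2)) * (pi\<^sup>2 / 6)) * infsum (pair_weight 1 (1 / 2)) shifted_pairs"
  and C2_product: "(\<lambda>N. \<Prod>p\<in>primes_le N. 1 + 1 / (sqrt p * (real p + 1)))
      \<longlonglongrightarrow> (pi\<^sup>2 / 6) * infsum (pair_weight 1 (1 / 2)) shifted_pairs"
proof -
  have q: "(\<lambda>N. \<Prod>p\<in>primes_le N. pair_factor (1 / p) (real p powr (- 1 / 2)))
      \<longlonglongrightarrow> infsum (pair_weight 1 (1 / 2)) shifted_pairs"
    using pair_weight_euler_product[of 1 "1 / 2"] by (simp add: powr_minus_divide)
  have lim: "(\<lambda>N. \<Prod>p\<in>primes_le N. pair_factor (1 / p) (real p powr (- 1 / 2)) / (1 - (1 / p)\<^sup>2))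
      \<longlonglongrightarrow> (pi\<^sup>2 / 6) * infsum (pair_weight 1 (1 / 2)) shifted_pairs / 1"
  proof -
    have "(\<lambda>N. (pi\<^sup>2 / 6) * (\<Prod>p\<in>primes_le N. pair_factor (1 / p) (real p powr (- 1 / 2)))
        / (pi\<^sup>2 / 6 * (\<Prod>p\<in>primes_le N. 1 - (1 / real p)\<^sup>2)))
        \<longlonglongrightarrow> (pi\<^sup>2 / 6) * infsum (pair_weight 1 (1 / 2)) shifted_pairs / 1"
      by (intro tendsto_intros zeta_2_euler_product q) auto
    then show ?thesis by (simp add: prod_dividef power_divide)
  qed
  have ge: "pair_factor (1 / p) (real p powr (- 1 / 2)) / (1 - (1 / p)\<^sup>2) \<ge> 1" if "prime p" for p :: nat
    unfolding C2_factor_eq[OF that] by simp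
  from lim have "(\<Prod>p. if prime p then pair_factor (1 / p) (real p powr (- 1 / 2)) / (1 - (1 / p)\<^sup>2) else 1)
      = (pi\<^sup>2 / 6) * infsum (pair_weight 1 (1 / 2)) shifted_pairs"
    using ge by (intro prodinf_over_primes) simp_all
  moreover have "(\<lambda>p. if prime p then
      (1 - 1 / real p) ^ 2 * (1 - real p powr (- 1 / 2)) *
      (\<Sum>\<^sub>\<infinity>(a, b)\<in>UNIV. real (tau12 (p ^ (a + b))) / real p powr (real a + real b / 2)) else 1)
    = (\<lambda>p. if prime p then pair_factor (1 / p) (real p powr (- 1 / 2)) / (1 - (1 / p)\<^sup>2) else 1)"
    using C2_factor by (simp add: fun_eq_iff)
  ultimately show "C2 = 2 * (Re (zeta (1 / 2)) * (pi\<^sup>2 / 6)) * infsum (pair_weight 1 (1 / 2)) shifted_pairs"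
    unfolding C2_def by simp
  have "(\<Prod>p\<in>primes_le N. pair_factor (1 / p) (real p powr (- 1 / 2)) / (1 - (1 / p)\<^sup>2))
    = (\<Prod>p\<in>primes_le N. 1 + 1 / (sqrt p * (real p + 1)))" for N
    by (intro prod.cong refl C2_factor_eq) auto
  then show "(\<lambda>N. \<Prod>p\<in>primes_le N. 1 + 1 / (sqrt p * (real p + 1)))
      \<longlonglongrightarrow> (pi\<^sup>2 / 6) * infsum (pair_weight 1 (1 / 2)) shifted_pairs" using lim by simp
qed

section \<open>The zeta function to the right of the imaginary axis\<close>

text \<open>
  The Taylor remainder of \<open>y powr (1 - z)\<close> over a unit step. It compares a term of the zeta series
  with an integral. The factor \<open>1 - z\<close> is kept in front, which avoids the pole at \<open>z = 1\<close>.
\<close>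
lemma norm_powr_taylor1:
  assumes "a > 0" "Re z > 0"
  shows "norm ((1 - z) * of_real a powr (- z) - (of_real (a + 1) powr (1 - z) - of_real a powr (1 - z)))
    \<le> norm (1 - z) * norm z * a powr (- Re z - 1)"
proof -
  define S where "S = closed_segment (of_real a) (of_real (a + 1) :: complex)"
  have S: "\<exists>v. a \<le> v \<and> y = of_real v" if "y \<in> S" for y
    using that unfolding S_def closed_segment_of_real closed_segment_eq_real_ivl by auto
  define f where "f i y = (if i = 0 then y powr (1 - z) else if i = 1 then (1 - z) * y powr (- z)
    else (1 - z) * (- z * y powr (- z - 1)))" for i :: nat and y
  have "norm (f 0 (of_real (a + 1)) - (\<Sum>i\<le>1. f i (of_real a) * (of_real (a + 1) - of_real a) ^ i / fact i))
      \<le> norm (1 - z) * norm z * a powr (- Re z - 1) * norm (of_real (a + 1) - of_real a :: complex) ^ Suc 1 / fact 1"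
  proof (rule complex_Taylor)
    show "convex S" "of_real a \<in> S" "of_real (a + 1) \<in> S" by (simp_all add: S_def)
    show "(f i has_field_derivative f (Suc i) y) (at y within S)" if y: "y \<in> S" "i \<le> 1" for i y
    proof -
      have nn: "y \<notin> \<real>\<^sub>\<le>\<^sub>0" using S[OF y(1)] assms by auto
      consider "i = 0" | "i = 1" using y(2) by linarith
      then show ?thesis
      proof cases
        case 1
        then have "f i = (\<lambda>y. y powr (1 - z))" by (simp add: f_def fun_eq_iff)
        moreover have "((\<lambda>y. y powr (1 - z)) has_field_derivative f (Suc i) y) (at y)"
          using has_field_derivative_powr[OF nn, of "1 - z"] 1 by (simp add: f_def)
        ultimately show ?thesis by (simp add: has_field_derivative_at_within)
      next
        case 2
        then have "f i = (\<lambda>y. (1 - z) * y powr (- z))" by (simp add: f_def fun_eq_iff)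
        moreover have "((\<lambda>y. (1 - z) * y powr (- z)) has_field_derivative f (Suc i) y) (at y)"
          using DERIV_cmult[OF has_field_derivative_powr[OF nn, of "- z"], of "1 - z"] 2 by (simp add: f_def)
        ultimately show ?thesis by (simp add: has_field_derivative_at_within)
      qed
    qed
    show "norm (f (Suc 1) y) \<le> norm (1 - z) * norm z * a powr (- Re z - 1)" if y: "y \<in> S" for y
    proof -
      obtain v where v: "a \<le> v" "y = of_real v" using S[OF y] by blast
      have "norm (y powr (- z - 1)) = v powr (- Re z - 1)"
        using v assms by (simp add: norm_powr_real_powr)
      also have "\<dots> \<le> a powr (- Re z - 1)"
        using v assms by (intro powr_mono2') auto
      finally show ?thesis by (simp add: f_def norm_mult mult.assoc mult_left_mono)
    qed
  qed
  moreover have "of_real (a + 1) - of_real a = (1 :: complex)" by simp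
  ultimately have "norm (of_real (a + 1) powr (1 - z) - (of_real a powr (1 - z) + (1 - z) * of_real a powr (- z)))
      \<le> norm (1 - z) * norm z * a powr (- Re z - 1)" by (simp add: f_def del: of_real_add)
  also have "of_real (a + 1) powr (1 - z) - (of_real a powr (1 - z) + (1 - z) * of_real a powr (- z))
     = - ((1 - z) * of_real a powr (- z) - (of_real (a + 1) powr (1 - z) - of_real a powr (1 - z)))"
    by (simp add: algebra_simps)
  finally show ?thesis unfolding norm_minus_cancel .
qed

text \<open>
  The series converges locally uniformly for \<open>Re z > 0\<close>, and for \<open>Re z > 1\<close> the second part
  telescopes. So it is \<open>(1 - z) \<zeta>(z) + 1\<close> there, and everywhere by uniqueness of the continuation.
\<close>
lemma zeta_half_plane:
  assumes s: "Re s > 0" "s \<noteq> 1"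
  shows "(\<lambda>n. (1 - s) * of_nat (Suc n) powr (- s) -
      (of_nat (Suc (Suc n)) powr (1 - s) - of_nat (Suc n) powr (1 - s)))
    sums ((1 - s) * zeta s + 1)"
proof -
  define F :: "nat \<Rightarrow> complex \<Rightarrow> complex" where "F n z = (1 - z) * of_nat (Suc n) powr (- z) -
      (of_nat (Suc (Suc n)) powr (1 - z) - of_nat (Suc n) powr (1 - z))" for n z
  define G where "G z = (\<Sum>n. F n z)" for z
  have bound: "norm (F n z) \<le> norm (1 - z) * norm z * real (Suc n) powr (- Re z - 1)"
    if "Re z > 0" for n z
  proof -
    have "of_nat (Suc (Suc n)) = complex_of_real (real (Suc n) + 1)" by simp
    then show ?thesis using norm_powr_taylor1[of "real (Suc n)" z] that
      by (simp add: F_def)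
  qed
  have summable: "summable (\<lambda>n. c * real (Suc n) powr (- d - 1))" if "d > 0" for c d :: real
  proof (rule summable_mult)
    have "summable (\<lambda>n. real n powr (- d - 1))"
      by (subst summable_real_powr_iff) (use that in auto)
    then show "summable (\<lambda>n. real (Suc n) powr (- d - 1))" by (subst summable_Suc_iff)
  qed
  have sums: "(\<lambda>n. F n z) sums G z" if "Re z > 0" for z
    unfolding G_def
  proof (rule summable_sums, rule summable_comparison_test)
    show "\<exists>N. \<forall>n\<ge>N. norm (F n z) \<le> norm (1 - z) * norm z * real (Suc n) powr (- Re z - 1)"
      using bound[OF that] by blast
  qed (rule summable[OF that])
  have "G holomorphic_on {z. 0 < Re z}"
  proof (rule holomorphic_uniform_sequence)
    show "open {z. 0 < Re z}" by (rule open_halfspace_Re_gt)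
    show "(\<lambda>z. \<Sum>i<n. F i z) holomorphic_on {z. 0 < Re z}" for n
      unfolding F_def by (intro holomorphic_intros)
    fix x assume "x \<in> {z. 0 < Re z}"
    then have x: "Re x > 0" by simp
    define d where "d = Re x / 2"
    have d: "d > 0" using x by (simp add: d_def)
    have near: "d \<le> Re z" "norm z \<le> norm x + d" if "z \<in> cball x d" for z
    proof -
      have "norm (x - z) \<le> d" using that by (simp add: dist_norm)
      then show "d \<le> Re z" "norm z \<le> norm x + d"
        using abs_Re_le_cmod[of "x - z"] norm_triangle_ineq3[of x z] by (auto simp: d_def)
    qed
    have "uniform_limit (cball x d) (\<lambda>n z. \<Sum>i<n. F i z) G sequentially"
      unfolding G_def
    proof (rule Weierstrass_m_test)
      fix n z assume z: "z \<in> cball x d"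
      have "norm (1 - z) \<le> 1 + (norm x + d)" using near(2)[OF z] norm_triangle_ineq4[of 1 z] by simp
      then show "norm (F n z) \<le> (1 + (norm x + d)) * (norm x + d) * real (Suc n) powr (- d - 1)"
        using near[OF z] d
        by (intro order.trans[OF bound] mult_mono powr_mono) auto
    qed (rule summable[OF d])
    moreover have "cball x d \<subseteq> {z. 0 < Re z}" using near(1) d by force
    ultimately show "\<exists>d>0. cball x d \<subseteq> {z. 0 < Re z} \<and>
        uniform_limit (cball x d) (\<lambda>n z. \<Sum>i<n. F i z) G sequentially" using d by blast
  qed
  then have "(\<lambda>z. (G z - 1) / (1 - z)) holomorphic_on {z. 0 < Re z} - {1}"
    by (intro holomorphic_intros) (auto elim: holomorphic_on_subset)
  moreover have "(\<lambda>n. of_nat (Suc n) powr (- z)) sums ((G z - 1) / (1 - z))" if z: "1 < Re z" for z :: complex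
  proof -
    have "(\<lambda>n. of_nat n powr (1 - z) :: complex) \<longlonglongrightarrow> 0"
      by (rule tendsto_neg_powr_complex_of_nat)
        (use z in \<open>auto intro: filterlim_ident\<close>)
    then have "(\<lambda>n. of_nat (Suc n) powr (1 - z) :: complex) \<longlonglongrightarrow> 0"
      by (rule LIMSEQ_Suc)
    then have "(\<lambda>n. of_nat (Suc (Suc n)) powr (1 - z) - of_nat (Suc n) powr (1 - z) :: complex) sums (0 - of_nat (Suc 0) powr (1 - z))"
      by (rule telescope_sums)
    \<comment> \<open>Adding the telescoping series back removes the integrals and leaves the Dirichlet series.\<close>
    from sums_add[OF sums[of z] this] z
    have "(\<lambda>n. (1 - z) * of_nat (Suc n) powr (- z)) sums (G z - 1)"
      by (simp add: F_def)
    from sums_divide[OF this, of "1 - z"] show ?thesis using z by (cases "z = 1") simp_all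
  qed
  ultimately have "zeta s = (G s - 1) / (1 - s)"
    using s by (intro zeta_eqI[where r = 0]) auto
  then have "G s = (1 - s) * zeta s + 1" using s by (simp add: field_simps)
  then show ?thesis using sums[OF s(1)] by (simp add: F_def)
qed

lemma zeta_half_limit:
  "(\<lambda>N. (\<Sum>n=1..N. 1 / sqrt (real n)) - 2 * sqrt (real N + 1)) \<longlonglongrightarrow> Re (zeta (1 / 2))"
proof -
  define w :: complex where "w = 1 / 2"
  have w: "1 - w = of_real (1 / 2)" "- w = of_real (- (1 / 2))" "Re w = 1 / 2" by (simp_all add: w_def)
  have p: "of_nat (Suc n) powr (of_real e :: complex) = of_real (real (Suc n) powr e)" for n e
    using powr_of_real[of "real (Suc n)" e] by simp
  have "(\<lambda>n. of_real (1 / 2) * of_real (real (Suc n) powr (- (1/2))) -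
      (of_real (real (Suc (Suc n)) powr (1 / 2)) - of_real (real (Suc n) powr (1/2))))
    sums ((1 - w) * zeta w + 1)"
    using zeta_half_plane[of w] unfolding w(1,2) p by (simp add: w_def)
  from sums_Re[OF this]
  have "(\<lambda>n. 1 / 2 * real (Suc n) powr (- (1/2)) - (real (Suc (Suc n)) powr (1 / 2) - real (Suc n) powr (1/2)))
    sums Re ((1 - w) * zeta w + 1)" by simp
  also have "Re ((1 - w) * zeta w + 1) = Re (zeta w) / 2 + 1" unfolding w(1) by simp
  also have "(\<lambda>n. 1 / 2 * real (Suc n) powr (- (1/2)) - (real (Suc (Suc n)) powr (1 / 2) - real (Suc n) powr (1/2)))
    = (\<lambda>n. 1 / 2 * (1 / sqrt (Suc n)) - (sqrt (Suc (Suc n)) - sqrt (Suc n)))"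
    by (simp add: powr_minus powr_half_sqrt field_simps)
  finally have "(\<lambda>N. \<Sum>n<N. 1 / 2 * (1 / sqrt (Suc n)) - (sqrt (Suc (Suc n)) - sqrt (Suc n)))
      \<longlonglongrightarrow> Re (zeta w) / 2 + 1" by (simp add: sums_def)
  moreover have "(\<Sum>n<N. 1 / 2 * (1 / sqrt (Suc n)) - (sqrt (Suc (Suc n)) - sqrt (Suc n)))
      = (1 / 2) * (\<Sum>n=1..N. 1 / sqrt (real n)) - sqrt (real N + 1) + 1" for N
    by (induction N) (simp_all add: algebra_simps)
  ultimately have "(\<lambda>N. (1 / 2) * (\<Sum>n=1..N. 1 / sqrt (real n)) - sqrt (real N + 1) + 1) \<longlonglongrightarrow> Re (zeta w) / 2 + 1"
    by simp
  from tendsto_mult[OF tendsto_const[of 2] tendsto_diff[OF this tendsto_const[of 1]]]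
  show ?thesis by (simp add: w_def algebra_simps)
qed

text \<open>
  Concavity of the square root, i.e. the midpoint rule for \<open>1 / sqrt t\<close>.
\<close>
lemma sqrt_midpoint_step:
  assumes "n \<ge> 1" shows "1 / sqrt (real n) \<le> 2 * (sqrt (real n + 1/2) - sqrt (real n - 1/2))"
proof -
  define a b c where "a = sqrt (real n + 1/2)" and "b = sqrt (real n - 1/2)" and "c = sqrt (real n)"
  have pos: "a > 0" "b > 0" "c > 0" and sq: "a\<^sup>2 = real n + 1/2" "b\<^sup>2 = real n - 1/2" "c\<^sup>2 = real n"
    using assms by (auto simp: a_def b_def c_def)
  have "(a + b)\<^sup>2 \<le> (2 * c)\<^sup>2"
    using sq zero_le_power2[of "a - b"] by (simp add: power2_sum power2_diff power_mult_distrib)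
  then have ab: "a + b \<le> 2 * c" using pos by (intro power2_le_imp_le[of "a + b" "2 * c"]) auto
  have "(a - b) * (a + b) = 1" using sq by (simp add: power2_eq_square algebra_simps)
  then have "1 = (a - b) * (a + b)" by simp
  moreover have "a - b \<ge> 0" by (simp add: a_def b_def)
  ultimately have "1 \<le> (a - b) * (2 * c)" using ab by (metis mult_left_mono)
  then show ?thesis using pos unfolding a_def[symmetric] b_def[symmetric] c_def[symmetric]
    by (simp add: field_simps)
qed

text \<open>
  The trapezoidal rule for \<open>1 / sqrt t\<close>; it reduces to the inequality of the arithmetic and
  harmonic means.
\<close>
lemma sqrt_trapezoid_step:
  assumes "n \<ge> 1"
  shows "2 * (sqrt (real n + 1) - sqrt (real n)) \<le> (1 / sqrt (real n) + 1 / sqrt (real n + 1)) / 2"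
proof -
  define a b where "a = sqrt (real n + 1)" and "b = sqrt (real n)"
  have pos: "a > 0" "b > 0" and sq: "a\<^sup>2 = real n + 1" "b\<^sup>2 = real n"
    using assms by (auto simp: a_def b_def)
  have 1: "(a - b) * (a + b) = 1" using sq by (simp add: power2_eq_square algebra_simps)
  then have "4 * a * b * (a - b) * (a + b) \<le> (a + b)\<^sup>2"
    using zero_le_power2[of "a - b"] by (simp add: power2_sum power2_diff mult.assoc)
  then have "4 * a * b * (a - b) \<le> a + b"
    using pos by (simp add: power2_eq_square mult_le_cancel_right)
  then show ?thesis using pos unfolding a_def[symmetric] b_def[symmetric]
    by (simp add: field_simps)
qed

text \<open>
  The midpoint rule makes this correction of the partial sums decreasing, and the trapezoidal rule
  makes the one of \<open>zeta_half_lower\<close> increasing. Together they give the error term of the hyperbola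
  method and, at \<open>N = 10\<close>, the numerical value of \<open>\<zeta>(1/2)\<close>.
\<close>
lemma zeta_half_upper: "Re (zeta (1 / 2)) \<le> (\<Sum>n=1..N. 1 / sqrt (real n)) - 2 * sqrt (real N + 1/2)"
proof -
  define X where "X N = (\<Sum>n=1..N. 1 / sqrt (real n)) - 2 * sqrt (real N + 1/2)" for N :: nat
  have "decseq X"
  proof (rule decseq_SucI)
    show "X (Suc n) \<le> X n" for n
      using sqrt_midpoint_step[of "Suc n"] by (simp add: X_def algebra_simps)
  qed
  moreover have "X \<longlonglongrightarrow> Re (zeta (1 / 2))"
  proof -
    have "(\<lambda>N. 2 * (sqrt (real N + 1) - sqrt (real N + 1/2))) \<longlonglongrightarrow> 0" by real_asymp
    from tendsto_add[OF zeta_half_limit this] show ?thesis by (simp add: X_def[abs_def] algebra_simps)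
  qed
  ultimately have "Re (zeta (1 / 2)) \<le> X N" by (rule decseq_ge)
  then show ?thesis by (simp add: X_def)
qed

lemma zeta_half_lower:
  assumes "N \<ge> 1"
  shows "(\<Sum>n=1..N. 1 / sqrt (real n)) - 2 * sqrt N - 1 / (2 * sqrt N) \<le> Re (zeta (1 / 2))"
proof -
  define X where "X N = (\<Sum>n=1..Suc N. 1 / sqrt (real n)) - 2 * sqrt (Suc N) - 1 / (2 * sqrt (Suc N))" for N :: nat
  have "incseq X"
  proof (rule incseq_SucI)
    show "X n \<le> X (Suc n)" for n
      using sqrt_trapezoid_step[of "Suc n"] by (simp add: X_def algebra_simps)
  qed
  moreover have "X \<longlonglongrightarrow> Re (zeta (1 / 2))"
  proof -
    have "(\<lambda>N. 2 * (sqrt (real (Suc N) + 1) - sqrt (real (Suc N))) - 1 / (2 * sqrt (Suc N))) \<longlonglongrightarrow> 0" by real_asymp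
    from tendsto_add[OF LIMSEQ_Suc[OF zeta_half_limit] this]
    show ?thesis by (simp add: X_def[abs_def] algebra_simps)
  qed
  ultimately have "X (N - 1) \<le> Re (zeta (1 / 2))" by (rule incseq_le)
  then show ?thesis using assms by (simp add: X_def)
qed

lemma inverse_squares_bounds:
  assumes "N \<ge> 1"
  shows "pi\<^sup>2 / 6 - 1 / N \<le> (\<Sum>n=1..N. 1 / real n ^ 2)"
    and "(\<Sum>n=1..N. 1 / real n ^ 2) \<le> pi\<^sup>2 / 6 - 1 / (real N + 1)"
proof -
  define X where "X N = (\<Sum>n=1..N. 1 / real n ^ 2)" for N :: nat
  have "X = (\<lambda>N. \<Sum>n<N. 1 / (real n + 1)\<^sup>2)"
  proof
    show "X N = (\<Sum>n<N. 1 / (real n + 1)\<^sup>2)" for N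
      by (induction N) (simp_all add: X_def add.commute)
  qed
  then have lim: "X \<longlonglongrightarrow> pi\<^sup>2 / 6" using inverse_squares_sums by (simp add: sums_def add.commute)
  have "decseq (\<lambda>n. X (Suc n) + 1 / real (Suc n))"
    by (rule decseq_SucI) (simp add: X_def divide_simps power2_eq_square, simp add: algebra_simps)
  moreover have "(\<lambda>n. X (Suc n) + 1 / real (Suc n)) \<longlonglongrightarrow> pi\<^sup>2 / 6 + 0"
    by (intro tendsto_add LIMSEQ_Suc lim) real_asymp
  ultimately have "pi\<^sup>2 / 6 + 0 \<le> X (Suc (N - 1)) + 1 / real (Suc (N - 1))" by (rule decseq_ge)
  then show "pi\<^sup>2 / 6 - 1 / N \<le> (\<Sum>n=1..N. 1 / real n ^ 2)" using assms by (simp add: X_def)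
  have "incseq (\<lambda>n. X n + 1 / real (Suc n))"
    by (rule incseq_SucI) (simp add: X_def divide_simps power2_eq_square, simp add: algebra_simps)
  moreover have "(\<lambda>n. X n + 1 / real (Suc n)) \<longlonglongrightarrow> pi\<^sup>2 / 6 + 0"
    by (intro tendsto_add lim) real_asymp
  ultimately have "X N + 1 / real (Suc N) \<le> pi\<^sup>2 / 6 + 0" by (rule incseq_le)
  then show "(\<Sum>n=1..N. 1 / real n ^ 2) \<le> pi\<^sup>2 / 6 - 1 / (real N + 1)" by (simp add: X_def add.commute)
qed

section \<open>The summatory function of \<open>tau12\<close>\<close>

definition summatory_tau12 :: "real \<Rightarrow> real" where
  "summatory_tau12 y = (\<Sum>n\<in>{1..nat \<lfloor>y\<rfloor>}. real (tau12 n))"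

lemma summatory_tau12_eq_card:
  "summatory_tau12 y = real (card {(a, b). 0 < a \<and> 0 < b \<and> real (a * b\<^sup>2) \<le> y})"
proof -
  define D where "D n = {(a, b). 0 < a \<and> 0 < b \<and> a * b\<^sup>2 = n}" for n :: nat
  have fin: "finite (D n)" for n
  proof (rule finite_subset)
    show "D n \<subseteq> {..n} \<times> {..n}"
    proof
      fix c assume "c \<in> D n"
      then obtain a b where c: "c = (a, b)" "0 < a" "0 < b" "n = a * b\<^sup>2" by (auto simp: D_def)
      have "a \<le> a * b\<^sup>2" using c by simp
      moreover have "b * 1 \<le> b * (a * b)" using c by (intro mult_left_mono) auto
      then have "b \<le> a * b\<^sup>2" by (simp add: power2_eq_square ac_simps)
      ultimately show "c \<in> {..n} \<times> {..n}" using c by auto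
    qed
  qed simp
  have "summatory_tau12 y = real (\<Sum>n\<in>{1..nat \<lfloor>y\<rfloor>}. card (D n))"
    by (simp add: summatory_tau12_def tau12_def D_def)
  also have "(\<Sum>n\<in>{1..nat \<lfloor>y\<rfloor>}. card (D n)) = card (\<Union>n\<in>{1..nat \<lfloor>y\<rfloor>}. D n)"
    by (rule card_UN_disjoint[symmetric]) (simp_all add: fin, auto simp: D_def)
  also have "(\<Union>n\<in>{1..nat \<lfloor>y\<rfloor>}. D n) = {(a, b). 0 < a \<and> 0 < b \<and> real (a * b\<^sup>2) \<le> y}"
  proof -
    have fl: "n \<in> {1..nat \<lfloor>y\<rfloor>} \<longleftrightarrow> 0 < n \<and> real n \<le> y" for n
    proof (cases "y \<ge> 0")
      case True
      then show ?thesis by (auto simp: le_nat_iff le_floor_iff)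
    next
      case False
      then show ?thesis by (auto simp: floor_less_iff)
    qed
    show ?thesis
    proof (intro equalityI subsetI)
      fix c assume "c \<in> {(a, b). 0 < a \<and> 0 < b \<and> real (a * b\<^sup>2) \<le> y}"
      then obtain a b where c: "c = (a, b)" "0 < a" "0 < b" "real (a * b\<^sup>2) \<le> y" by auto
      have "a * b\<^sup>2 \<in> {1..nat \<lfloor>y\<rfloor>}" using c by (subst fl) simp
      moreover have "c \<in> D (a * b\<^sup>2)" using c by (simp add: D_def)
      ultimately show "c \<in> (\<Union>n\<in>{1..nat \<lfloor>y\<rfloor>}. D n)" by blast
    next
      fix c assume "c \<in> (\<Union>n\<in>{1..nat \<lfloor>y\<rfloor>}. D n)"
      then obtain n where n: "n \<in> {1..nat \<lfloor>y\<rfloor>}" "c \<in> D n" by blast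
      then show "c \<in> {(a, b). 0 < a \<and> 0 < b \<and> real (a * b\<^sup>2) \<le> y}"
        using n(1)[unfolded fl] by (auto simp: D_def)
    qed
  qed
  finally show ?thesis .
qed

text \<open>
  Lattice points \<open>(a, b)\<close> with \<open>a b\<^sup>2 \<le> y\<close>: those with \<open>b \<le> B\<close> are counted along \<open>a\<close>, the others
  along \<open>b\<close>. In the second range \<open>a \<le> y / B\<^sup>2\<close>.
\<close>
lemma hyperbola_split:
  assumes y: "y > 0" and B: "B \<ge> 1"
  shows "summatory_tau12 y = (\<Sum>b=1..B. real (nat \<lfloor>y / real b ^ 2\<rfloor>))
    + (\<Sum>a=1..nat \<lfloor>y / real B ^ 2\<rfloor>. real (nat \<lfloor>sqrt y / sqrt (real a)\<rfloor> - B))"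
proof -
  define X where "X = (SIGMA b:{1..B}. {1..nat \<lfloor>y / real b ^ 2\<rfloor>})"
  define Y where "Y = (SIGMA a:{1..nat \<lfloor>y / real B ^ 2\<rfloor>}. {B<..nat \<lfloor>sqrt y / sqrt (real a)\<rfloor>})"
  have fl: "n \<le> nat \<lfloor>w\<rfloor> \<longleftrightarrow> real n \<le> w" if "w \<ge> 0" for n w
    using that by (simp add: le_nat_iff le_floor_iff)
  have X: "(b, a) \<in> X \<longleftrightarrow> 0 < a \<and> 0 < b \<and> b \<le> B \<and> real (a * b\<^sup>2) \<le> y" for a b
    using y by (auto simp: X_def fl field_simps)
  have Y: "(a, b) \<in> Y \<longleftrightarrow> 0 < a \<and> B < b \<and> real (a * b\<^sup>2) \<le> y" for a b
  proof -
    have "real b \<le> sqrt y / sqrt (real a) \<longleftrightarrow> real (a * b\<^sup>2) \<le> y" if "a > 0"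
    proof -
      have "real b \<le> sqrt y / sqrt (real a) \<longleftrightarrow> sqrt (real (a * b\<^sup>2)) \<le> sqrt y"
        using that by (simp add: field_simps real_sqrt_mult)
      then show ?thesis by simp
    qed
    moreover have "real a \<le> y / real B ^ 2" if "B < b" "real (a * b\<^sup>2) \<le> y"
    proof -
      have "real a * real B ^ 2 \<le> real a * real b ^ 2"
        using that by (intro mult_left_mono power_mono) auto
      then show ?thesis using that B by (simp add: field_simps)
    qed
    ultimately show ?thesis using y by (auto simp: Y_def fl)
  qed
  have fin: "finite X" "finite Y" by (auto simp: X_def Y_def)
  have "{(a, b). 0 < a \<and> 0 < b \<and> real (a * b\<^sup>2) \<le> y} = prod.swap ` X \<union> Y"
  proof (intro equalityI subsetI)
    fix c assume "c \<in> {(a, b). 0 < a \<and> 0 < b \<and> real (a * b\<^sup>2) \<le> y}"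
    then obtain a b where c: "c = (a, b)" "0 < a" "0 < b" "real (a * b\<^sup>2) \<le> y" by auto
    show "c \<in> prod.swap ` X \<union> Y"
    proof (cases "b \<le> B")
      case True
      then have "(b, a) \<in> X" using c X by simp
      then show ?thesis using c(1) by (auto intro!: image_eqI[of _ _ "(b, a)"])
    next
      case False
      then show ?thesis using c Y by simp
    qed
  qed (use X Y in auto)
  moreover have "prod.swap ` X \<inter> Y = {}"
  proof -
    have "\<not> (b \<le> B \<and> B < b)" for b by simp
    then show ?thesis using X Y by force
  qed
  ultimately have "summatory_tau12 y = real (card (prod.swap ` X) + card Y)"
    using fin by (simp add: summatory_tau12_eq_card card_Un_disjoint)
  also have "card (prod.swap ` X) = card X" by (rule card_image) auto
  finally show ?thesis by (simp add: X_def Y_def card_SigmaI)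
qed

text \<open>
  The hyperbola method with \<open>B\<close> the integer part of \<open>y\<^bsup>1/3\<^esup>\<close>, which balances the numbers \<open>B\<close> and
  \<open>M \<approx> y / B\<^sup>2\<close> of rounding errors. Beyond these the main terms leave
  \<open>2 r m B - m\<^sup>2 B - r\<^sup>2 B\<close>, where \<open>r\<^sup>2 = y / B\<^sup>2\<close> and \<open>m\<^sup>2 = M\<close> is its integer part; this is
  \<open>-B (r - m)\<^sup>2\<close>, of size at most \<open>B\<close>.
\<close>
lemma summatory_tau12_ge_1:
  assumes y: "y \<ge> 1"
  shows "\<bar>summatory_tau12 y - pi\<^sup>2 / 6 * y - Re (zeta (1 / 2)) * sqrt y\<bar> \<le> 6 * y powr (1 / 3)"
proof -
  define Z where "Z = Re (zeta (1 / 2))"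
  define t where "t = y powr (1 / 3)"
  have t: "t \<ge> 1" "t ^ 3 = y"
    using y by (auto simp: t_def ge_one_powr_ge_zero powr_power)
  define B where "B = nat \<lfloor>t\<rfloor>"
  have B: "B \<ge> 1" "real B \<le> t" "t < real B + 1"
    using t by (auto simp: B_def le_nat_iff le_floor_iff of_nat_floor)
  have B2: "t \<le> 2 * real B" using B by linarith
  define q where "q = y / real B ^ 2"
  define M where "M = nat \<lfloor>q\<rfloor>"
  have "t * real B ^ 2 \<le> t * t ^ 2" using B t by (intro mult_left_mono power_mono) auto
  also have t3: "t * t ^ 2 = y" using t(2) by (simp add: eval_nat_numeral)
  finally have q1: "q \<ge> t" using B by (simp add: q_def field_simps)
  have "t * t ^ 2 \<le> t * (2 * real B) ^ 2" using B2 t by (intro mult_left_mono power_mono) auto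
  then have q2: "q \<le> 4 * t" unfolding t3 using B by (simp add: q_def field_simps)
  have M: "M \<ge> 1" "real M \<le> q" "q < real M + 1"
    using t q1 by (auto simp: M_def le_nat_iff le_floor_iff of_nat_floor)
  \<comment> \<open>With \<open>t \<le> q \<le> 4t\<close> and \<open>M\<close> within a factor 2 of \<open>q\<close>, all error terms are bounded by multiples of \<open>t\<close>.\<close>
  have M2: "t \<le> 2 * real M" using M q1 by linarith
  define h where "h = (\<Sum>a=1..M. 1 / sqrt (real a))"
  have h1: "h \<le> 2 * sqrt M + Z + 1 / (2 * sqrt M)"
    using zeta_half_lower[OF M(1)] by (simp add: h_def Z_def)
  have h2: "2 * sqrt M + Z \<le> h"
  proof -
    have "sqrt M \<le> sqrt (real M + 1 / 2)" by simp
    then show ?thesis using zeta_half_upper[of M] unfolding h_def Z_def by linarith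
  qed
  define s where "s = (\<Sum>b=1..B. 1 / real b ^ 2)"
  have s1: "s \<le> pi\<^sup>2 / 6 - 1 / (real B + 1)" and s2: "pi\<^sup>2 / 6 - 1 / B \<le> s"
    using inverse_squares_bounds[OF B(1)] by (auto simp: s_def)
  have "1 / real B - 1 / (real B + 1) \<le> 1 / real B ^ 2"
    using B by (simp add: divide_simps power2_eq_square)
  then have s1: "s \<le> pi\<^sup>2 / 6 - 1 / B + 1 / real B ^ 2" using s1 by linarith
  define U V where "U = (\<Sum>b=1..B. real (nat \<lfloor>y / real b ^ 2\<rfloor>))"
    and "V = (\<Sum>a=1..M. real (nat \<lfloor>sqrt y / sqrt (real a)\<rfloor> - B))"
  have T: "summatory_tau12 y = U + V"
    using hyperbola_split[of y B] y B by (simp add: U_def V_def M_def q_def)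
  have U1: "U \<le> y * s" unfolding U_def s_def sum_distrib_left
    using y by (intro sum_mono) (simp add: of_nat_floor)
  have floor_ge: "w - 1 \<le> real (nat \<lfloor>w\<rfloor>)" for w :: real by linarith
  have "(\<Sum>b=1..B. y * (1 / real b ^ 2) - 1) \<le> U" unfolding U_def
    using floor_ge[of "y / real b ^ 2" for b] by (intro sum_mono) simp
  then have U2: "y * s - B \<le> U" by (simp add: s_def sum_subtractf sum_distrib_left)
  have aB: "real B \<le> sqrt y / sqrt (real a)" if "a \<in> {1..M}" for a
  proof -
    have "real a \<le> y / real B ^ 2" using that M(2) unfolding q_def by (simp add: order.trans)
    then have "real B ^ 2 * real a \<le> y" using B by (simp add: field_simps)
    then have "sqrt (real B ^ 2 * real a) \<le> sqrt y" by simp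
    then show ?thesis using that by (simp add: real_sqrt_mult field_simps)
  qed
  then have aB': "B \<le> nat \<lfloor>sqrt y / sqrt (real a)\<rfloor>" if "a \<in> {1..M}" for a
    using aB[OF that] by (intro le_nat_floor)
  have "V \<le> (\<Sum>a=1..M. sqrt y * (1 / sqrt (real a)) - B)" unfolding V_def
    using aB' y by (intro sum_mono) (simp add: of_nat_diff of_nat_floor)
  then have V1: "V \<le> sqrt y * h - M * B" by (simp add: h_def sum_subtractf sum_distrib_left)
  have "(\<Sum>a=1..M. sqrt y * (1 / sqrt (real a)) - 1 - B) \<le> V" unfolding V_def
  proof (rule sum_mono)
    fix a assume a: "a \<in> {1..M}"
    have "sqrt y * (1 / sqrt (real a)) - 1 \<le> real (nat \<lfloor>sqrt y / sqrt (real a)\<rfloor>)"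
      using floor_ge by simp
    then show "sqrt y * (1 / sqrt (real a)) - 1 - B \<le> real (nat \<lfloor>sqrt y / sqrt (real a)\<rfloor> - B)"
      using aB'[OF a] by (simp add: of_nat_diff)
  qed
  then have V2: "sqrt y * h - M - M * B \<le> V" by (simp add: h_def sum_subtractf sum_distrib_left algebra_simps)
  define r m where "r = sqrt q" and "m = sqrt M"
  have rm: "r\<^sup>2 = q" "m\<^sup>2 = M" "m \<ge> 1" "r \<ge> m" using M by (auto simp: r_def m_def)
  have yq: "y = q * real B ^ 2" using B by (simp add: q_def)
  then have sy: "sqrt y = r * B" by (simp add: r_def real_sqrt_mult)
  have yB: "y / B = r\<^sup>2 * B" using B by (subst yq, unfold rm(1)) (simp add: power2_eq_square)
  have key: "2 * (r * B * m) - m\<^sup>2 * B - r\<^sup>2 * B = - (B * (r - m)\<^sup>2)"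
    by (simp add: power2_eq_square algebra_simps)
  have "r - m \<le> (r - m) * (r + m)" using mult_left_mono[of 1 "r + m" "r - m"] rm by simp
  also have "\<dots> = q - M" using rm by (simp add: power2_eq_square algebra_simps)
  finally have "r - m \<le> 1" using M by linarith
  then have rm1: "(r - m)\<^sup>2 \<le> 1" using rm by (simp add: power_le_one)
  have y0: "y \<ge> 0" and sy0: "sqrt y \<ge> 0" using y by simp_all
  have up: "summatory_tau12 y - pi\<^sup>2 / 6 * y - Z * sqrt y \<le> q + r * B / (2 * m)"
  proof -
    have "U \<le> y * (pi\<^sup>2 / 6 - 1 / B + 1 / real B ^ 2)"
      using U1 mult_left_mono[OF s1 y0] by linarith
    also have "\<dots> = pi\<^sup>2 / 6 * y - r\<^sup>2 * B + q" unfolding yB[symmetric] q_def by (simp add: algebra_simps)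
    finally have 1: "U \<le> pi\<^sup>2 / 6 * y - r\<^sup>2 * B + q" .
    have "V \<le> sqrt y * (2 * m + Z + 1 / (2 * m)) - M * B"
      using V1 mult_left_mono[OF h1 sy0] unfolding m_def by linarith
    also have "\<dots> = 2 * (r * B * m) - m\<^sup>2 * B + Z * sqrt y + r * B / (2 * m)"
      unfolding rm(2) by (simp add: sy algebra_simps)
    finally have "U + V \<le> pi\<^sup>2 / 6 * y + Z * sqrt y + q + r * B / (2 * m) - B * (r - m)\<^sup>2"
      using 1 key by linarith
    moreover have "B * (r - m)\<^sup>2 \<ge> 0" by simp
    ultimately show ?thesis unfolding T by linarith
  qed
  have lo: "summatory_tau12 y - pi\<^sup>2 / 6 * y - Z * sqrt y \<ge> - 2 * real B - M"
  proof -
    have "y * (pi\<^sup>2 / 6 - 1 / B) - B \<le> U"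
      using U2 mult_left_mono[OF s2 y0] by linarith
    moreover have "y * (pi\<^sup>2 / 6 - 1 / B) = pi\<^sup>2 / 6 * y - r\<^sup>2 * B" unfolding yB[symmetric] by (simp add: algebra_simps)
    ultimately have 1: "pi\<^sup>2 / 6 * y - r\<^sup>2 * B - B \<le> U" by simp
    have "sqrt y * (2 * m + Z) - M - M * B \<le> V"
      using V2 mult_left_mono[OF h2 sy0] unfolding m_def by linarith
    moreover have "sqrt y * (2 * m + Z) - M - M * B = 2 * (r * B * m) - m\<^sup>2 * B + Z * sqrt y - M"
      unfolding rm(2) by (simp add: sy algebra_simps)
    ultimately have "pi\<^sup>2 / 6 * y + Z * sqrt y - B - M - B * (r - m)\<^sup>2 \<le> U + V"
      using 1 key by linarith
    moreover have "real B * (r - m)\<^sup>2 \<le> real B * 1" using rm1 by (intro mult_left_mono) auto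
    ultimately show ?thesis unfolding T by linarith
  qed
  have "r * B / (2 * m) \<le> t"
  proof -
    have "r\<^sup>2 \<le> (2 * m)\<^sup>2" unfolding power_mult_distrib rm(1,2) using M by simp
    moreover have "0 \<le> 2 * m" using rm(3) by simp
    ultimately have "r \<le> 2 * m" by (rule power2_le_imp_le)
    then have "r * real B \<le> (2 * m) * t" using B(2) rm(3) by (intro mult_mono) simp_all
    then show ?thesis using rm(3) by (subst pos_divide_le_eq) (simp_all add: ac_simps)
  qed
  then show ?thesis using up lo q2 B(2) M(2) unfolding Z_def[symmetric] t_def[symmetric] by linarith
qed

lemma summatory_tau12_less_1: "y < 1 \<Longrightarrow> summatory_tau12 y = 0"
  by (simp add: summatory_tau12_def floor_less_iff)

text \<open>
  For \<open>y < 1\<close> the summatory function vanishes, and \<open>y\<close> and \<open>sqrt y\<close> are themselves at most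
  \<open>y\<^bsup>1/3\<^esup>\<close>; likewise \<open>y \<le> y\<^bsup>2/3\<^esup>\<close>. Validity on all of \<open>y > 0\<close> is what allows complete sums
  over the shifts later.
\<close>
lemma summatory_tau12_bounds:
  obtains C where "C > 0"
    "\<And>y. y > 0 \<Longrightarrow> \<bar>summatory_tau12 y - pi\<^sup>2 / 6 * y - Re (zeta (1 / 2)) * sqrt y\<bar> \<le> C * y powr (1 / 3)"
    "\<And>y. y > 0 \<Longrightarrow> \<bar>summatory_tau12 y - pi\<^sup>2 / 6 * y\<bar> \<le> C * y powr (2 / 3)"
proof -
  define A Z where "A = pi\<^sup>2 / 6" and "Z = Re (zeta (1 / 2))"
  have A: "A \<ge> 0" by (simp add: A_def)
  have s: "sqrt y = y powr (1 / 2)" if "y > 0" for y using that by (simp add: powr_half_sqrt)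
  have "\<bar>summatory_tau12 y - A * y - Z * sqrt y\<bar> \<le> (6 + A + \<bar>Z\<bar>) * y powr (1 / 3) \<and>
        \<bar>summatory_tau12 y - A * y\<bar> \<le> (6 + A + \<bar>Z\<bar>) * y powr (2 / 3)" if y: "y > 0" for y
  proof (cases "y \<ge> 1")
    case True
    have 1: "\<bar>summatory_tau12 y - A * y - Z * sqrt y\<bar> \<le> 6 * y powr (1 / 3)"
      using summatory_tau12_ge_1[OF True] by (simp add: A_def Z_def)
    have "6 * y powr (1 / 3) \<le> 6 * y powr (2 / 3)" using True by (simp add: powr_mono)
    moreover have "\<bar>Z\<bar> * sqrt y \<le> \<bar>Z\<bar> * y powr (2 / 3)"
      unfolding s[OF y] using True by (intro mult_left_mono powr_mono) auto
    moreover have "\<bar>Z * sqrt y\<bar> = \<bar>Z\<bar> * sqrt y" using y by (simp add: abs_mult)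
    moreover have "0 \<le> A * y powr (2 / 3)" "0 \<le> A * y powr (1 / 3)" "0 \<le> \<bar>Z\<bar> * y powr (1 / 3)"
      using A by auto
    ultimately show ?thesis using 1 unfolding distrib_right by (intro conjI; linarith)
  next
    case False
    then have y1: "y \<le> 1" by simp
    have T: "summatory_tau12 y = 0" using False by (simp add: summatory_tau12_less_1)
    have "A * y \<le> A * y powr (1 / 3)" "A * y \<le> A * y powr (2 / 3)"
      using powr_mono'[of "1 / 3" 1 y] powr_mono'[of "2 / 3" 1 y] y y1 A by (auto intro!: mult_left_mono)
    moreover have "\<bar>Z\<bar> * sqrt y \<le> \<bar>Z\<bar> * y powr (1 / 3)"
      unfolding s[OF y] using y y1 by (intro mult_left_mono powr_mono') auto
    moreover have "\<bar>Z * sqrt y\<bar> = \<bar>Z\<bar> * sqrt y" "\<bar>A * y\<bar> = A * y" using y A by (simp_all add: abs_mult)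
    moreover have "0 \<le> y powr (1 / 3)" "0 \<le> y powr (2 / 3)" "0 \<le> \<bar>Z\<bar> * y powr (2 / 3)" by auto
    ultimately show ?thesis unfolding T distrib_right by (intro conjI; linarith)
  qed
  moreover have "6 + A + \<bar>Z\<bar> > 0" using A by linarith
  ultimately show ?thesis using that[of "6 + A + \<bar>Z\<bar>"] by (simp add: A_def Z_def)
qed

section \<open>The double sum\<close>

lemma sum_tau12_quot:
  assumes "x \<ge> 0" "d > 0"
  shows "(\<Sum>m\<in>{1..nat \<lfloor>x\<rfloor>}. tau12_quot m d) = summatory_tau12 (x / real d)"
proof -
  have fl: "n \<le> nat \<lfloor>w\<rfloor> \<longleftrightarrow> real n \<le> w" if "w \<ge> 0" for n w
    using that by (simp add: le_nat_iff le_floor_iff)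
  have mem: "d * k \<le> nat \<lfloor>x\<rfloor> \<longleftrightarrow> k \<le> nat \<lfloor>x / real d\<rfloor>" for k
    using assms by (simp add: fl field_simps)
  have "(\<Sum>m\<in>{1..nat \<lfloor>x\<rfloor>}. tau12_quot m d) = (\<Sum>m\<in>{m\<in>{1..nat \<lfloor>x\<rfloor>}. d dvd m}. real (tau12 (m div d)))"
    unfolding tau12_quot_def by (rule sum.inter_filter[symmetric]) simp
  also have "\<dots> = summatory_tau12 (x / real d)" unfolding summatory_tau12_def
  proof (rule sum.reindex_bij_witness[of _ "\<lambda>k. d * k" "\<lambda>m. m div d"])
    fix m assume "m \<in> {m \<in> {1..nat \<lfloor>x\<rfloor>}. d dvd m}"
    then obtain k where k: "m = d * k" "1 \<le> m" "m \<le> nat \<lfloor>x\<rfloor>" by (auto elim: dvdE)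
    then have "1 \<le> k" by (auto intro!: Suc_leI Nat.gr0I)
    then show "m div d \<in> {1..nat \<lfloor>x / real d\<rfloor>}" using k assms mem[of k] by simp
  next
    fix k assume "k \<in> {1..nat \<lfloor>x / real d\<rfloor>}"
    then show "d * k \<in> {m \<in> {1..nat \<lfloor>x\<rfloor>}. d dvd m}" using assms mem[of k] by (auto simp: Suc_le_eq)
  qed (use assms in auto)
  finally show ?thesis .
qed

lemma shifted_pairs_divisors:
  assumes "\<sigma> \<in> shifted_pairs"
  shows "left_divisor \<sigma> > 0" "right_divisor \<sigma> > 0" "\<sigma> p \<noteq> (0, 0) \<Longrightarrow> p \<le> left_divisor \<sigma>"
proof -
  have fin: "finite {p. \<sigma> p \<noteq> (0, 0)}" and p: "\<sigma> p \<noteq> (0, 0) \<Longrightarrow> prime p \<and> \<sigma> p \<in> shifts" for p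
    using assms by (auto simp: prime_choices_def)
  show 1: "left_divisor \<sigma> > 0" "right_divisor \<sigma> > 0"
    using p unfolding left_divisor_def right_divisor_def
    by (auto intro!: prod_pos simp: prime_gt_0_nat)
  assume p0: "\<sigma> p \<noteq> (0, 0)"
  then have "fst (\<sigma> p) \<noteq> 0" using p[OF p0] by auto
  then have "p dvd p ^ fst (\<sigma> p)" by simp
  also have "\<dots> dvd left_divisor \<sigma>" unfolding left_divisor_def using fin p0 by (intro dvd_prodI) auto
  finally show "p \<le> left_divisor \<sigma>" using 1 by (simp add: dvd_imp_le)
qed

text \<open>
  Sum the convolution identity over \<open>m, n \<le> x\<close>, with \<open>P\<close> the primes up to \<open>x\<close>. A choice that is
  nontrivial at a larger prime has a left divisor beyond \<open>x\<close>, so that its term is zero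
  and the finite sum is a complete one.
\<close>
lemma has_sum_double_summatory:
  assumes x: "x > 0"
  shows "((\<lambda>\<sigma>. pair_sign \<sigma> * summatory_tau12 (x / left_divisor \<sigma>) * summatory_tau12 (x / right_divisor \<sigma>))
    has_sum (\<Sum>m\<in>{1..nat \<lfloor>x\<rfloor>}. \<Sum>n\<in>{1..nat \<lfloor>x\<rfloor>}. real (tau12 (m * n)))) shifted_pairs"
proof (rule has_sum_finite_neutralI)
  define K where "K = nat \<lfloor>x\<rfloor>"
  define D where "D = choices shifts (0, 0) (primes_le K)"
  show "finite D" unfolding D_def by (intro finite_choices) auto
  show D: "D \<subseteq> shifted_pairs" unfolding D_def by (rule choices_subset_prime_choices)
  have quot: "(\<Sum>m\<in>{1..K}. tau12_quot m d) = summatory_tau12 (x / real d)" if "d > 0" for d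
    unfolding K_def using x that by (intro sum_tau12_quot) auto
  have pf: "prime_factors m \<subseteq> primes_le K" if "m \<in> {1..K}" for m
    using that by (auto simp: in_prime_factors_iff dest!: dvd_imp_le)
  have "(\<Sum>m\<in>{1..K}. \<Sum>n\<in>{1..K}. real (tau12 (m * n))) =
    (\<Sum>m\<in>{1..K}. \<Sum>n\<in>{1..K}. \<Sum>\<sigma>\<in>D. pair_sign \<sigma> * tau12_quot m (left_divisor \<sigma>) * tau12_quot n (right_divisor \<sigma>))"
    unfolding D_def using pf by (intro sum.cong refl tau12_mult) auto
  also have "\<dots> = (\<Sum>m\<in>{1..K}. \<Sum>\<sigma>\<in>D. \<Sum>n\<in>{1..K}. pair_sign \<sigma> * tau12_quot m (left_divisor \<sigma>) * tau12_quot n (right_divisor \<sigma>))"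
    by (intro sum.cong refl sum.swap)
  also have "\<dots> = (\<Sum>\<sigma>\<in>D. \<Sum>m\<in>{1..K}. \<Sum>n\<in>{1..K}. pair_sign \<sigma> * tau12_quot m (left_divisor \<sigma>) * tau12_quot n (right_divisor \<sigma>))"
    by (rule sum.swap)
  also have "\<dots> = (\<Sum>\<sigma>\<in>D. pair_sign \<sigma> * (\<Sum>m\<in>{1..K}. tau12_quot m (left_divisor \<sigma>)) * (\<Sum>n\<in>{1..K}. tau12_quot n (right_divisor \<sigma>)))"
    unfolding mult.assoc sum_product by (simp add: sum_distrib_left)
  also have "\<dots> = (\<Sum>\<sigma>\<in>D. pair_sign \<sigma> * summatory_tau12 (x / left_divisor \<sigma>) * summatory_tau12 (x / right_divisor \<sigma>))"
  proof (rule sum.cong[OF refl])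
    fix \<sigma> assume "\<sigma> \<in> D"
    then have \<sigma>: "\<sigma> \<in> shifted_pairs" using D by blast
    show "pair_sign \<sigma> * (\<Sum>m\<in>{1..K}. tau12_quot m (left_divisor \<sigma>)) * (\<Sum>n\<in>{1..K}. tau12_quot n (right_divisor \<sigma>))
      = pair_sign \<sigma> * summatory_tau12 (x / left_divisor \<sigma>) * summatory_tau12 (x / right_divisor \<sigma>)"
      unfolding quot[OF shifted_pairs_divisors(1)[OF \<sigma>]] quot[OF shifted_pairs_divisors(2)[OF \<sigma>]] ..
  qed
  finally show "(\<Sum>m\<in>{1..nat \<lfloor>x\<rfloor>}. \<Sum>n\<in>{1..nat \<lfloor>x\<rfloor>}. real (tau12 (m * n))) = \<dots>" unfolding K_def .
  fix \<sigma> assume \<sigma>: "\<sigma> \<in> shifted_pairs - D"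
  then have val: "\<sigma> p \<noteq> (0, 0) \<Longrightarrow> prime p \<and> \<sigma> p \<in> shifts" for p
    unfolding prime_choices_def by blast
  have "\<exists>p. \<sigma> p \<noteq> (0, 0) \<and> p > K"
  proof (rule ccontr)
    assume no: "\<not> (\<exists>p. \<sigma> p \<noteq> (0, 0) \<and> p > K)"
    have "\<sigma> p \<in> shifts" for p by (cases "\<sigma> p = (0, 0)") (use val[of p] in simp_all)
    moreover have "\<sigma> p = (0, 0)" if "p \<notin> primes_le K" for p
      using that no val[of p] by (auto simp: not_le)
    ultimately have "\<sigma> \<in> D" unfolding D_def choices_def by blast
    then show False using \<sigma> by blast
  qed
  then obtain p where p: "\<sigma> p \<noteq> (0, 0)" "p > K" by blast
  then have "left_divisor \<sigma> > K" using shifted_pairs_divisors(3)[of \<sigma> p] \<sigma> by fastforce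
  then have "x < left_divisor \<sigma>" unfolding K_def using x by linarith
  then have "x / left_divisor \<sigma> < 1" using shifted_pairs_divisors(1)[of \<sigma>] \<sigma> by simp
  then show "pair_sign \<sigma> * summatory_tau12 (x / left_divisor \<sigma>) * summatory_tau12 (x / right_divisor \<sigma>) = 0"
    by (simp add: summatory_tau12_less_1)
qed

lemma has_sum_diff:
  fixes f g :: "_ \<Rightarrow> real"
  assumes "(f has_sum a) A" "(g has_sum b) A"
  shows "((\<lambda>x. f x - g x) has_sum (a - b)) A"
  using has_sum_add[OF assms(1) has_sum_uminusI[OF assms(2)]] by simp

lemma has_sum_pair_weight:
  assumes "s + w > 1" "2 * s + w > 1" "s + 2 * w > 1"
  shows "(pair_weight s w has_sum infsum (pair_weight s w) shifted_pairs) shifted_pairs"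
  by (rule has_sum_infsum, rule abs_summable_summable) (use pair_weight_abs_summable[OF assms] in simp)

text \<open>
  The Euler factors are symmetric in \<open>u\<close> and \<open>v\<close>.
\<close>
lemma infsum_pair_weight_commute:
  assumes "s + w > 1" "2 * s + w > 1" "s + 2 * w > 1"
  shows "infsum (pair_weight s w) shifted_pairs = infsum (pair_weight w s) shifted_pairs"
proof (rule LIMSEQ_unique)
  show "(\<lambda>N. \<Prod>p\<in>primes_le N. pair_factor (real p powr - s) (real p powr - w))
      \<longlonglongrightarrow> infsum (pair_weight s w) shifted_pairs"
    by (rule pair_weight_euler_product[OF assms])
  have "pair_factor u v = pair_factor v u" for u v by (simp add: pair_factor_def algebra_simps)
  then show "(\<lambda>N. \<Prod>p\<in>primes_le N. pair_factor (real p powr - s) (real p powr - w))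
      \<longlonglongrightarrow> infsum (pair_weight w s) shifted_pairs"
    using pair_weight_euler_product[of w s] assms by (simp add: add.commute)
qed

lemma pair_weight_scale:
  assumes "\<sigma> \<in> shifted_pairs" "x > 0"
  shows "pair_sign \<sigma> * ((x / left_divisor \<sigma>) powr s * (x / right_divisor \<sigma>) powr w)
    = x powr (s + w) * pair_weight s w \<sigma>"
  using shifted_pairs_divisors[OF assms(1)] assms(2)
  by (simp add: pair_weight_def powr_divide powr_minus_divide powr_add)

text \<open>
  Termwise comparison of two series over the shifts: \<open>E\<close> is the term minus its main parts, and \<open>B\<close>
  is the bound from the two estimates for the summatory function.
\<close>
lemma double_sum_error:
  obtains K where "\<And>x. x \<ge> 1 \<Longrightarrow>
    \<bar>(\<Sum>m\<in>{1..nat \<lfloor>x\<rfloor>}. \<Sum>n\<in>{1..nat \<lfloor>x\<rfloor>}. real (tau12 (m * n))) - (C1 * x ^ 2 + C2 * x powr (3 / 2))\<bar>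
      \<le> K * x powr (4 / 3)"
proof -
  define A Z where "A = pi\<^sup>2 / 6" and "Z = Re (zeta (1 / 2))"
  define T where "T = summatory_tau12"
  have A: "A > 0" by (simp add: A_def)
  obtain C where C: "C > 0"
    "\<And>y. y > 0 \<Longrightarrow> \<bar>T y - A * y - Z * sqrt y\<bar> \<le> C * y powr (1 / 3)"
    "\<And>y. y > 0 \<Longrightarrow> \<bar>T y - A * y\<bar> \<le> C * y powr (2 / 3)"
    using summatory_tau12_bounds unfolding A_def Z_def T_def by metis
  define W where "W s w = infsum (pair_weight s w) shifted_pairs" for s w
  define V where "V s w = infsum (\<lambda>\<sigma>. \<bar>pair_weight s w \<sigma>\<bar>) shifted_pairs" for s w
  have hsV: "((\<lambda>\<sigma>. \<bar>pair_weight s w \<sigma>\<bar>) has_sum V s w) shifted_pairs"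
    if "s + w > 1" "2 * s + w > 1" "s + 2 * w > 1" for s w
    unfolding V_def using pair_weight_abs_summable[OF that] by (rule has_sum_infsum)
  define K where "K = (A * C + C * C) * (V 1 (1/3) + V (1/3) 1 + V (2/3) (2/3))"
  have prod_bound: "\<bar>T a * T b - A * A * (a * b) - A * Z * (a * sqrt b) - A * Z * (sqrt a * b)\<bar>
      \<le> (A * C + C * C) * (a * b powr (1/3) + a powr (1/3) * b + a powr (2/3) * b powr (2/3))"
    if "a > 0" "b > 0" for a b
  proof -
    \<comment> \<open>The fine estimate is used against the factors \<open>A a\<close>, \<open>A b\<close>, the crude one in the product of errors.\<close>
    have "T a * T b - A * A * (a * b) - A * Z * (a * sqrt b) - A * Z * (sqrt a * b)
      = A * (a * (T b - A * b - Z * sqrt b)) + A * ((T a - A * a - Z * sqrt a) * b)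
        + (T a - A * a) * (T b - A * b)"
      by (simp add: algebra_simps)
    also have "\<bar>\<dots>\<bar> \<le> \<bar>A * (a * (T b - A * b - Z * sqrt b))\<bar> + \<bar>A * ((T a - A * a - Z * sqrt a) * b)\<bar>
        + \<bar>(T a - A * a) * (T b - A * b)\<bar>" by linarith
    also have "\<dots> \<le> A * (a * (C * b powr (1/3))) + A * ((C * a powr (1/3)) * b)
        + (C * a powr (2/3)) * (C * b powr (2/3))"
      unfolding abs_mult using that A C
      by (intro add_mono mult_mono) (auto intro!: mult_nonneg_nonneg)
    also have "\<dots> = A * C * (a * b powr (1/3) + a powr (1/3) * b) + C * C * (a powr (2/3) * b powr (2/3))"
      by (simp add: algebra_simps)
    also have "\<dots> \<le> (A * C + C * C) * (a * b powr (1/3) + a powr (1/3) * b)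
        + (A * C + C * C) * (a powr (2/3) * b powr (2/3))"
      using that A C by (intro add_mono mult_right_mono) auto
    finally show ?thesis by (simp add: algebra_simps)
  qed
  have "\<bar>(\<Sum>m\<in>{1..nat \<lfloor>x\<rfloor>}. \<Sum>n\<in>{1..nat \<lfloor>x\<rfloor>}. real (tau12 (m * n))) - (C1 * x ^ 2 + C2 * x powr (3 / 2))\<bar>
      \<le> K * x powr (4 / 3)" if "x \<ge> 1" for x
  proof -
    have x: "x > 0" using that by simp
    define S where "S = (\<Sum>m\<in>{1..nat \<lfloor>x\<rfloor>}. \<Sum>n\<in>{1..nat \<lfloor>x\<rfloor>}. real (tau12 (m * n)))"
    define E where "E \<sigma> = pair_sign \<sigma> * T (x / left_divisor \<sigma>) * T (x / right_divisor \<sigma>)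
      - A * A * x powr 2 * pair_weight 1 1 \<sigma> - A * Z * x powr (3/2) * pair_weight 1 (1/2) \<sigma>
      - A * Z * x powr (3/2) * pair_weight (1/2) 1 \<sigma>" for \<sigma>
    define B where "B \<sigma> = (A * C + C * C) * x powr (4/3) *
      (\<bar>pair_weight 1 (1/3) \<sigma>\<bar> + \<bar>pair_weight (1/3) 1 \<sigma>\<bar> + \<bar>pair_weight (2/3) (2/3) \<sigma>\<bar>)" for \<sigma>
    have hs: "(pair_weight s w has_sum W s w) shifted_pairs"
      if "s + w > 1" "2 * s + w > 1" "s + 2 * w > 1" for s w
      unfolding W_def by (rule has_sum_pair_weight[OF that])
    have hE: "(E has_sum (S - A * A * x powr 2 * W 1 1 - A * Z * x powr (3/2) * W 1 (1/2)
      - A * Z * x powr (3/2) * W (1/2) 1)) shifted_pairs"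
      unfolding E_def
      by (intro has_sum_diff has_sum_cmult_right hs)
        (use has_sum_double_summatory[OF x] in \<open>simp_all add: S_def T_def\<close>)
    have hB: "(B has_sum (K * x powr (4/3))) shifted_pairs"
    proof -
      have "(B has_sum ((A * C + C * C) * x powr (4/3) * (V 1 (1/3) + V (1/3) 1 + V (2/3) (2/3)))) shifted_pairs"
        unfolding B_def by (intro has_sum_cmult_right has_sum_add hsV) simp_all
      then show ?thesis by (simp add: K_def ac_simps)
    qed
    have EB: "\<bar>E \<sigma>\<bar> \<le> B \<sigma>" if \<sigma>: "\<sigma> \<in> shifted_pairs" for \<sigma>
    proof -
      define a b where "a = x / left_divisor \<sigma>" and "b = x / right_divisor \<sigma>"
      have ab: "a > 0" "b > 0" using shifted_pairs_divisors[OF \<sigma>] x by (auto simp: a_def b_def)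
      have scale: "x powr (s + w) * pair_weight s w \<sigma> = pair_sign \<sigma> * (a powr s * b powr w)" for s w
        using pair_weight_scale[OF \<sigma> x] by (simp add: a_def b_def)
      have sq: "sqrt a = a powr (1/2)" "sqrt b = b powr (1/2)" using ab by (simp_all add: powr_half_sqrt)
      have "E \<sigma> = pair_sign \<sigma> * (T a * T b - A * A * (a * b) - A * Z * (a * sqrt b) - A * Z * (sqrt a * b))"
        using scale[of 1 1] scale[of 1 "1/2"] scale[of "1/2" 1] ab
        by (simp add: E_def a_def[symmetric] b_def[symmetric] sq algebra_simps)
      then have "\<bar>E \<sigma>\<bar> = \<bar>T a * T b - A * A * (a * b) - A * Z * (a * sqrt b) - A * Z * (sqrt a * b)\<bar>"
        by (simp add: abs_mult abs_pair_sign)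
      also have "\<dots> \<le> (A * C + C * C) * (a * b powr (1/3) + a powr (1/3) * b + a powr (2/3) * b powr (2/3))"
        by (rule prod_bound[OF ab])
      also have "\<dots> = B \<sigma>"
      proof -
        have abs_scale: "x powr (4/3) * \<bar>pair_weight s w \<sigma>\<bar> = a powr s * b powr w" if "s + w = 4/3" for s w
        proof -
          have "x powr (4/3) * \<bar>pair_weight s w \<sigma>\<bar> = \<bar>x powr (s + w) * pair_weight s w \<sigma>\<bar>"
            by (simp add: abs_mult that)
          also have "\<dots> = a powr s * b powr w" unfolding scale by (simp add: abs_mult abs_pair_sign)
          finally show ?thesis .
        qed
        show ?thesis unfolding B_def mult.assoc distrib_left
          using ab by (simp add: abs_scale)
      qed
      finally show ?thesis .
    qed
    have "S - A * A * x powr 2 * W 1 1 - A * Z * x powr (3/2) * W 1 (1/2) - A * Z * x powr (3/2) * W (1/2) 1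
        \<le> K * x powr (4/3)"
      by (rule has_sum_mono[OF hE hB]) (use EB in \<open>auto dest: abs_le_D1\<close>)
    moreover have "- (S - A * A * x powr 2 * W 1 1 - A * Z * x powr (3/2) * W 1 (1/2) - A * Z * x powr (3/2) * W (1/2) 1)
        \<le> K * x powr (4/3)"
      by (rule has_sum_mono[OF has_sum_uminusI[OF hE] hB]) (use EB in \<open>auto dest: abs_le_D2\<close>)
    moreover have "C1 * x ^ 2 + C2 * x powr (3/2) = A * A * x powr 2 * W 1 1 + A * Z * x powr (3/2) * W 1 (1/2) + A * Z * x powr (3/2) * W (1/2) 1"
    proof -
      have "W (1/2) 1 = W 1 (1/2)" unfolding W_def by (rule infsum_pair_weight_commute) auto
      then show ?thesis unfolding C1_eq C2_eq W_def[symmetric] A_def[symmetric] Z_def[symmetric]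
        using x by (simp add: power2_eq_square algebra_simps)
    qed
    ultimately show ?thesis unfolding S_def[symmetric] by linarith
  qed
  then show ?thesis by (rule that)
qed

lemma double_sum_bigo:
  assumes "\<epsilon> > 0"
  shows "(\<lambda>x::real. (\<Sum>m\<in>{1..nat \<lfloor>x\<rfloor>}. \<Sum>n\<in>{1..nat \<lfloor>x\<rfloor>}. real (tau12 (m * n)))
          - (C1 * x ^ 2 + C2 * x powr (3 / 2))) \<in> O[at_top](\<lambda>x. x powr (10 / 7 + \<epsilon>))"
proof -
  obtain K where K: "\<And>x. x \<ge> 1 \<Longrightarrow>
    \<bar>(\<Sum>m\<in>{1..nat \<lfloor>x\<rfloor>}. \<Sum>n\<in>{1..nat \<lfloor>x\<rfloor>}. real (tau12 (m * n))) - (C1 * x ^ 2 + C2 * x powr (3 / 2))\<bar>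
      \<le> K * x powr (4 / 3)" using double_sum_error by blast
  have "(\<lambda>x::real. (\<Sum>m\<in>{1..nat \<lfloor>x\<rfloor>}. \<Sum>n\<in>{1..nat \<lfloor>x\<rfloor>}. real (tau12 (m * n)))
          - (C1 * x ^ 2 + C2 * x powr (3 / 2))) \<in> O[at_top](\<lambda>x. x powr (4 / 3))"
    by (rule bigoI[of _ K]) (use K in \<open>auto intro!: eventually_at_top_linorderI[of 1]\<close>)
  also have "(\<lambda>x::real. x powr (4 / 3)) \<in> O[at_top](\<lambda>x. x powr (10 / 7 + \<epsilon>))"
    by (rule bigoI[of _ 1])
      (use assms in \<open>auto intro!: eventually_at_top_linorderI[of 1] powr_mono\<close>)
  finally show ?thesis .
qed

section \<open>Numerical tools\<close>

lemma powr_minus_three_halves: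
  assumes "x > 0" shows "x powr - (3 / 2) = 1 / (x * sqrt x)"
proof -
  have "x powr (1 + 1 / 2) = x * sqrt x" unfolding powr_add using assms by (simp add: powr_half_sqrt)
  then show ?thesis by (simp add: powr_minus_divide)
qed

text \<open>
  The analogues of \<open>zeta_half_upper\<close> and \<open>zeta_half_lower\<close> at \<open>3/2\<close>: comparison with the
  integral makes one correction of the partial sums decreasing, the trapezoidal rule makes the other
  increasing.
\<close>
lemma zeta_3_2_bounds:
  assumes "N \<ge> 1"
  shows "(\<Sum>n=1..N. 1 / (real n * sqrt (real n))) + 2 / sqrt N - 1 / (2 * (real N * sqrt N))
      \<le> (\<Sum>n. real (Suc n) powr - (3 / 2))"
    and "(\<Sum>n. real (Suc n) powr - (3 / 2)) \<le> (\<Sum>n=1..N. 1 / (real n * sqrt (real n))) + 2 / sqrt N"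
proof -
  define X where "X N = (\<Sum>n=1..N. 1 / (real n * sqrt (real n)))" for N :: nat
  define Z where "Z = (\<Sum>n. real (Suc n) powr - (3 / 2))"
  have "summable (\<lambda>n. real (Suc n) powr - (3 / 2))"
    by (subst summable_Suc_iff, subst summable_real_powr_iff) simp
  then have "(\<lambda>n. real (Suc n) powr - (3 / 2)) sums Z" by (simp add: Z_def summable_sums)
  moreover have "(\<Sum>n<N. real (Suc n) powr - (3 / 2)) = X N" for N
    by (induction N) (simp_all add: X_def powr_minus_three_halves)
  ultimately have lim: "X \<longlonglongrightarrow> Z" by (simp add: sums_def)
  have step: "u\<^sup>2 - v\<^sup>2 = u\<^sup>2 * v\<^sup>2" "u \<ge> v" "v > 0"
      "u ^ 3 = 1 / (real (Suc n) * sqrt (Suc n))" "v ^ 3 = 1 / (real (Suc (Suc n)) * sqrt (Suc (Suc n)))"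
    if "u = 1 / sqrt (Suc n)" "v = 1 / sqrt (Suc (Suc n))" for u v :: real and n :: nat
  proof -
    define r s where "r = sqrt (real (Suc n))" and "s = sqrt (real (Suc (Suc n)))"
    have rs: "r > 0" "s > 0" "r \<le> s" "s * s = r * r + 1" "real (Suc n) = r * r" "real (Suc (Suc n)) = s * s"
      by (simp_all add: r_def s_def)
    have uv: "u = 1 / r" "v = 1 / s" using that by (simp_all add: r_def s_def)
    show "u\<^sup>2 - v\<^sup>2 = u\<^sup>2 * v\<^sup>2" unfolding uv power2_eq_square
    proof -
      have "r * r + 1 > 0" using rs(1) by (simp add: add_pos_pos)
      then show "1 / r * (1 / r) - 1 / s * (1 / s) = 1 / r * (1 / r) * (1 / s * (1 / s))"
        using rs(1,2,4) by (simp add: divide_simps)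
    qed
    show "u \<ge> v" "v > 0" unfolding uv using rs by (simp_all add: frac_le)
    show "u ^ 3 = 1 / (real (Suc n) * sqrt (Suc n))" unfolding r_def[symmetric] rs(5) uv
      using rs(1) by (simp add: power3_eq_cube)
    show "v ^ 3 = 1 / (real (Suc (Suc n)) * sqrt (Suc (Suc n)))" unfolding s_def[symmetric] rs(6) uv
      using rs(2) by (simp add: power3_eq_cube)
  qed
  \<comment> \<open>With \<open>u = 1 / sqrt n\<close> and \<open>v = 1 / sqrt (n + 1)\<close> both step inequalities are polynomial.\<close>
  have le: "v ^ 3 + 2 * v \<le> 2 * u" and ge: "2 * u \<le> 2 * v + (u ^ 3 + v ^ 3) / 2"
    if uv: "u\<^sup>2 - v\<^sup>2 = u\<^sup>2 * v\<^sup>2" "u \<ge> v" "v > 0" for u v :: real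
  proof -
    have "(u - v) * (u + v) = u\<^sup>2 - v\<^sup>2" by (simp add: power2_eq_square algebra_simps)
    also have "\<dots> = u\<^sup>2 * v\<^sup>2" by (rule uv(1))
    finally have diff: "(u - v) * (u + v) = u\<^sup>2 * v\<^sup>2" .
    have "v ^ 3 * (u + v) \<le> 2 * (u\<^sup>2 * v\<^sup>2)"
    proof -
      have "v ^ 3 * (u + v) = v\<^sup>2 * (v * u + v * v)" by (simp add: eval_nat_numeral algebra_simps)
      also have "\<dots> \<le> v\<^sup>2 * (u * u + u * u)"
        using uv by (intro mult_left_mono add_mono mult_mono) auto
      finally show ?thesis by (simp add: eval_nat_numeral algebra_simps)
    qed
    also have "\<dots> = (2 * (u - v)) * (u + v)" using diff by (simp only: mult.assoc)
    finally have "v ^ 3 \<le> 2 * (u - v)" using uv by simp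
    then show "v ^ 3 + 2 * v \<le> 2 * u" by simp
    have "(2 * (u - v)) * (u + v) = 2 * (u\<^sup>2 * v\<^sup>2)" using diff by (simp only: mult.assoc)
    also have "\<dots> \<le> (u ^ 3 + v ^ 3) / 2 * (u + v)"
    proof -
      have "(u ^ 3 + v ^ 3) * (u + v) - 4 * (u\<^sup>2 * v\<^sup>2) = (u\<^sup>2 - v\<^sup>2)\<^sup>2 + u * v * (u - v)\<^sup>2"
        by (simp add: eval_nat_numeral algebra_simps)
      moreover have "u * v * (u - v)\<^sup>2 \<ge> 0" using uv by simp
      ultimately have "4 * (u\<^sup>2 * v\<^sup>2) \<le> (u ^ 3 + v ^ 3) * (u + v)"
        using zero_le_power2[of "u\<^sup>2 - v\<^sup>2"] by linarith
      then show ?thesis by simp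
    qed
    finally have "2 * (u - v) \<le> (u ^ 3 + v ^ 3) / 2"
      by (rule mult_right_le_imp_le) (use uv in simp)
    then show "2 * u \<le> 2 * v + (u ^ 3 + v ^ 3) / 2" by (simp add: field_simps)
  qed
  have Xs: "X (Suc (Suc n)) = X (Suc n) + 1 / (real (Suc (Suc n)) * sqrt (Suc (Suc n)))" for n
    by (simp add: X_def)
  have "decseq (\<lambda>n. X (Suc n) + 2 * (1 / sqrt (Suc n)))"
  proof (rule decseq_SucI)
    fix n
    show "X (Suc (Suc n)) + 2 * (1 / sqrt (Suc (Suc n))) \<le> X (Suc n) + 2 * (1 / sqrt (Suc n))"
      using le[OF step(1-3)[OF refl refl], of n] step(5)[OF refl refl, of n] unfolding Xs by linarith
  qed
  moreover have "(\<lambda>n. X (Suc n) + 2 * (1 / sqrt (Suc n))) \<longlonglongrightarrow> Z + 0"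
    by (intro tendsto_add LIMSEQ_Suc lim) real_asymp
  ultimately have "Z + 0 \<le> X (Suc (N - 1)) + 2 * (1 / sqrt (Suc (N - 1)))" by (rule decseq_ge)
  then show "(\<Sum>n. real (Suc n) powr - (3 / 2)) \<le> (\<Sum>n=1..N. 1 / (real n * sqrt (real n))) + 2 / sqrt N"
    using assms by (simp add: X_def Z_def)
  have "incseq (\<lambda>n. X (Suc n) + 2 * (1 / sqrt (Suc n)) - (1 / (real (Suc n) * sqrt (Suc n))) / 2)"
  proof (rule incseq_SucI)
    fix n
    show "X (Suc n) + 2 * (1 / sqrt (Suc n)) - (1 / (real (Suc n) * sqrt (Suc n))) / 2
      \<le> X (Suc (Suc n)) + 2 * (1 / sqrt (Suc (Suc n))) - (1 / (real (Suc (Suc n)) * sqrt (Suc (Suc n)))) / 2"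
    proof -
      have arith: "x + 2 * u - c / 2 \<le> x + d + 2 * v - d / 2" if "2 * u \<le> 2 * v + (c + d) / 2"
        for x u v c d :: real using that by (simp add: field_simps)
      show ?thesis unfolding Xs
        by (rule arith) (use ge[OF step(1-3)[OF refl refl], of n] in \<open>unfold step(4,5)[OF refl refl, of n]\<close>)
    qed
  qed
  moreover have "(\<lambda>n. X (Suc n) + 2 * (1 / sqrt (Suc n)) - (1 / (real (Suc n) * sqrt (Suc n))) / 2)
      \<longlonglongrightarrow> Z + 0 - 0"
    by (intro tendsto_add tendsto_diff LIMSEQ_Suc lim) real_asymp+
  ultimately have "X (Suc (N - 1)) + 2 * (1 / sqrt (Suc (N - 1))) - (1 / (real (Suc (N - 1)) * sqrt (Suc (N - 1)))) / 2 \<le> Z + 0 - 0"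
    by (rule incseq_le)
  then show "(\<Sum>n=1..N. 1 / (real n * sqrt (real n))) + 2 / sqrt N - 1 / (2 * (real N * sqrt N))
      \<le> (\<Sum>n. real (Suc n) powr - (3 / 2))"
    using assms by (simp add: X_def Z_def)
qed

text \<open>
  Products of fractions in fixed-point arithmetic, rounded down or up after each factor. The
  recursion runs on integer numerals, so that rewriting evaluates it.
\<close>
fun floor_prod :: "int \<Rightarrow> (int \<times> int) list \<Rightarrow> int" where
  "floor_prod c [] = c"
| "floor_prod c ((a, b) # xs) = floor_prod (c * a div b) xs"

fun ceiling_prod :: "int \<Rightarrow> (int \<times> int) list \<Rightarrow> int" where
  "ceiling_prod c [] = c"
| "ceiling_prod c ((a, b) # xs) = ceiling_prod (c * a div b + 1) xs"

lemma
  assumes "\<forall>(a, b)\<in>set xs. a \<ge> 0 \<and> b > 0"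
  shows floor_prod_le: "real_of_int (floor_prod c xs) \<le> real_of_int c * (\<Prod>(a, b)\<leftarrow>xs. real_of_int a / real_of_int b)"
    and ceiling_prod_ge: "real_of_int c * (\<Prod>(a, b)\<leftarrow>xs. real_of_int a / real_of_int b) \<le> real_of_int (ceiling_prod c xs)"
proof -
  have "real_of_int (floor_prod c xs) \<le> real_of_int c * (\<Prod>(a, b)\<leftarrow>xs. real_of_int a / real_of_int b) \<and>
    real_of_int c * (\<Prod>(a, b)\<leftarrow>xs. real_of_int a / real_of_int b) \<le> real_of_int (ceiling_prod c xs)"
    using assms
  proof (induction xs arbitrary: c)
    case (Cons x xs)
    obtain a b where x: "x = (a, b)" by force
    define Q where "Q = (\<Prod>(a, b)\<leftarrow>xs. real_of_int a / real_of_int b)"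
    have prems: "\<forall>(a, b)\<in>set xs. a \<ge> 0 \<and> b > 0" and b: "b > 0" using Cons.prems by (auto simp: x)
    have Q: "Q \<ge> 0" using prems unfolding Q_def by (induction xs) auto
    have "real_of_int (c * a div b) \<le> real_of_int c * (real_of_int a / real_of_int b)"
      using real_of_int_div4[of "c * a" b] by simp
    from mult_right_mono[OF this Q]
    have 1: "real_of_int (floor_prod (c * a div b) xs) \<le> real_of_int c * (real_of_int a / real_of_int b) * Q"
      using Cons.IH[OF prems, of "c * a div b"] unfolding Q_def by linarith
    have "real_of_int c * (real_of_int a / real_of_int b) \<le> real_of_int (c * a div b + 1)"
      using real_of_int_div3[of "c * a" b] by simp
    from mult_right_mono[OF this Q]
    have 2: "real_of_int c * (real_of_int a / real_of_int b) * Q \<le> real_of_int (ceiling_prod (c * a div b + 1) xs)"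
      using Cons.IH[OF prems, of "c * a div b + 1"] unfolding Q_def by linarith
    from 1 2 show ?case by (simp add: x Q_def mult.assoc)
  qed simp
  then show "real_of_int (floor_prod c xs) \<le> real_of_int c * (\<Prod>(a, b)\<leftarrow>xs. real_of_int a / real_of_int b)"
    "real_of_int c * (\<Prod>(a, b)\<leftarrow>xs. real_of_int a / real_of_int b) \<le> real_of_int (ceiling_prod c xs)" by auto
qed

text \<open>
  Primes beyond \<open>M \<ge> 2\<close> are odd, and over the odd numbers the bound telescopes in steps of two.
\<close>
lemma prime_tail_sum:
  assumes N: "even M" and h: "\<And>n. n > M \<Longrightarrow> odd n \<Longrightarrow> 0 \<le> h n \<and> h n \<le> H (n - 1) - H (n + 1)"
    and H: "\<And>n. H n \<ge> (0 :: real)" and M: "M \<ge> 2"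
  shows "(\<Sum>p\<in>primes_le N - primes_le M. h p) \<le> H M"
proof -
  obtain m where m: "M = 2 * m" using N by (elim evenE)
  have "(\<Sum>p\<in>primes_le N - primes_le M. h p) \<le> (\<Sum>p\<in>(\<lambda>j. 2 * j + 1) ` {m..m + N}. h p)"
  proof (rule sum_mono2)
    show "primes_le N - primes_le M \<subseteq> (\<lambda>j. 2 * j + 1) ` {m..m + N}"
    proof
      fix p assume p: "p \<in> primes_le N - primes_le M"
      then have "odd p" using M prime_odd_nat[of p] by auto
      then obtain j where "p = 2 * j + 1" by (elim oddE)
      then show "p \<in> (\<lambda>j. 2 * j + 1) ` {m..m + N}" using p m by auto
    qed
    show "0 \<le> h p" if "p \<in> (\<lambda>j. 2 * j + 1) ` {m..m + N} - (primes_le N - primes_le M)" for p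
      using that h[of p] m by auto
  qed simp
  also have "\<dots> = (\<Sum>j\<in>{m..m + N}. h (2 * j + 1))"
    by (subst sum.reindex) (auto simp: inj_on_def)
  also have "\<dots> \<le> (\<Sum>j\<in>{m..m + N}. H (2 * j) - H (2 * Suc j))"
  proof (rule sum_mono)
    show "h (2 * j + 1) \<le> H (2 * j) - H (2 * Suc j)" if "j \<in> {m..m + N}" for j
      using h[of "2 * j + 1"] that m by simp
  qed
  also have "\<dots> = H (2 * m) - H (2 * Suc (m + N))"
    by (induction N) simp_all
  also have "\<dots> \<le> H M" using H by (simp add: m)
  finally show ?thesis .
qed

text \<open>
  Factors in \<open>[0, 1]\<close> make the partial products decrease; how much they still lose is bounded by the
  sum of the defects \<open>h n\<close>.
\<close>
lemma euler_product_limit_bounds: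
  assumes lim: "(\<lambda>N. \<Prod>p\<in>primes_le N. f p) \<longlonglongrightarrow> (L :: real)"
    and f: "\<And>p. prime p \<Longrightarrow> 0 \<le> f p \<and> f p \<le> 1"
    and M: "even M" "M \<ge> 2"
    and h: "\<And>n. n > M \<Longrightarrow> odd n \<Longrightarrow> 0 \<le> h n \<and> h n \<le> 1 \<and> 1 - h n \<le> f n \<and> h n \<le> H (n - 1) - H (n + 1)"
    and H: "\<And>n. H n \<ge> 0"
  shows "L \<le> (\<Prod>p\<in>primes_le M. f p)" "(\<Prod>p\<in>primes_le M. f p) * (1 - H M) \<le> L"
proof -
  define P where "P = (\<Prod>p\<in>primes_le M. f p)"
  have P: "P \<ge> 0" unfolding P_def using f by (intro prod_nonneg) auto
  have split: "(\<Prod>p\<in>primes_le N. f p) = P * (\<Prod>p\<in>primes_le N - primes_le M. f p)" if "N \<ge> M" for N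
    unfolding P_def using that by (subst prod.union_disjoint[symmetric]) (auto intro!: prod.cong)
  have up: "(\<Prod>p\<in>primes_le N. f p) \<le> P" if "N \<ge> M" for N
    unfolding split[OF that] using f P by (intro mult_left_le prod_le_1) auto
  have lo: "P * (1 - H M) \<le> (\<Prod>p\<in>primes_le N. f p)" if "N \<ge> M" for N
    unfolding split[OF that]
  proof (rule mult_left_mono[OF _ P])
    have odd: "odd p" "p > M" if "p \<in> primes_le N - primes_le M" for p
      using that M prime_odd_nat[of p] by auto
    have "(\<Sum>p\<in>primes_le N - primes_le M. h p) \<le> H M"
      by (rule prime_tail_sum) (use M h H in auto)
    then have "1 - H M \<le> 1 - (\<Sum>p\<in>primes_le N - primes_le M. h p)" by simp
    also have "\<dots> \<le> (\<Prod>p\<in>primes_le N - primes_le M. 1 - h p)"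
      by (rule Weierstrass_prod_ineq) (use h odd in auto)
    also have "\<dots> \<le> (\<Prod>p\<in>primes_le N - primes_le M. f p)"
      using h odd by (intro prod_mono) auto
    finally show "1 - H M \<le> (\<Prod>p\<in>primes_le N - primes_le M. f p)" .
  qed
  show "L \<le> (\<Prod>p\<in>primes_le M. f p)" unfolding P_def[symmetric]
    by (rule LIMSEQ_le_const2[OF lim]) (use up in blast)
  show "(\<Prod>p\<in>primes_le M. f p) * (1 - H M) \<le> L" unfolding P_def[symmetric]
    by (rule LIMSEQ_le_const[OF lim]) (use lo in blast)
qed

definition small_primes :: "nat list" where
  "small_primes = [2, 3, 5, 7, 11, 13, 17, 19, 23, 29, 31, 37, 41, 43, 47, 53, 59, 61, 67, 71, 73, 79, 83, 89, 97]"

lemma primes_le_100: "primes_le 100 = set small_primes"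
proof -
  have "primes_le 100 = set (filter prime [0..<101])" by auto
  also have "filter prime [0..<101] = small_primes" by code_simp
  finally show ?thesis .
qed

lemma prod_primes_le_100: "(\<Prod>p\<in>primes_le 100. f p) = (\<Prod>p\<leftarrow>small_primes. f p)"
  unfolding primes_le_100 by (rule prod.distinct_set_conv_list) (simp add: small_primes_def)

lemma inverse_square_telescope:
  assumes "x > (1 :: real)" shows "1 / x ^ 2 \<le> (1 / (x - 1) - 1 / (x + 1)) / 2"
proof -
  have "x ^ 2 > 1" using assms by simp
  then have "1 / x ^ 2 \<le> 1 / (x ^ 2 - 1)"
    using assms by (intro divide_left_mono mult_pos_pos) auto
  also have "\<dots> = (1 / (x - 1) - 1 / (x + 1)) / 2"
  proof -
    have "x ^ 2 - 1 = (x - 1) * (x + 1)" by (simp add: power2_eq_square algebra_simps)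
    then show ?thesis using assms by (simp add: divide_simps)
  qed
  finally show ?thesis .
qed

lemma inverse_cube_telescope:
  assumes "x > (1 :: real)" shows "1 / x ^ 3 \<le> (1 / (x - 1) ^ 2 - 1 / (x + 1) ^ 2) / 4"
proof -
  have x2: "x ^ 2 > 1" using assms by simp
  have "(x ^ 2 - 1) ^ 2 \<le> (x ^ 2) ^ 2" using x2 by (intro power_mono) auto
  moreover have "(x ^ 2 - 1) ^ 2 > 0" using x2 by (intro zero_less_power) linarith
  ultimately have "x / (x ^ 2) ^ 2 \<le> x / (x ^ 2 - 1) ^ 2"
    using assms by (intro divide_left_mono mult_pos_pos) auto
  moreover have "1 / x ^ 3 = x / (x ^ 2) ^ 2" using assms by (simp add: eval_nat_numeral)
  ultimately have "1 / x ^ 3 \<le> x / (x ^ 2 - 1) ^ 2" by simp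
  also have "\<dots> = (1 / (x - 1) ^ 2 - 1 / (x + 1) ^ 2) / 4"
  proof -
    have "x ^ 2 - 1 = (x - 1) * (x + 1)" by (simp add: power2_eq_square algebra_simps)
    then have "(x ^ 2 - 1) ^ 2 = (x - 1) ^ 2 * (x + 1) ^ 2" by (simp add: power_mult_distrib)
    moreover have "(x + 1) ^ 2 - (x - 1) ^ 2 = 4 * x" by (simp add: power2_eq_square algebra_simps)
    then have "x = ((x + 1) ^ 2 - (x - 1) ^ 2) / 4" by simp
    ultimately have "x / (x ^ 2 - 1) ^ 2 = ((x + 1) ^ 2 - (x - 1) ^ 2) / 4 / ((x - 1) ^ 2 * (x + 1) ^ 2)" by metis
    moreover have "(b - a) / 4 / (a * b) = (1 / a - 1 / b) / 4" if "a > 0" "b > 0" for a b :: real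
      using that by (simp add: divide_simps)
    from this[of "(x - 1) ^ 2" "(x + 1) ^ 2"] assms
    have "((x + 1) ^ 2 - (x - 1) ^ 2) / 4 / ((x - 1) ^ 2 * (x + 1) ^ 2) = (1 / (x - 1) ^ 2 - 1 / (x + 1) ^ 2) / 4"
      by (simp only: zero_less_power diff_gt_0_iff_gt add_pos_pos zero_less_one less_trans[OF zero_less_one])
    ultimately show ?thesis by (rule trans)
  qed
  finally show ?thesis .
qed

section \<open>Numerical value of \<open>C1\<close>\<close>

text \<open>
  The local factor of \<open>C1\<close> times \<open>(1 - p\<^sup>-\<^sup>2)\<^sup>3\<close>, which is \<open>1 - 2p\<^sup>-\<^sup>3 - p\<^sup>-\<^sup>4 + 2p\<^sup>-\<^sup>5\<close>.
\<close>
definition C1_residual_factor :: "nat \<Rightarrow> real" where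
  "C1_residual_factor p = (1 - (1 / p)\<^sup>2) * pair_factor (1 / p) (1 / p)"

lemma C1_residual_product:
  "(\<lambda>N. \<Prod>p\<in>primes_le N. C1_residual_factor p) \<longlonglongrightarrow> C1 / (pi\<^sup>2 / 6) ^ 3"
proof -
  define A where "A = pi\<^sup>2 / 6"
  have A: "A > 0" by (simp add: A_def)
  have "(\<lambda>N. (\<Prod>p\<in>primes_le N. pair_factor (1 / p) (1 / p) / (1 - (1 / p)\<^sup>2)\<^sup>2) *
      (A * (\<Prod>p\<in>primes_le N. 1 - (1 / real p)\<^sup>2)) ^ 3 / A ^ 3) \<longlonglongrightarrow> C1 * 1 ^ 3 / A ^ 3"
    unfolding A_def by (intro tendsto_intros C1_product zeta_2_euler_product) auto
  moreover have "(\<Prod>p\<in>primes_le N. pair_factor (1 / p) (1 / p) / (1 - (1 / p)\<^sup>2)\<^sup>2) *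
      (A * (\<Prod>p\<in>primes_le N. 1 - (1 / real p)\<^sup>2)) ^ 3 / A ^ 3 = (\<Prod>p\<in>primes_le N. C1_residual_factor p)" for N
  proof -
    have "(\<Prod>p\<in>primes_le N. pair_factor (1 / p) (1 / p) / (1 - (1 / p)\<^sup>2)\<^sup>2) *
      (A * (\<Prod>p\<in>primes_le N. 1 - (1 / real p)\<^sup>2)) ^ 3 / A ^ 3 =
      (\<Prod>p\<in>primes_le N. pair_factor (1 / p) (1 / p) / (1 - (1 / p)\<^sup>2)\<^sup>2 * (1 - (1 / real p)\<^sup>2) ^ 3)"
      unfolding power_mult_distrib prod_power_distrib prod.distrib using A by simp
    also have "\<dots> = (\<Prod>p\<in>primes_le N. C1_residual_factor p)"
    proof (rule prod.cong[OF refl])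
      fix p assume "p \<in> primes_le N"
      then have "real p > 1" using prime_gt_1_nat by auto
      then have "(1 / real p)\<^sup>2 < 1" by (simp add: power_one_over)
      moreover have "a / b\<^sup>2 * b ^ 3 = b * a" if "b \<noteq> 0" for a b :: real
        using that by (simp add: power2_eq_square power3_eq_cube)
      ultimately show "pair_factor (1 / p) (1 / p) / (1 - (1 / p)\<^sup>2)\<^sup>2 * (1 - (1 / real p)\<^sup>2) ^ 3 = C1_residual_factor p"
        unfolding C1_residual_factor_def by simp
    qed
    finally show ?thesis .
  qed
  ultimately show ?thesis by (simp add: A_def)
qed

text \<open>
  As a rational number the factor at \<open>q\<close> is \<open>(q\<^sup>2 - 1)(q\<^sup>3 + q - 2) / q\<^sup>5\<close>.
\<close>
lemma C1_residual_product_100: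
  "(\<Prod>p\<in>primes_le 100. C1_residual_factor p) \<in> {0.67296475083..0.67296475086}"
proof -
  define xs where "xs = map (\<lambda>p. let q = int p in ((q ^ 2 - 1) * (q ^ 3 + q - 2), q ^ 5)) small_primes"
  have "(\<Prod>(a, b)\<leftarrow>xs. real_of_int a / real_of_int b) = (\<Prod>p\<in>primes_le 100. C1_residual_factor p)"
    unfolding prod_primes_le_100 xs_def map_map
  proof (intro arg_cong[where f = prod_list] map_cong refl)
    fix p assume "p \<in> set small_primes"
    then have "p > 0" unfolding primes_le_100[symmetric] by (simp add: prime_gt_0_nat)
    then show "((\<lambda>(a, b). real_of_int a / real_of_int b) \<circ> (\<lambda>p. let q = int p in ((q\<^sup>2 - 1) * (q ^ 3 + q - 2), q ^ 5))) p
        = C1_residual_factor p"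
      by (simp add: C1_residual_factor_def pair_factor_def Let_def field_simps eval_nat_numeral)
  qed
  moreover have "\<forall>(a, b)\<in>set xs. a \<ge> 0 \<and> b > 0" by (simp add: xs_def small_primes_def)
  moreover have "floor_prod (10 ^ 12) xs = 672964750832" "ceiling_prod (10 ^ 12) xs = 672964750857"
    by (simp_all add: xs_def small_primes_def)
  ultimately show ?thesis
    using floor_prod_le[of xs "10 ^ 12"] ceiling_prod_ge[of xs "10 ^ 12"] by simp
qed

text \<open>
  Beyond 100 the defect \<open>2u\<^sup>3 + u\<^sup>4 - 2u\<^sup>5\<close> is at most \<open>(21/10) u\<^sup>3\<close>, which gives a relative tail of
  about \<open>5 * 10\<^sup>-\<^sup>5\<close>. As \<open>C1\<close> is about \<open>2.9952\<close>, only the lower bound is delicate.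
\<close>
lemma C1_bounds: "2.995 \<le> C1" "C1 < 2.996"
proof -
  define h where "h n = 21 / 10 / real n ^ 3" for n
  define H where "H n = 21 / 40 / real n ^ 2" for n
  have f: "0 \<le> C1_residual_factor p \<and> C1_residual_factor p \<le> 1" if "prime p" for p
  proof -
    define u where "u = 1 / real p"
    have u: "0 \<le> u" "u \<le> 1 / 2" using prime_ge_2_nat[OF that] by (auto simp: u_def field_simps)
    have eq: "C1_residual_factor p = (1 - u\<^sup>2) * (1 + u\<^sup>2 - 2 * u ^ 3)"
      by (simp add: C1_residual_factor_def pair_factor_def u_def[symmetric] eval_nat_numeral algebra_simps)
    have u2: "u\<^sup>2 \<le> 1" using u by (simp add: power_le_one)
    have "u\<^sup>2 * (2 * u) \<le> u\<^sup>2 * 1" using u by (intro mult_left_mono) auto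
    then have u3: "2 * u ^ 3 \<le> u\<^sup>2" by (simp add: eval_nat_numeral)
    have "(1 - u\<^sup>2) * (1 + u\<^sup>2 - 2 * u ^ 3) \<le> (1 - u\<^sup>2) * (1 + u\<^sup>2)"
      using u u2 by (intro mult_left_mono) auto
    also have "\<dots> = 1 - (u\<^sup>2)\<^sup>2" by (simp add: power2_eq_square algebra_simps)
    also have "\<dots> \<le> 1" by simp
    finally show ?thesis unfolding eq using u2 u3 by simp
  qed
  have hH: "0 \<le> h n \<and> h n \<le> 1 \<and> 1 - h n \<le> C1_residual_factor n \<and> h n \<le> H (n - 1) - H (n + 1)"
    if "n > 100" for n
  proof -
    define u where "u = 1 / real n"
    have n: "real n > 100" using that by simp
    have u: "0 \<le> u" "u \<le> 1 / 100" using n by (auto simp: u_def field_simps)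
    have h: "h n = 21 / 10 * u ^ 3" by (simp add: h_def u_def power_one_over)
    have "u ^ 3 * (1 / 10 - u + 2 * u\<^sup>2) \<ge> 0" using u by (intro mult_nonneg_nonneg) auto
    moreover have "C1_residual_factor n = 1 - 2 * u ^ 3 - u ^ 4 + 2 * u ^ 5"
      by (simp add: C1_residual_factor_def pair_factor_def u_def[symmetric] eval_nat_numeral algebra_simps)
    ultimately have 1: "1 - h n \<le> C1_residual_factor n"
      unfolding h by (simp add: eval_nat_numeral algebra_simps)
    have 2: "h n \<le> 1"
    proof -
      have "u ^ 3 \<le> (1 / 100) ^ 3" using u by (intro power_mono)
      then show ?thesis unfolding h by (simp add: eval_nat_numeral)
    qed
    have "21 / 10 * (1 / real n ^ 3) \<le> 21 / 10 * ((1 / (real n - 1) ^ 2 - 1 / (real n + 1) ^ 2) / 4)"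
      using inverse_cube_telescope[of "real n"] n by (intro mult_left_mono) auto
    then have "h n \<le> H (n - 1) - H (n + 1)"
      using that by (simp add: h_def H_def of_nat_diff add.commute)
    then show ?thesis using 1 2 by (simp add: h_def)
  qed
  have H: "H n \<ge> 0" for n by (simp add: H_def)
  have A: "1.644934 \<le> pi\<^sup>2 / 6" "pi\<^sup>2 / 6 \<le> 1.644935"
  proof -
    have "(3.14159265) ^ 2 \<le> pi\<^sup>2" using pi_approx by (intro power_mono) auto
    then show "1.644934 \<le> pi\<^sup>2 / 6" by (simp add: power2_eq_square)
    have "pi\<^sup>2 \<le> (3.14159266) ^ 2" using pi_approx by (intro power_mono) auto
    then show "pi\<^sup>2 / 6 \<le> 1.644935" by (simp add: power2_eq_square)
  qed
  note bounds = euler_product_limit_bounds[OF C1_residual_product f, of 100 h H]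
  have A3: "(1.644934) ^ 3 \<le> (pi\<^sup>2 / 6) ^ 3" "(pi\<^sup>2 / 6) ^ 3 \<le> (1.644935) ^ 3"
    using A by (auto intro!: power_mono)
  have pos: "(pi\<^sup>2 / 6) ^ 3 > 0" by simp
  have "C1 / (pi\<^sup>2 / 6) ^ 3 \<le> (\<Prod>p\<in>primes_le 100. C1_residual_factor p)"
    by (rule bounds(1)) (use hH H in auto)
  also have "\<dots> \<le> 0.67296475086" using C1_residual_product_100 by simp
  finally have "C1 / (pi\<^sup>2 / 6) ^ 3 \<le> 0.67296475086" .
  then have "C1 \<le> 0.67296475086 * (pi\<^sup>2 / 6) ^ 3" using pos by (simp add: pos_divide_le_eq)
  then show "C1 < 2.996" using A3(2) by (simp add: eval_nat_numeral)
  have "0.67296475083 * (1 - H 100) \<le> C1 / (pi\<^sup>2 / 6) ^ 3"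
  proof -
    have "0.67296475083 * (1 - H 100) \<le> (\<Prod>p\<in>primes_le 100. C1_residual_factor p) * (1 - H 100)"
      using C1_residual_product_100 by (intro mult_right_mono) (auto simp: H_def)
    also have "\<dots> \<le> C1 / (pi\<^sup>2 / 6) ^ 3" by (rule bounds(2)) (use hH H in auto)
    finally show ?thesis .
  qed
  then have "0.67296475083 * (1 - H 100) * (pi\<^sup>2 / 6) ^ 3 \<le> C1" using pos by (simp add: pos_le_divide_eq)
  moreover have "0.67296475083 * (1 - H 100) * (1.644934) ^ 3 \<le> 0.67296475083 * (1 - H 100) * (pi\<^sup>2 / 6) ^ 3"
    using A3(1) by (intro mult_left_mono) (auto simp: H_def)
  ultimately show "2.995 \<le> C1" by (simp add: H_def eval_nat_numeral)
qed

section \<open>Numerical value of \<open>C2\<close>\<close>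

text \<open>
  The local factor of \<open>C2\<close> times \<open>1 - p\<^bsup>-3/2\<^esup>\<close>, which removes the slowest term \<open>p\<^bsup>-3/2\<^esup>\<close>.
\<close>
definition C2_residual_factor :: "nat \<Rightarrow> real" where
  "C2_residual_factor p = (1 - 1 / (p * sqrt p)) * (1 + 1 / (sqrt p * (real p + 1)))"

lemma C2_residual_product:
  "(\<lambda>N. \<Prod>p\<in>primes_le N. C2_residual_factor p) \<longlonglongrightarrow>
     (pi\<^sup>2 / 6) * infsum (pair_weight 1 (1 / 2)) shifted_pairs / (\<Sum>n. real (Suc n) powr - (3 / 2))"
proof -
  define Z where "Z = (\<Sum>n. real (Suc n) powr - (3 / 2))"
  have Z: "Z > 0" using zeta_3_2_bounds(1)[of 1] by (simp add: Z_def)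
  have "(\<lambda>N. Z * (\<Prod>p\<in>primes_le N. 1 - real p powr - (3 / 2)) *
      (\<Prod>p\<in>primes_le N. 1 + 1 / (sqrt p * (real p + 1))) / Z)
    \<longlonglongrightarrow> 1 * (pi\<^sup>2 / 6 * infsum (pair_weight 1 (1 / 2)) shifted_pairs) / Z"
    unfolding Z_def by (intro tendsto_intros C2_product zeta_times_euler_product) (use Z in \<open>auto simp: Z_def\<close>)
  moreover have "Z * (\<Prod>p\<in>primes_le N. 1 - real p powr - (3 / 2)) *
      (\<Prod>p\<in>primes_le N. 1 + 1 / (sqrt p * (real p + 1))) / Z = (\<Prod>p\<in>primes_le N. C2_residual_factor p)" for N
  proof -
    have "(\<Prod>p\<in>primes_le N. C2_residual_factor p) =
      (\<Prod>p\<in>primes_le N. (1 - real p powr - (3 / 2)) * (1 + 1 / (sqrt p * (real p + 1))))"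
      by (intro prod.cong refl) (simp add: C2_residual_factor_def powr_minus_three_halves prime_gt_0_nat)
    then show ?thesis using Z by (simp add: prod.distrib)
  qed
  ultimately show ?thesis by (simp add: Z_def)
qed

text \<open>
  The integer parts of \<open>10\<^sup>4 sqrt p\<close>; their squares certify the rational bounds for \<open>sqrt p\<close>.
\<close>
definition small_prime_roots :: "nat \<Rightarrow> int" where
  "small_prime_roots p = the (map_of (zip small_primes
    [14142, 17320, 22360, 26457, 33166, 36055, 41231, 43588, 47958, 53851, 55677,
     60827, 64031, 65574, 68556, 72801, 76811, 78102, 81853, 84261, 85440, 88881, 91104,
     94339, 98488]) p)"

text \<open>
  The factor is \<open>(1 - r / p\<^sup>2)(1 + r / (p (p + 1)))\<close> with \<open>r = sqrt p\<close>. It decreases in one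
  occurrence of \<open>r\<close> and increases in the other, so that these are bounded separately by \<open>k / 10\<^sup>4\<close> and
  \<open>(k + 1) / 10\<^sup>4\<close>.
\<close>
lemma C2_residual_factor_bounds:
  assumes p: "p > 0" and k: "k \<ge> 0" "k ^ 2 \<le> 10 ^ 8 * int p" "10 ^ 8 * int p \<le> (k + 1) ^ 2"
  shows "real_of_int ((10 ^ 4 * int p ^ 2 - (k + 1)) * (10 ^ 4 * int p * (int p + 1) + k)) /
      real_of_int (10 ^ 8 * int p ^ 3 * (int p + 1)) \<le> C2_residual_factor p"
    and "C2_residual_factor p \<le> real_of_int ((10 ^ 4 * int p ^ 2 - k) * (10 ^ 4 * int p * (int p + 1) + (k + 1))) /
      real_of_int (10 ^ 8 * int p ^ 3 * (int p + 1))"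
proof -
  define r t where "r = sqrt (real p)" and "t = real_of_int k / 10 ^ 4"
  have r: "r > 0" "r * r = real p" using p by (auto simp: r_def)
  have "real_of_int (k ^ 2) \<le> real_of_int (10 ^ 8 * int p)" "real_of_int (10 ^ 8 * int p) \<le> real_of_int ((k + 1) ^ 2)"
    using k by (simp_all only: of_int_le_iff)
  then have "t ^ 2 \<le> real p" "real p \<le> (t + 1 / 10 ^ 4) ^ 2"
    by (simp_all add: t_def power_divide power2_eq_square field_simps)
  moreover have t0: "t \<ge> 0" using k by (simp add: t_def)
  ultimately have t: "t \<le> r" "r \<le> t + 1 / 10 ^ 4"
    unfolding r_def by (auto intro: real_le_rsqrt real_le_lsqrt)
  have p1: "real p \<ge> 1" using p by simp
  have eq: "C2_residual_factor p = (1 - r / real p ^ 2) * (1 + r / (real p * (real p + 1)))"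
  proof -
    have "1 / (real p * r) = r / real p ^ 2" "1 / (r * (real p + 1)) = r / (real p * (real p + 1))"
      using r by (simp_all add: divide_simps power2_eq_square r(2)[symmetric])
    then show ?thesis by (simp add: C2_residual_factor_def r_def)
  qed
  have rp: "r \<le> real p ^ 2"
  proof -
    have "r * 1 \<le> r * (r * (r * r))"
      using r p1 by (intro mult_left_mono) (auto intro!: mult_ge1_I simp: r_def)
    also have "\<dots> = real p ^ 2" unfolding power2_eq_square r(2)[symmetric] by simp
    finally show ?thesis by simp
  qed
  have lower: "(1 - (t + 1 / 10 ^ 4) / real p ^ 2) * (1 + t / (real p * (real p + 1))) \<le> C2_residual_factor p"
    unfolding eq
  proof (rule mult_mono)
    show "1 - (t + 1 / 10 ^ 4) / real p ^ 2 \<le> 1 - r / real p ^ 2"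
      using t by (intro diff_left_mono divide_right_mono) auto
    show "1 + t / (real p * (real p + 1)) \<le> 1 + r / (real p * (real p + 1))"
      using t by (intro add_left_mono divide_right_mono) auto
  qed (use rp t0 p1 in \<open>auto simp: divide_simps\<close>)
  have upper: "C2_residual_factor p \<le> (1 - t / real p ^ 2) * (1 + (t + 1 / 10 ^ 4) / (real p * (real p + 1)))"
    unfolding eq
  proof (rule mult_mono)
    show "1 - r / real p ^ 2 \<le> 1 - t / real p ^ 2"
      using t by (intro diff_left_mono divide_right_mono) auto
    show "1 + r / (real p * (real p + 1)) \<le> 1 + (t + 1 / 10 ^ 4) / (real p * (real p + 1))"
      using t by (intro add_left_mono divide_right_mono) auto
    show "0 \<le> 1 - t / real p ^ 2" using rp t p1 by (simp add: divide_simps)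
    show "0 \<le> 1 + r / (real p * (real p + 1))" using r by simp
  qed
  have split: "real_of_int ((10 ^ 4 * int p ^ 2 - a) * (10 ^ 4 * int p * (int p + 1) + b)) /
      real_of_int (10 ^ 8 * int p ^ 3 * (int p + 1))
      = (1 - real_of_int a / 10 ^ 4 / real p ^ 2) * (1 + real_of_int b / 10 ^ 4 / (real p * (real p + 1)))" for a b
    using p1 by (simp add: divide_simps add_pos_pos) (simp add: eval_nat_numeral algebra_simps)
  show "real_of_int ((10 ^ 4 * int p ^ 2 - (k + 1)) * (10 ^ 4 * int p * (int p + 1) + k)) /
      real_of_int (10 ^ 8 * int p ^ 3 * (int p + 1)) \<le> C2_residual_factor p"
    unfolding split using lower by (simp add: t_def add_divide_distrib)
  show "C2_residual_factor p \<le> real_of_int ((10 ^ 4 * int p ^ 2 - k) * (10 ^ 4 * int p * (int p + 1) + (k + 1))) /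
      real_of_int (10 ^ 8 * int p ^ 3 * (int p + 1))"
    unfolding split using upper by (simp add: t_def add_divide_distrib)
qed

lemma C2_residual_product_100:
  "(\<Prod>p\<in>primes_le 100. C2_residual_factor p) \<in> {0.7096..0.7097}"
proof -
  define lo where "lo = (\<lambda>p. let q = int p; k = small_prime_roots p in
    ((10 ^ 4 * q ^ 2 - (k + 1)) * (10 ^ 4 * q * (q + 1) + k), 10 ^ 8 * q ^ 3 * (q + 1)))"
  define hi where "hi = (\<lambda>p. let q = int p; k = small_prime_roots p in
    ((10 ^ 4 * q ^ 2 - k) * (10 ^ 4 * q * (q + 1) + (k + 1)), 10 ^ 8 * q ^ 3 * (q + 1)))"
  have roots: "\<forall>p\<in>set small_primes. small_prime_roots p \<ge> 0 \<and> small_prime_roots p ^ 2 \<le> 10 ^ 8 * int p \<and>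
      10 ^ 8 * int p \<le> (small_prime_roots p + 1) ^ 2"
    by (simp add: small_primes_def small_prime_roots_def)
  have pos: "p > 0" if "p \<in> set small_primes" for p
    using that unfolding primes_le_100[symmetric] by (simp add: prime_gt_0_nat)
  have ok: "\<forall>(a, b)\<in>set (map lo small_primes). a \<ge> 0 \<and> b > 0" "\<forall>(a, b)\<in>set (map hi small_primes). a \<ge> 0 \<and> b > 0"
    by (simp_all add: lo_def hi_def small_primes_def small_prime_roots_def)
  have list_prod: "(\<Prod>(a, b)\<leftarrow>map g small_primes. real_of_int a / real_of_int b)
      = (\<Prod>p\<in>primes_le 100. case g p of (a, b) \<Rightarrow> real_of_int a / real_of_int b)" for g
    unfolding prod_primes_le_100 by (simp add: o_def)
  have bounds: "(case lo p of (a, b) \<Rightarrow> real_of_int a / real_of_int b) \<le> C2_residual_factor p"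
      "C2_residual_factor p \<le> (case hi p of (a, b) \<Rightarrow> real_of_int a / real_of_int b)"
      "0 \<le> (case lo p of (a, b) \<Rightarrow> real_of_int a / real_of_int b)" if "p \<in> primes_le 100" for p
  proof -
    have p: "p \<in> set small_primes" using that primes_le_100 by blast
    show "(case lo p of (a, b) \<Rightarrow> real_of_int a / real_of_int b) \<le> C2_residual_factor p"
      using C2_residual_factor_bounds(1)[OF pos[OF p]] roots p by (simp add: lo_def Let_def)
    show "C2_residual_factor p \<le> (case hi p of (a, b) \<Rightarrow> real_of_int a / real_of_int b)"
      using C2_residual_factor_bounds(2)[OF pos[OF p]] roots p by (simp add: hi_def Let_def)
    have "case lo p of (a, b) \<Rightarrow> a \<ge> 0 \<and> b > 0" using ok(1) p by auto
    then show "0 \<le> (case lo p of (a, b) \<Rightarrow> real_of_int a / real_of_int b)" by (auto split: prod.splits)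
  qed
  have "real_of_int (floor_prod (10 ^ 12) (map lo small_primes)) \<le> 10 ^ 12 * (\<Prod>p\<in>primes_le 100. C2_residual_factor p)"
  proof (rule order.trans[OF floor_prod_le[OF ok(1)]])
    have "(\<Prod>(a, b)\<leftarrow>map lo small_primes. real_of_int a / real_of_int b) \<le> (\<Prod>p\<in>primes_le 100. C2_residual_factor p)"
      unfolding list_prod using bounds by (intro prod_mono) auto
    then show "real_of_int (10 ^ 12) * (\<Prod>(a, b)\<leftarrow>map lo small_primes. real_of_int a / real_of_int b)
      \<le> 10 ^ 12 * (\<Prod>p\<in>primes_le 100. C2_residual_factor p)" by simp
  qed
  moreover have "10 ^ 12 * (\<Prod>p\<in>primes_le 100. C2_residual_factor p) \<le> real_of_int (ceiling_prod (10 ^ 12) (map hi small_primes))"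
  proof (rule order.trans[OF _ ceiling_prod_ge[OF ok(2)]])
    have "(\<Prod>p\<in>primes_le 100. C2_residual_factor p) \<le> (\<Prod>(a, b)\<leftarrow>map hi small_primes. real_of_int a / real_of_int b)"
      unfolding list_prod using bounds by (intro prod_mono) (auto intro: order.trans)
    then show "10 ^ 12 * (\<Prod>p\<in>primes_le 100. C2_residual_factor p)
      \<le> real_of_int (10 ^ 12) * (\<Prod>(a, b)\<leftarrow>map hi small_primes. real_of_int a / real_of_int b)" by simp
  qed
  moreover have "floor_prod (10 ^ 12) (map lo small_primes) = 709623495220"
      "ceiling_prod (10 ^ 12) (map hi small_primes) = 709687493523"
    by (simp_all add: lo_def hi_def small_primes_def small_prime_roots_def)
  ultimately show ?thesis by simp
qed

lemma sum_1_to_10: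
  fixes f :: "nat \<Rightarrow> real"
  shows "(\<Sum>n=1..10. f n) = f 1 + f 2 + f 3 + f 4 + f 5 + f 6 + f 7 + f 8 + f 9 + f 10"
  by (simp add: eval_nat_numeral)

lemma sqrt_bounds:
  "1.41421 \<le> sqrt 2" "sqrt 2 \<le> 1.41422" "1.73205 \<le> sqrt 3" "sqrt 3 \<le> 1.73206"
  "2.23606 \<le> sqrt 5" "sqrt 5 \<le> 2.23607" "2.44948 \<le> sqrt 6" "sqrt 6 \<le> 2.4495"
  "2.64575 \<le> sqrt 7" "sqrt 7 \<le> 2.64576" "3.16227 \<le> sqrt 10" "sqrt 10 \<le> 3.16228"
  "3.24037 \<le> sqrt (21 / 2)" "sqrt 4 = 2" "sqrt 9 = 3" "sqrt 8 = 2 * sqrt 2"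
proof -
  have "sqrt 4 = sqrt (2 ^ 2)" "sqrt 9 = sqrt (3 ^ 2)" "sqrt 8 = sqrt (2 ^ 2 * 2)" by simp_all
  then show "sqrt 4 = 2" "sqrt 9 = 3" "sqrt 8 = 2 * sqrt 2"
    by (simp_all only: real_sqrt_abs real_sqrt_mult)
qed (((rule real_le_rsqrt | rule real_le_lsqrt); simp add: power2_eq_square)+)

lemma zeta_half_bounds: "- 1.463 \<le> Re (zeta (1 / 2))" "Re (zeta (1 / 2)) \<le> - 1.4595"
proof -
  have inv: "1 / sqrt x = sqrt x / x" if "x > 0" for x :: real
    using that by (simp add: divide_simps)
  have sum: "(\<Sum>n=1..10. 1 / sqrt (real n)) = 1 + sqrt 2 / 2 + sqrt 3 / 3 + 1 / 2 + sqrt 5 / 5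
      + sqrt 6 / 6 + sqrt 7 / 7 + sqrt 2 / 4 + 1 / 3 + sqrt 10 / 10"
    unfolding sum_1_to_10 by (simp add: inv sqrt_bounds real_div_sqrt)
  show "- 1.463 \<le> Re (zeta (1 / 2))"
    using zeta_half_lower[of 10] sqrt_bounds inv[of 10] unfolding sum by simp
  show "Re (zeta (1 / 2)) \<le> - 1.4595"
    using zeta_half_upper[of 10] sqrt_bounds unfolding sum by simp
qed

lemma zeta_3_2_numeric: "2.611 \<le> (\<Sum>n. real (Suc n) powr - (3 / 2))" "(\<Sum>n. real (Suc n) powr - (3 / 2)) \<le> 2.63"
proof -
  have inv: "1 / (x * sqrt x) = sqrt x / x ^ 2" "1 / sqrt x = sqrt x / x" if "x > 0" for x :: real
    using that by (simp_all add: divide_simps power2_eq_square)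
  have sum: "(\<Sum>n=1..10. 1 / (real n * sqrt (real n))) = 1 + sqrt 2 / 4 + sqrt 3 / 9 + 1 / 8 + sqrt 5 / 25
      + sqrt 6 / 36 + sqrt 7 / 49 + sqrt 2 / 32 + 1 / 27 + sqrt 10 / 100"
    unfolding sum_1_to_10 by (simp add: inv sqrt_bounds real_div_sqrt)
  show "2.611 \<le> (\<Sum>n. real (Suc n) powr - (3 / 2))"
    using zeta_3_2_bounds(1)[of 10] sqrt_bounds inv[of 10] unfolding sum by simp
  show "(\<Sum>n. real (Suc n) powr - (3 / 2)) \<le> 2.63"
    using zeta_3_2_bounds(2)[of 10] sqrt_bounds inv[of 10] unfolding sum by simp
qed

text \<open>
  The factor is \<open>(1 - a)(1 + b)\<close> with \<open>0 \<le> b \<le> a \<le> 1\<close>, hence at most 1. Beyond 100 the defect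
  \<open>(1/r + 1/r\<^sup>2) / (n (n + 1))\<close> is at most \<open>(1/10 + 1/100) / n\<^sup>2\<close>.
\<close>
lemma C2_residual_limit_bounds:
  assumes lim: "(\<lambda>N. \<Prod>p\<in>primes_le N. C2_residual_factor p) \<longlonglongrightarrow> L"
  shows "0.7096 * (1 - 11 / 20000) \<le> L" "L \<le> 0.7097"
proof -
  define h where "h n = 11 / 100 / real n ^ 2" for n
  define H where "H n = 11 / 200 / real n" for n
  have ab: "1 / (sqrt p * (real p + 1)) \<le> 1 / (p * sqrt p)" "1 / (p * sqrt p) \<le> 1" if "p > 0" for p :: nat
  proof -
    have "sqrt p \<ge> 1" using that by simp
    moreover have "real p \<ge> 1" using that by simp
    ultimately have "1 * 1 \<le> p * sqrt p" by (intro mult_mono) auto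
    then show "1 / (p * sqrt p) \<le> 1" by (simp add: divide_simps)
    show "1 / (sqrt p * (real p + 1)) \<le> 1 / (p * sqrt p)"
      using that by (intro divide_left_mono mult_pos_pos) (auto simp: algebra_simps)
  qed
  have f: "0 \<le> C2_residual_factor p \<and> C2_residual_factor p \<le> 1" if "prime p" for p
  proof -
    have p: "p > 0" using that by (rule prime_gt_0_nat)
    define a b where "a = 1 / (p * sqrt p)" and "b = 1 / (sqrt p * (real p + 1))"
    have "0 \<le> b" "b \<le> a" "a \<le> 1" using ab[OF p] by (simp_all add: a_def b_def)
    moreover have "(1 - a) * (1 + b) \<le> (1 - a) * (1 + a)" using calculation by (intro mult_left_mono) auto
    moreover have "(1 - a) * (1 + a) = 1 - a\<^sup>2" by (simp add: power2_eq_square algebra_simps)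
    moreover have "a\<^sup>2 \<ge> 0" by simp
    ultimately show ?thesis unfolding C2_residual_factor_def a_def[symmetric] b_def[symmetric]
      by (intro conjI mult_nonneg_nonneg) linarith+
  qed
  have hH: "0 \<le> h n \<and> h n \<le> 1 \<and> 1 - h n \<le> C2_residual_factor n \<and> h n \<le> H (n - 1) - H (n + 1)"
    if "n > 100" for n
  proof -
    have n: "real n > 100" using that by simp
    define r where "r = sqrt (real n)"
    have r: "r * r = real n" "r > 10" using n by (auto simp: r_def intro: real_less_rsqrt)
    have "1 - C2_residual_factor n = (1 / r + 1 / (r * r)) / (real n * (real n + 1))"
    proof -
      have "r > 0" "r * r + 1 > 0" using r by (auto intro: add_pos_pos)
      then show ?thesis unfolding C2_residual_factor_def r_def[symmetric] r(1)[symmetric]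
        by (simp add: divide_simps) (simp add: algebra_simps)
    qed
    also have "\<dots> \<le> (11 / 100) / real n ^ 2"
    proof (rule frac_le)
      have "1 / r \<le> 1 / 10" using r by (intro divide_left_mono) auto
      moreover have "1 / (r * r) \<le> 1 / 100" unfolding r(1) using n by (intro divide_left_mono) auto
      ultimately show "1 / r + 1 / (r * r) \<le> 11 / 100" by linarith
      show "real n ^ 2 \<le> real n * (real n + 1)" by (simp add: power2_eq_square algebra_simps)
    qed (use n in auto)
    finally have 1: "1 - h n \<le> C2_residual_factor n" by (simp add: h_def)
    have "1 * 1 \<le> real n * real n" using n by (intro mult_mono) auto
    then have 2: "h n \<le> 1" unfolding h_def power2_eq_square by (simp add: divide_simps)
    have "11 / 100 * (1 / real n ^ 2) \<le> 11 / 100 * ((1 / (real n - 1) - 1 / (real n + 1)) / 2)"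
      using inverse_square_telescope[of "real n"] n by (intro mult_left_mono) auto
    moreover have "11 / 100 * y \<le> 11 / 200 * a - 11 / 200 * b" if "11 / 100 * y \<le> 11 / 100 * ((a - b) / 2)"
      for y a b :: real using that by (simp add: field_simps)
    ultimately have "11 / 100 * (1 / real n ^ 2) \<le> 11 / 200 * (1 / (real n - 1)) - 11 / 200 * (1 / (real n + 1))"
      by blast
    moreover have "h n = 11 / 100 * (1 / real n ^ 2)" "H (n - 1) = 11 / 200 * (1 / (real n - 1))"
        "H (n + 1) = 11 / 200 * (1 / (real n + 1))"
      using that by (simp_all add: h_def H_def of_nat_diff)
    ultimately have "h n \<le> H (n - 1) - H (n + 1)" by simp
    then show ?thesis using 1 2 by (simp add: h_def)
  qed
  have H: "H n \<ge> 0" for n by (simp add: H_def)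
  note bounds = euler_product_limit_bounds[OF lim f, of 100 h H]
  have "L \<le> (\<Prod>p\<in>primes_le 100. C2_residual_factor p)" by (rule bounds(1)) (use hH H in auto)
  also have "\<dots> \<le> 0.7097" using C2_residual_product_100 by simp
  finally show "L \<le> 0.7097" .
  have "0.7096 * (1 - H 100) \<le> (\<Prod>p\<in>primes_le 100. C2_residual_factor p) * (1 - H 100)"
    using C2_residual_product_100 by (intro mult_right_mono) (auto simp: H_def)
  also have "\<dots> \<le> L" by (rule bounds(2)) (use hH H in auto)
  finally show "0.7096 * (1 - 11 / 20000) \<le> L" by (simp add: H_def)
qed

lemma C2_bounds: "- 5.5 < C2" "C2 \<le> - 5.4"
proof -
  define z Z where "z = (\<Sum>n. real (Suc n) powr - (3 / 2))" and "Z = - Re (zeta (1 / 2))"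
  define L where "L = (pi\<^sup>2 / 6) * infsum (pair_weight 1 (1 / 2)) shifted_pairs / z"
  have z: "2.611 \<le> z" "z \<le> 2.63" using zeta_3_2_numeric by (simp_all add: z_def)
  have Z: "1.4595 \<le> Z" "Z \<le> 1.463" using zeta_half_bounds by (simp_all add: Z_def)
  have L: "0.7096 * (1 - 11 / 20000) \<le> L" "L \<le> 0.7097"
    using C2_residual_limit_bounds[OF C2_residual_product] by (simp_all add: L_def z_def)
  have C2: "C2 = - (2 * (Z * (z * L)))" using z(1) by (simp add: C2_eq L_def Z_def)
  have "1.4595 * (2.611 * (0.7096 * (1 - 11 / 20000))) \<le> Z * (z * L)"
    using z Z L by (intro mult_mono) auto
  then show "C2 \<le> - 5.4" unfolding C2 by simp
  have "Z * (z * L) \<le> 1.463 * (2.63 * 0.7097)"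
    using z Z L by (intro mult_mono) auto
  then show "- 5.5 < C2" unfolding C2 by simp
qed

theorem theorem1:
  shows "(\<forall>\<epsilon>::real. \<epsilon> > 0 \<longrightarrow>
      (\<lambda>x::real. (\<Sum>m\<in>{1..nat \<lfloor>x\<rfloor>}. \<Sum>n\<in>{1..nat \<lfloor>x\<rfloor>}. real (tau12 (m * n)))
          - (C1 * x ^ 2 + C2 * x powr (3 / 2)))
        \<in> O[at_top](\<lambda>x. x powr (10 / 7 + \<epsilon>)))
    \<and> 2.995 \<le> C1 \<and> C1 < 2.996
    \<and> - 5.5 < C2 \<and> C2 \<le> - 5.4"
  using double_sum_bigo C1_bounds C2_bounds by blast

end
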